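(* Let $A$ be a unital $\mathrm{C}^*$-algebra. Then the following conditions are equivalent. (i) The additive group $A$ with the norm topology is SUR. (ii) The additive group $A_{\mathrm{sa}}$ with the norm topology is SUR. (iii) $\mathcal{U}(A)_u$ is SUR. (iv) $A$ is finite-dimensional.
   Context: $A_{\mathrm{sa}}$ is the set of self-adjoint elements of $A$. $\mathcal{U}(A)$ is the unitary group of $A$, and $\mathcal{U}(A)_u$ denotes it equipped with the norm topology. A Hausdorff topological group $G$ is strongly unitarily representable (SUR) if $G$ is isomorphic as a topological group to a closed subgroup of the unitary group $\mathcal{U}(H)$ of some (complex) Hilbert space $H$, where $\mathcal{U}(H)$ is equipped with the strong operator topology. *)

theory Defs
  imports "HOL-Analysis.Analysis" "HOL-Algebra.Module" "HOL-Algebra.Bij"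
begin

section \<open>Unital C*-algebras\<close>

text \<open>
  The ring structure and the norm are those of the class of real normed algebras; \<open>scaleC\<close> extends
  the real scaling to complex scalars. The unit comes from \<^class>\<open>monoid_mult\<close> rather than from
  \<^class>\<open>ring_1\<close>, so that the zero algebra (where \<open>1 = 0\<close>) is not excluded. Neither \<open>norm 1 = 1\<close>
  (for \<open>1 \<noteq> 0\<close>) nor the isometry of the involution needs to be assumed.
\<close>

class unital_cstar_algebra = real_normed_algebra + complete_space + monoid_mult +
  fixes scaleC :: "complex \<Rightarrow> 'a \<Rightarrow> 'a"  (infixr \<open>*\<^sub>C\<close> 75)
    and star :: "'a \<Rightarrow> 'a"
  assumes scaleC_of_real: "complex_of_real r *\<^sub>C x = r *\<^sub>R x"
    and scaleC_add_right: "c *\<^sub>C (x + y) = c *\<^sub>C x + c *\<^sub>C y"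
    and scaleC_add_left: "(c + d) *\<^sub>C x = c *\<^sub>C x + d *\<^sub>C x"
    and scaleC_scaleC: "c *\<^sub>C d *\<^sub>C x = (c * d) *\<^sub>C x"
    and scaleC_mult_left: "(c *\<^sub>C x) * y = c *\<^sub>C (x * y)"
    and scaleC_mult_right: "x * (c *\<^sub>C y) = c *\<^sub>C (x * y)"
    and norm_scaleC: "norm (c *\<^sub>C x) = cmod c * norm x"
    and star_star: "star (star x) = x"
    and star_add: "star (x + y) = star x + star y"
    and star_scaleC: "star (c *\<^sub>C x) = cnj c *\<^sub>C star x"
    and star_mult: "star (x * y) = star y * star x"
    and cstar_identity: "norm (star x * x) = (norm x)\<^sup>2"

global_interpretation complex_vector:
  vector_space "scaleC :: complex \<Rightarrow> 'a \<Rightarrow> 'a::unital_cstar_algebra"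
  defines cspan = complex_vector.span
proof
  show "1 *\<^sub>C x = x" for x :: 'a
    using scaleC_of_real[of 1 x] by simp
qed (simp_all add: scaleC_add_right scaleC_add_left scaleC_scaleC)

definition finite_dimensional :: "'a::unital_cstar_algebra itself \<Rightarrow> bool" where
  "finite_dimensional _ \<longleftrightarrow> (\<exists>B :: 'a set. finite B \<and> cspan B = UNIV)"

definition self_adjoints :: "'a::unital_cstar_algebra set" where
  "self_adjoints = {x. star x = x}"

definition unitaries :: "'a::unital_cstar_algebra set" where
  "unitaries = {u. star u * u = 1 \<and> u * star u = 1}"

definition additive_group :: "'a::ab_group_add set \<Rightarrow> 'a monoid" where
  "additive_group S = \<lparr>carrier = S, monoid.mult = (+), one = 0\<rparr>"

definition unitary_group :: "'a::unital_cstar_algebra monoid" where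
  "unitary_group = \<lparr>carrier = unitaries, monoid.mult = (*), one = 1\<rparr>"


section \<open>Complex Hilbert spaces on a carrier set\<close>

text \<open>
  The definition of strong unitary representability quantifies existentially over Hilbert spaces, so
  these are structures on a carrier set and not types of some class. As always for
  \<^locale>\<open>module\<close>, the ring multiplication and unit of the record are irrelevant here.
\<close>

record 'h inner_product_space = "(complex, 'h) module" +
  cinner :: "'h \<Rightarrow> 'h \<Rightarrow> complex"

definition complex_ring :: "complex ring" where
  "complex_ring = \<lparr>carrier = UNIV, monoid.mult = (*), one = 1, zero = 0, add = (+)\<rparr>"

text \<open>The value \<open>0\<close> outside the carrier matches the conventions of \<^locale>\<open>Metric_space\<close>.\<close>

definition hdist :: "('h, 'm) inner_product_space_scheme \<Rightarrow> 'h \<Rightarrow> 'h \<Rightarrow> real" where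
  "hdist H x y =
     (if x \<in> carrier H \<and> y \<in> carrier H
      then sqrt (Re (cinner H (x \<ominus>\<^bsub>H\<^esub> y) (x \<ominus>\<^bsub>H\<^esub> y))) else 0)"

locale complex_hilbert_space = Module.module complex_ring H
  for H :: "('h, 'm) inner_product_space_scheme" (structure) +
  assumes cinner_add_left:
      "\<lbrakk>x \<in> carrier H; y \<in> carrier H; z \<in> carrier H\<rbrakk> \<Longrightarrow>
        cinner H (x \<oplus> y) z = cinner H x z + cinner H y z"
    and cinner_smult_left:
      "\<lbrakk>x \<in> carrier H; y \<in> carrier H\<rbrakk> \<Longrightarrow> cinner H (c \<odot> x) y = c * cinner H x y"
    and cinner_commute:
      "\<lbrakk>x \<in> carrier H; y \<in> carrier H\<rbrakk> \<Longrightarrow> cinner H y x = cnj (cinner H x y)"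
    and cinner_pos:
      "\<lbrakk>x \<in> carrier H; x \<noteq> \<zero>\<rbrakk> \<Longrightarrow> 0 < Re (cinner H x x)"
    and complete: "Metric_space.mcomplete (carrier H) (hdist H)"

text \<open>
  A unitary operator is a linear bijection of the carrier that preserves the inner product. As in
  \<^const>\<open>BijGroup\<close>, operators are extensional functions.
\<close>

definition unitary_operators :: "('h, 'm) inner_product_space_scheme \<Rightarrow> ('h \<Rightarrow> 'h) set" where
  "unitary_operators H =
     {U \<in> Bij (carrier H).
        (\<forall>x\<in>carrier H. \<forall>y\<in>carrier H. U (x \<oplus>\<^bsub>H\<^esub> y) = U x \<oplus>\<^bsub>H\<^esub> U y) \<and>
        (\<forall>c. \<forall>x\<in>carrier H. U (c \<odot>\<^bsub>H\<^esub> x) = c \<odot>\<^bsub>H\<^esub> U x) \<and>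
        (\<forall>x\<in>carrier H. \<forall>y\<in>carrier H. cinner H (U x) (U y) = cinner H x y)}"

definition unitary_operator_group ::
    "('h, 'm) inner_product_space_scheme \<Rightarrow> ('h \<Rightarrow> 'h) monoid" where
  "unitary_operator_group H = BijGroup (carrier H)\<lparr>carrier := unitary_operators H\<rparr>"

text \<open>The strong operator topology is the topology of pointwise convergence in norm.\<close>

definition strong_operator_topology ::
    "('h, 'm) inner_product_space_scheme \<Rightarrow> ('h \<Rightarrow> 'h) topology" where
  "strong_operator_topology H =
     subtopology
       (product_topology (\<lambda>_. Metric_space.mtopology (carrier H) (hdist H)) (carrier H))
       (unitary_operators H)"


section \<open>Strongly unitarily representable groups\<close>

definition topological_group :: "('g, 'm) monoid_scheme \<Rightarrow> 'g topology \<Rightarrow> bool" where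
  "topological_group G T \<longleftrightarrow>
     group G \<and> topspace T = carrier G \<and>
     continuous_map (prod_topology T T) T (\<lambda>(x, y). x \<otimes>\<^bsub>G\<^esub> y) \<and>
     continuous_map T T (\<lambda>x. inv\<^bsub>G\<^esub> x)"

text \<open>
  HOL cannot quantify existentially over types, so the type \<open>'h\<close> in which the Hilbert spaces have
  their carriers is a parameter. It should be kept arbitrary, subject only to a lower bound on its
  cardinality where Hilbert spaces have to be constructed: any set of Hilbert spaces can be realised
  on a common type \<open>'h\<close>, while on too small a type there are not enough of them (a nonzero complex
  Hilbert space has at least the cardinality of the continuum).
\<close>

definition strongly_unitarily_representable ::
    "'h itself \<Rightarrow> ('g, 'm) monoid_scheme \<Rightarrow> 'g topology \<Rightarrow> bool" where
  "strongly_unitarily_representable _ G T \<longleftrightarrow>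
     topological_group G T \<and> Hausdorff_space T \<and>
     (\<exists>(H :: 'h inner_product_space) K f.
        complex_hilbert_space H \<and>
        subgroup K (unitary_operator_group H) \<and>
        closedin (strong_operator_topology H) K \<and>
        f \<in> iso G (unitary_operator_group H\<lparr>carrier := K\<rparr>) \<and>
        homeomorphic_map T (subtopology (strong_operator_topology H) K) f)"

end

theory Submission
  imports Defs "HOL-Library.Function_Algebras"
begin

text \<open>
  Each of the three groups is strongly unitarily representable exactly when the algebra is
  finite-dimensional.

  \<^bold>\<open>Infinite dimension is an obstruction.\<close> An infinite-dimensional C*-algebra contains, for every \<open>n\<close>,
  self-adjoint elements \<open>h\<^sub>1, \<dots>, h\<^sub>n\<close> of norm 1 with pairwise products 0, and all sums
  \<open>\<plusminus>h\<^sub>1 \<plusminus> \<dots> \<plusminus> h\<^sub>n\<close> then have norm at most 1. A Hilbert space does not tolerate this. Suppose that all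
  products of the form \<open>g\<^sub>1\<^sup>\<plusminus>\<^sup>1 \<dots> g\<^sub>n\<^sup>\<plusminus>\<^sup>1\<close>, with factors possibly omitted, move a vector \<open>x\<close> by at most \<open>\<eta>\<close>,
  and average \<open>x\<close> over the signs, one \<open>g\<^sub>k\<close> at a time. By the parallelogram law the step \<open>v \<mapsto> (g\<^sub>k v + g\<^sub>k\<^sup>-\<^sup>1 v) / 2\<close> lowers the
  squared norm by a quarter of the square of \<open>\<parallel>g\<^sub>k v - g\<^sub>k\<^sup>-\<^sup>1 v\<parallel> = \<parallel>g\<^sub>k\<^sup>2 v - v\<parallel>\<close>. All these losses together
  are at most \<open>\<parallel>x\<parallel>\<^sup>2\<close>, so for large \<open>n\<close> one \<open>g\<^sub>k\<^sup>2\<close> hardly moves the average \<open>v\<close>, which is still within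
  \<open>\<eta>\<close> of \<open>x\<close>. Hence \<open>g\<^sub>k\<^sup>2\<^sup>m\<close> moves \<open>x\<close> by little more than \<open>2\<eta>\<close> for all \<open>m \<le> M\<close>, where \<open>M\<close> was fixed
  before \<open>n\<close> (\<open>some_even_powers_small\<close>, \<open>even_powers_small_if_representable\<close>). This contradicts the
  choice \<open>g\<^sub>k = r h\<^sub>k\<close> in the additive groups, where \<open>2 M r > 1\<close>, and the choice \<open>g\<^sub>k = exp (\<i> arcsin (r h\<^sub>k))\<close>
  in the unitary group, where repeated squaring leaves the ball of radius \<open>1/2\<close> about 1.

  \<^bold>\<open>Finding the orthogonal elements.\<close> The binomial series of \<open>sqrt (1 - x)\<close> converges absolutely on the
  closed unit ball and provides absolute values, so every self-adjoint \<open>w\<close> splits into the orthogonal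
  parts \<open>\<bar>w\<bar> + w\<close> and \<open>\<bar>w\<bar> - w\<close>. If orthogonal families have bounded size, let \<open>h\<close> be a member of one of
  maximal size and consider the self-adjoint elements orthogonal to the other members. No two nonzero ones
  among them are orthogonal, so \<open>\<bar>w\<bar> = w\<close> or \<open>\<bar>w\<bar> = - w\<close> for each of them. Rotating \<open>y\<close> into \<open>- y\<close> through
  \<open>cos t y + sin t z\<close> changes the sign, hence passes through 0, and \<open>y\<close>, \<open>z\<close> are linearly dependent. So
  \<open>h\<close> is a multiple of a projection \<open>p\<close> with \<open>p A p = \<complex> p\<close>; by maximality these projections add up to 1, and
  \<open>A\<close> is the sum of the corners \<open>p A q\<close>, whose dimensions are at most 1 (\<open>minimal_projections_if_bounded\<close>,
  \<open>corner_one_dimensional\<close>).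

  \<^bold>\<open>Finite dimension is sufficient.\<close> The same projections yield bounded coordinates and a trace inner
  product. The unitary group acts on \<open>A\<close> itself by left multiplication, and a closed additive subgroup acts
  on \<open>L\<^sup>2[0,1]\<close> through multiplication by functions of modulus 1 that encode the coordinates. In both actions
  the orbit map of one vector (the constant 1) has a uniformly continuous inverse; since the group is
  complete, it follows that the image is closed in the strong operator topology and that the
  representation is an embedding (\<open>representable_if_uniform_orbit\<close>).
\<close>

instance unital_cstar_algebra \<subseteq> banach ..

section \<open>Elementary C*-algebra\<close>

lemma scaleC_one [simp]: "1 *\<^sub>C x = (x::'a::unital_cstar_algebra)"
  by (fact complex_vector.scale_one)

lemma star_zero [simp]: "star (0::'a::unital_cstar_algebra) = 0"
  using star_add[of "0::'a" 0] by simp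

lemma star_minus: "star (- x) = - star (x::'a::unital_cstar_algebra)"
  using star_add[of x "- x"] by (simp add: add_eq_0_iff)

lemma star_diff: "star (x - y) = star x - star (y::'a::unital_cstar_algebra)"
  using star_add[of x "- y"] by (simp add: star_minus)

lemma star_one [simp]: "star (1::'a::unital_cstar_algebra) = 1"
  by (metis mult.left_neutral mult.right_neutral star_mult star_star)

lemma star_scaleR: "star (r *\<^sub>R x) = r *\<^sub>R star (x::'a::unital_cstar_algebra)"
  by (metis complex_cnj_complex_of_real scaleC_of_real star_scaleC)

lemma star_sum: "star (sum f S) = (\<Sum>i\<in>S. star (f i :: 'a::unital_cstar_algebra))"
  by (induction S rule: infinite_finite_induct) (simp_all add: star_add)

lemma star_power: "star (x ^ n) = star (x::'a::unital_cstar_algebra) ^ n"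
  by (induction n) (simp_all add: star_mult power_commutes)

text \<open>
  The C*-identity bounds \<open>\<parallel>x\<parallel>\<^sup>2\<close> by \<open>\<parallel>x*\<parallel> \<parallel>x\<parallel>\<close>. Applied to \<open>x*\<close> as well, this makes the
  involution isometric.
\<close>

lemma norm_le_norm_star: "norm (x::'a::unital_cstar_algebra) \<le> norm (star x)"
proof (cases "x = 0")
  case False
  have "norm x * norm x \<le> norm (star x) * norm x"
    using norm_mult_ineq[of "star x" x] by (simp add: cstar_identity power2_eq_square)
  with False show ?thesis by simp
qed simp

lemma norm_star [simp]: "norm (star x) = norm (x::'a::unital_cstar_algebra)"
  by (metis norm_le_norm_star order_antisym star_star)

lemma bounded_linear_star: "bounded_linear (star :: 'a::unital_cstar_algebra \<Rightarrow> 'a)"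
  by (rule bounded_linear_intro[where K = 1]) (simp_all add: star_add star_scaleR)

lemmas continuous_on_star [continuous_intros] =
  bounded_linear.continuous_on[OF bounded_linear_star]

lemma norm_one_le: "norm (1::'a::unital_cstar_algebra) \<le> 1"
proof -
  have "norm (1::'a) = norm (1::'a) * norm (1::'a)"
    using cstar_identity[of "1::'a"] by (simp add: power2_eq_square)
  then have "norm (1::'a) = 0 \<or> norm (1::'a) = 1"
    by (metis mult_cancel_right1 mult_eq_0_iff)
  then show ?thesis by auto
qed

text \<open>In the zero algebra the norm of a unitary is 0, hence no equality.\<close>

lemma norm_unitary_le:
  assumes "star u * u = (1::'a::unital_cstar_algebra)" shows "norm u \<le> 1"
proof -
  have "(norm u)\<^sup>2 \<le> 1"
    using cstar_identity[of u] assms norm_one_le[where 'a='a] by simp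
  then show ?thesis by (simp add: abs_square_le_1)
qed

lemma norm_power_le:
  fixes x :: "'a::unital_cstar_algebra"
  shows "norm (x ^ n) \<le> norm x ^ n"
proof (induction n)
  case (Suc n)
  have "norm (x * x ^ n) \<le> norm x * norm (x ^ n)" by (rule norm_mult_ineq)
  also have "\<dots> \<le> norm x * norm x ^ n" by (intro mult_left_mono Suc.IH) simp
  finally show ?case by simp
qed (simp add: norm_one_le)

lemma norm_square_self_adjoint:
  assumes "star x = (x::'a::unital_cstar_algebra)" shows "norm (x * x) = (norm x)\<^sup>2"
  using cstar_identity[of x] assms by simp

lemma self_adjoint_square_zero:
  assumes "star x = (x::'a::unital_cstar_algebra)" "x * x = 0" shows "x = 0"
  using norm_square_self_adjoint[of x] assms by simp

text \<open>
  The C*-identity computes norms of squares only, so powers of two are the exponents at which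
  the norm is multiplicative. Through this fact the norm of a self-adjoint element is visible in
  its high powers.
\<close>

lemma power2_powers_norm_self_adjoint:
  assumes "star x = (x::'a::unital_cstar_algebra)" shows "norm (x ^ (2 ^ k)) = norm x ^ (2 ^ k)"
proof (induction k)
  case (Suc k)
  have "x ^ (2 ^ Suc k) = x ^ (2 ^ k) * x ^ (2 ^ k)"
    by (simp add: mult_2 power_add)
  then show ?case
    using norm_square_self_adjoint[of "x ^ (2 ^ k)"] assms Suc.IH
    by (simp add: star_power power_mult[symmetric] mult.commute)
qed simp

lemma real_imaginary_parts:
  fixes x :: "'a::unital_cstar_algebra"
  obtains a b where "star a = a" "star b = b" "x = a + \<i> *\<^sub>C b"
proof
  let ?a = "(1/2) *\<^sub>R (x + star x)" and ?b = "(-\<i>/2) *\<^sub>C (x - star x)"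
  show "star ?a = ?a" by (simp add: star_scaleR star_add star_star add.commute)
  have "(\<i>/2) *\<^sub>C (star x - x) = (-\<i>/2) *\<^sub>C (x - star x)"
    by (metis complex_vector.scale_minus_left complex_vector.scale_minus_right
        minus_diff_eq minus_divide_left)
  then show "star ?b = ?b" by (simp add: star_scaleC star_diff star_star star_minus)
  have "\<i> *\<^sub>C ?b = (1/2::real) *\<^sub>R (x - star x)"
    using scaleC_of_real[of "1/2" "x - star x"] by (simp add: scaleC_scaleC)
  moreover have "(1/2) *\<^sub>R x + (1/2) *\<^sub>R x = x"
    by (simp flip: scaleR_left_distrib)
  ultimately show "x = ?a + \<i> *\<^sub>C ?b"
    by (simp add: scaleR_add_right scaleR_diff_right del: complex_vector.scale_scale)
qed

lemma norm_real_part_le: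
  fixes a b :: "'a::unital_cstar_algebra"
  assumes "star a = a" "star b = b" shows "norm a \<le> norm (a + \<i> *\<^sub>C b)"
proof -
  let ?x = "a + \<i> *\<^sub>C b"
  have "?x + star ?x = 2 *\<^sub>R a"
    using assms by (simp add: star_add star_scaleC scaleR_2)
  then have "2 * norm a \<le> norm ?x + norm (star ?x)"
    by (metis norm_triangle_ineq norm_scaleR abs_numeral)
  then show ?thesis by (simp del: norm_star add: norm_star)
qed

lemma norm_imaginary_part_le:
  fixes a b :: "'a::unital_cstar_algebra"
  assumes "star a = a" "star b = b" shows "norm b \<le> norm (a + \<i> *\<^sub>C b)"
proof -
  have "norm b \<le> norm (b + \<i> *\<^sub>C (- a))"
    using assms by (intro norm_real_part_le) (simp_all add: star_minus)
  also have "b + \<i> *\<^sub>C (- a) = (-\<i>) *\<^sub>C (a + \<i> *\<^sub>C b)"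
    by (simp add: scaleC_add_right scaleC_scaleC)
  finally show ?thesis by (simp add: norm_scaleC)
qed

text \<open>
  The sum of squares is \<open>z* z\<close> for the normal element \<open>z = x + \<i> y\<close>. A square is therefore the
  negative of another commuting square only if both vanish; this is how positivity enters below.
\<close>

lemma self_adjoint_sum_squares_zero:
  fixes x y :: "'a::unital_cstar_algebra"
  assumes "star x = x" "star y = y" "x * y = y * x" "x * x + y * y = 0"
  shows "x = 0" "y = 0"
proof -
  have "star (x + \<i> *\<^sub>C y) * (x + \<i> *\<^sub>C y) = x * x + y * y"
    using assms(1-3)
    by (simp add: star_add star_scaleC algebra_simps scaleC_mult_left scaleC_mult_right
        scaleC_scaleC scaleC_add_right)
  then have "(norm (x + \<i> *\<^sub>C y))\<^sup>2 = 0"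
    using cstar_identity[of "x + \<i> *\<^sub>C y"] assms(4) by simp
  then have "norm (x + \<i> *\<^sub>C y) = 0" by simp
  then show "x = 0" "y = 0"
    using norm_real_part_le[OF assms(1,2)] norm_imaginary_part_le[OF assms(1,2)] by auto
qed

lemma power_add_orthogonal:
  fixes x y :: "'a::unital_cstar_algebra"
  assumes "x * y = 0" "y * x = 0"
  shows "(x + y) ^ Suc n = x ^ Suc n + y ^ Suc n"
proof (induction n)
  case (Suc n)
  have "x * y ^ Suc n = 0" "y * x ^ Suc n = 0"
    using assms by (simp_all flip: mult.assoc)
  then show ?case
    using Suc.IH by (simp only: power_Suc[of _ "Suc n"] distrib_left distrib_right) simp
qed simp

text \<open>
  Powers of an orthogonal sum are the sums of the powers, hence have norm at most 2, whereas the
  powers of order \<open>2 ^ k\<close> of an element of norm above 1 are unbounded in norm.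
\<close>

lemma norm_add_orthogonal:
  fixes x y :: "'a::unital_cstar_algebra"
  assumes "star x = x" "star y = y" "x * y = 0" "norm x \<le> 1" "norm y \<le> 1"
  shows "norm (x + y) \<le> 1"
proof (rule ccontr)
  assume "\<not> norm (x + y) \<le> 1"
  then have gt: "1 < norm (x + y)" by simp
  have yx: "y * x = 0"
    using assms(1-3) by (metis star_mult star_zero)
  obtain k where "2 < norm (x + y) ^ k"
    using gt real_arch_pow by blast
  moreover have "norm (x + y) ^ k \<le> norm (x + y) ^ (2 ^ k)"
    using gt by (intro power_increasing) (auto intro: less_imp_le less_exp)
  moreover obtain n where n: "2 ^ k = Suc n"
    by (metis nat.exhaust power_not_zero zero_neq_numeral)
  have "norm (x + y) ^ (2 ^ k) = norm ((x + y) ^ (2 ^ k))"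
    using assms(1,2) by (subst power2_powers_norm_self_adjoint) (simp_all add: star_add)
  moreover have "norm ((x + y) ^ (2 ^ k)) \<le> norm (x ^ Suc n) + norm (y ^ Suc n)"
    unfolding n power_add_orthogonal[OF assms(3) yx] by (rule norm_triangle_ineq)
  moreover have "norm (x ^ Suc n) \<le> 1" "norm (y ^ Suc n) \<le> 1"
    using norm_power_le[of x "Suc n"] norm_power_le[of y "Suc n"] assms(4,5)
    by (meson norm_ge_zero order_trans power_le_one)+
  ultimately show False by linarith
qed

section \<open>Square roots and absolute values\<close>

text \<open>The Taylor coefficients of \<open>sqrt (1 - x)\<close> at 0.\<close>

definition sqrt_coeff :: "nat \<Rightarrow> real" where
  "sqrt_coeff n = (-1) ^ n * ((1/2) gchoose n)"

lemma signed_gbinomial_Suc: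
  fixes a :: real
  shows "real (Suc n) * ((-1) ^ Suc n * (a gchoose Suc n)) = (real n - a) * ((-1) ^ n * (a gchoose n))"
proof -
  have "real (Suc n) * (a gchoose Suc n) = (a - real n) * (a gchoose n)"
    using gbinomial_mult_1[of a n] by (simp add: algebra_simps)
  then have "- ((-1) ^ n) * (real (Suc n) * (a gchoose Suc n))
      = - ((-1) ^ n) * ((a - real n) * (a gchoose n))"
    by simp
  then show ?thesis by (simp add: algebra_simps)
qed

lemma sqrt_coeff_0 [simp]: "sqrt_coeff 0 = 1"
  by (simp add: sqrt_coeff_def)

lemma sqrt_coeff_nonpos: "sqrt_coeff (Suc n) \<le> 0"
proof (induction n)
  case (Suc n)
  have "real (Suc (Suc n)) * sqrt_coeff (Suc (Suc n)) = (real (Suc n) - 1/2) * sqrt_coeff (Suc n)"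
    unfolding sqrt_coeff_def by (rule signed_gbinomial_Suc)
  also have "\<dots> \<le> 0"
    using Suc.IH by (intro mult_nonneg_nonpos) auto
  finally show ?case
    by (metis mult_le_0_iff not_le of_nat_0_less_iff zero_less_Suc)
qed (simp add: sqrt_coeff_def)

lemma sum_sqrt_coeff_nonneg: "0 \<le> (\<Sum>k\<le>n. sqrt_coeff k)"
proof -
  have *: "0 \<le> (-1) ^ m * ((-1/2 :: real) gchoose m)" for m
  proof (induction m)
    case (Suc m)
    have "0 \<le> (real m - (-1/2)) * ((-1) ^ m * ((-1/2 :: real) gchoose m))"
      by (rule mult_nonneg_nonneg[OF _ Suc.IH]) simp
    then have "0 \<le> real (Suc m) * ((-1) ^ Suc m * ((-1/2 :: real) gchoose Suc m))"
      by (simp only: signed_gbinomial_Suc)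
    then show ?case
      by (metis not_le mult_pos_neg of_nat_0_less_iff zero_less_Suc)
  qed simp
  have "(\<Sum>k\<le>n. sqrt_coeff k) = (\<Sum>k\<le>n. ((1/2 :: real) gchoose k) * (-1) ^ k)"
    by (simp add: sqrt_coeff_def mult.commute)
  also have "\<dots> = (-1) ^ n * ((1/2 - 1 :: real) gchoose n)"
    by (rule gbinomial_sum_lower_neg)
  finally show ?thesis using *[of n] by simp
qed

text \<open>
  All coefficients after the first are nonpositive and the partial sums at \<open>x = 1\<close> are
  nonnegative, so the absolute values sum to at most 2. Convergence on the whole closed unit
  ball is essential: the series will be evaluated at \<open>1 - h\<^sup>2\<close>, whose norm may be 1.
\<close>

lemma summable_abs_sqrt_coeff: "summable (\<lambda>n. \<bar>sqrt_coeff n\<bar>)"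
proof (rule summableI_nonneg_bounded)
  fix n
  have "(\<Sum>i<n. \<bar>sqrt_coeff i\<bar>) \<le> (\<Sum>i\<le>n. \<bar>sqrt_coeff i\<bar>)"
    by (rule sum_mono2) auto
  also have "\<dots> = (\<Sum>i\<le>n. (if i = 0 then 2 else 0) - sqrt_coeff i)"
  proof (rule sum.cong)
    show "\<bar>sqrt_coeff i\<bar> = (if i = 0 then 2 else 0) - sqrt_coeff i" for i
      using sqrt_coeff_nonpos[of "i - 1"] by (cases i) auto
  qed simp
  also have "\<dots> \<le> 2"
    using sum_sqrt_coeff_nonneg[of n] by (simp add: sum_subtractf)
  finally show "(\<Sum>i<n. \<bar>sqrt_coeff i\<bar>) \<le> 2" .
qed simp

lemma sqrt_coeff_convolution:
  "(\<Sum>i\<le>n. sqrt_coeff i * sqrt_coeff (n - i)) = (if n = 0 then 1 else if n = 1 then -1 else 0)"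
proof -
  have "(\<Sum>i\<le>n. sqrt_coeff i * sqrt_coeff (n - i))
      = (\<Sum>i\<in>{0..n}. (-1) ^ n * ((1/2 gchoose i) * (1/2 gchoose (n - i))))"
  proof (rule sum.cong)
    fix i assume "i \<in> {0..n}"
    then have "(-1::real) ^ n = (-1) ^ i * (-1) ^ (n - i)"
      by (simp flip: power_add)
    then show "sqrt_coeff i * sqrt_coeff (n - i)
        = (-1) ^ n * ((1/2 gchoose i) * (1/2 gchoose (n - i)))"
      by (simp add: sqrt_coeff_def)
  qed auto
  also have "\<dots> = (-1) ^ n * ((1/2 + 1/2 :: real) gchoose n)"
    by (simp only: sum_distrib_left[symmetric] gbinomial_Vandermonde)
  also have "\<dots> = (-1) ^ n * real (1 choose n)"
    using binomial_gbinomial[of 1 n, where 'a = real] by simp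
  also have "\<dots> = (if n = 0 then 1 else if n = 1 then -1 else 0)"
    by (auto simp: binomial_eq_0)
  finally show ?thesis .
qed

text \<open>
  The value of \<open>sqrt (1 - x)\<close> at \<open>x = 1\<close>, read off from the convolution identity: the square of
  the sum is \<open>1 - 1\<close>.
\<close>

lemma suminf_sqrt_coeff: "(\<Sum>n. sqrt_coeff n) = 0"
proof -
  have "(\<Sum>n. sqrt_coeff n) * (\<Sum>n. sqrt_coeff n)
      = (\<Sum>n. \<Sum>i\<le>n. sqrt_coeff i * sqrt_coeff (n - i))"
    using summable_abs_sqrt_coeff by (intro Cauchy_product) simp_all
  also have "\<dots> = (\<Sum>n. if n = 0 then 1 else if n = 1 then -1 else 0)"
    by (simp only: sqrt_coeff_convolution)
  also have "\<dots> = (\<Sum>n\<in>{0,1::nat}. if n = 0 then 1 else if n = 1 then -1 else 0)"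
    by (rule suminf_finite) auto
  finally show ?thesis by simp
qed

definition sqrt_one_minus :: "'a::unital_cstar_algebra \<Rightarrow> 'a" where
  "sqrt_one_minus x = (\<Sum>n. sqrt_coeff n *\<^sub>R x ^ n)"

context
  fixes x :: "'a::unital_cstar_algebra"
  assumes x: "norm x \<le> 1"
begin

lemma norm_sqrt_term_le: "norm (sqrt_coeff n *\<^sub>R x ^ n) \<le> \<bar>sqrt_coeff n\<bar>"
proof -
  have "norm (x ^ n) \<le> 1"
    using norm_power_le[of x n] x by (meson norm_ge_zero order_trans power_le_one)
  then show ?thesis by (simp add: mult_left_le)
qed

lemma summable_norm_sqrt: "summable (\<lambda>n. norm (sqrt_coeff n *\<^sub>R x ^ n))"
  using norm_sqrt_term_le by (intro summable_comparison_test'[OF summable_abs_sqrt_coeff, of 0]) simp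

lemma summable_sqrt: "summable (\<lambda>n. sqrt_coeff n *\<^sub>R x ^ n)"
  by (rule summable_norm_cancel[OF summable_norm_sqrt])

lemma sqrt_one_minus_square: "sqrt_one_minus x * sqrt_one_minus x = 1 - x"
proof -
  have "sqrt_one_minus x * sqrt_one_minus x
      = (\<Sum>n. \<Sum>i\<le>n. (sqrt_coeff i *\<^sub>R x ^ i) * (sqrt_coeff (n - i) *\<^sub>R x ^ (n - i)))"
    unfolding sqrt_one_minus_def using summable_norm_sqrt by (intro Cauchy_product)
  also have "\<dots> = (\<Sum>n. (if n = 0 then 1 else if n = 1 then -1 else 0) *\<^sub>R x ^ n)"
  proof (rule suminf_cong)
    fix n
    have "(\<Sum>i\<le>n. (sqrt_coeff i *\<^sub>R x ^ i) * (sqrt_coeff (n - i) *\<^sub>R x ^ (n - i)))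
        = (\<Sum>i\<le>n. (sqrt_coeff i * sqrt_coeff (n - i)) *\<^sub>R x ^ n)"
      by (rule sum.cong) (simp_all flip: power_add)
    then show "(\<Sum>i\<le>n. (sqrt_coeff i *\<^sub>R x ^ i) * (sqrt_coeff (n - i) *\<^sub>R x ^ (n - i)))
        = (if n = 0 then 1 else if n = 1 then -1 else 0) *\<^sub>R x ^ n"
      by (simp only: scaleR_sum_left[symmetric] sqrt_coeff_convolution)
  qed
  also have "\<dots> = (\<Sum>n\<in>{0,1}. (if n = 0 then 1 else if n = 1 then -1 else 0) *\<^sub>R x ^ n)"
    by (rule suminf_finite) auto
  finally show ?thesis by simp
qed

lemma sqrt_one_minus_mult: "sqrt_one_minus x * y = (\<Sum>n. sqrt_coeff n *\<^sub>R (x ^ n * y))"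
  unfolding sqrt_one_minus_def
  using bounded_linear.suminf[OF bounded_linear_mult_left summable_sqrt, of y] by simp

lemma mult_sqrt_one_minus: "y * sqrt_one_minus x = (\<Sum>n. sqrt_coeff n *\<^sub>R (y * x ^ n))"
  unfolding sqrt_one_minus_def
  using bounded_linear.suminf[OF bounded_linear_mult_right summable_sqrt, of y] by simp

lemma sqrt_one_minus_commute:
  assumes "x * y = y * x" shows "sqrt_one_minus x * y = y * sqrt_one_minus x"
proof -
  have "x ^ n * y = y * x ^ n" for n
    using assms power_commuting_commutes by metis
  then show ?thesis by (simp add: sqrt_one_minus_mult mult_sqrt_one_minus)
qed

lemma star_sqrt_one_minus:
  assumes "star x = x" shows "star (sqrt_one_minus x) = sqrt_one_minus x"
  unfolding sqrt_one_minus_def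
  using bounded_linear.suminf[OF bounded_linear_star summable_sqrt] assms
  by (simp add: star_scaleR star_power)

text \<open>Where \<open>x\<close> acts as 1, the series acts as \<open>sqrt (1 - 1)\<close>.\<close>

lemma sqrt_one_minus_mult_fixed:
  assumes "x * y = y" shows "sqrt_one_minus x * y = 0"
proof -
  have "x ^ n * y = y" for n
    using assms by (induction n) (simp_all add: power_commutes mult.assoc)
  moreover have "(\<Sum>n. sqrt_coeff n *\<^sub>R y) = (\<Sum>n. sqrt_coeff n) *\<^sub>R y"
    using bounded_linear.suminf[OF bounded_linear_scaleR_left, of sqrt_coeff y]
      summable_rabs_cancel[OF summable_abs_sqrt_coeff] by simp
  ultimately show ?thesis by (simp add: sqrt_one_minus_mult suminf_sqrt_coeff)
qed

lemma sqrt_one_minus_mult_annihilated: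
  assumes "x * y = 0" shows "sqrt_one_minus x * y = y"
proof -
  have "sqrt_coeff n *\<^sub>R (x ^ n * y) = (if n = 0 then y else 0)" for n
    using assms by (cases n) (simp_all add: mult.assoc power_Suc2 del: power_Suc)
  then show ?thesis
    using suminf_finite[of "{0}" "\<lambda>n. if n = 0 then y else 0"] by (simp add: sqrt_one_minus_mult)
qed

end

lemma continuous_on_sqrt_one_minus:
  "continuous_on (cball 0 1) (sqrt_one_minus :: 'a::unital_cstar_algebra \<Rightarrow> 'a)"
proof (rule uniform_limit_theorem)
  show "uniform_limit (cball 0 1) (\<lambda>n x. \<Sum>i<n. sqrt_coeff i *\<^sub>R x ^ i)
      (sqrt_one_minus :: 'a \<Rightarrow> 'a) sequentially"
    unfolding sqrt_one_minus_def[abs_def]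
    by (rule Weierstrass_m_test[OF norm_sqrt_term_le summable_abs_sqrt_coeff]) simp
  have "continuous_on S (\<lambda>x::'a. x ^ n)" for n S
    by (induction n) (auto intro!: continuous_intros)
  then show "\<forall>\<^sub>F n in sequentially.
      continuous_on (cball 0 1) (\<lambda>x::'a. \<Sum>i<n. sqrt_coeff i *\<^sub>R x ^ i)"
    by (intro always_eventually allI continuous_intros)
qed simp

text \<open>For a real number \<open>h\<close> in \<open>[-1, 1]\<close> this is \<open>exp (\<i> arcsin h)\<close>.\<close>

definition cis_arcsin :: "'a::unital_cstar_algebra \<Rightarrow> 'a" where
  "cis_arcsin h = sqrt_one_minus (h * h) + \<i> *\<^sub>C h"

context
  fixes h :: "'a::unital_cstar_algebra"
  assumes sa: "star h = h" and h: "norm h \<le> 1"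
begin

lemma norm_square_le_1: "norm (h * h) \<le> 1"
  using norm_square_self_adjoint[OF sa] h by (simp add: power_le_one)

lemma star_sqrt_one_minus_square: "star (sqrt_one_minus (h * h)) = sqrt_one_minus (h * h)"
  by (intro star_sqrt_one_minus norm_square_le_1) (simp add: star_mult sa)

lemma sqrt_one_minus_square_commute: "sqrt_one_minus (h * h) * h = h * sqrt_one_minus (h * h)"
  by (intro sqrt_one_minus_commute norm_square_le_1) (simp add: mult.assoc)

lemma star_cis_arcsin:
  "star (cis_arcsin h) = cis_arcsin (- h)"
  by (simp add: cis_arcsin_def star_add star_scaleC star_sqrt_one_minus_square sa)

lemma cis_arcsin_unitary:
  "cis_arcsin h * cis_arcsin (- h) = 1"
  "cis_arcsin (- h) * cis_arcsin h = 1"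
  unfolding cis_arcsin_def
  by (simp_all add: algebra_simps scaleC_mult_left scaleC_mult_right scaleC_scaleC
      sqrt_one_minus_square_commute sqrt_one_minus_square[OF norm_square_le_1])

lemma norm_sqrt_one_minus_square_le: "norm (sqrt_one_minus (h * h)) \<le> 1"
proof -
  have "norm (sqrt_one_minus (h * h)) \<le> norm (cis_arcsin h)"
    unfolding cis_arcsin_def
    by (rule norm_real_part_le[OF star_sqrt_one_minus_square sa])
  also have "\<dots> \<le> 1"
    by (rule norm_unitary_le)
      (simp add: star_cis_arcsin cis_arcsin_unitary)
  finally show ?thesis .
qed

text \<open>
  The element \<open>sqrt (1 - h\<^sup>2)\<close> is the real part of a unitary, so its norm is at most 1; its
  square is \<open>1 - h\<^sup>2\<close>. This puts \<open>1 - h\<^sup>2\<close> into the domain of the square root series.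
\<close>

lemma norm_one_minus_square_le: "norm (1 - h * h) \<le> 1"
proof -
  have "norm (1 - h * h) = (norm (sqrt_one_minus (h * h)))\<^sup>2"
    by (simp flip: norm_square_self_adjoint[OF star_sqrt_one_minus_square]
        sqrt_one_minus_square[OF norm_square_le_1])
  then show ?thesis by (simp add: norm_sqrt_one_minus_square_le power_le_one)
qed

end

text \<open>
  The square root of \<open>h\<^sup>2\<close>, written as \<open>1 - (1 - h\<^sup>2)\<close>; meaningful for self-adjoint \<open>h\<close> of norm
  at most 1.
\<close>

definition absolute_value :: "'a::unital_cstar_algebra \<Rightarrow> 'a" where
  "absolute_value h = sqrt_one_minus (1 - h * h)"

context
  fixes h :: "'a::unital_cstar_algebra"
  assumes sa: "star h = h" and h: "norm h \<le> 1"
begin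

lemma star_absolute_value: "star (absolute_value h) = absolute_value h"
  unfolding absolute_value_def
  by (intro star_sqrt_one_minus norm_one_minus_square_le sa h) (simp add: star_diff star_mult sa)

lemma absolute_value_square: "absolute_value h * absolute_value h = h * h"
  unfolding absolute_value_def
  by (subst sqrt_one_minus_square[OF norm_one_minus_square_le[OF sa h]]) simp

lemma absolute_value_commute: "absolute_value h * h = h * absolute_value h"
  unfolding absolute_value_def
  by (intro sqrt_one_minus_commute norm_one_minus_square_le sa h) (simp add: algebra_simps)

lemma absolute_value_annihilates:
  assumes "h * y = 0" shows "absolute_value h * y = 0"
  unfolding absolute_value_def
  by (intro sqrt_one_minus_mult_fixed norm_one_minus_square_le sa h)
    (simp add: algebra_simps assms)

end

lemma absolute_value_minus: "absolute_value (- h) = absolute_value h"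
  by (simp add: absolute_value_def)

section \<open>Orthogonal families and minimal projections\<close>

text \<open>
  For each \<open>w\<close> in the unit ball of \<open>I\<close> the product of \<open>\<bar>w\<bar> + w\<close> and \<open>\<bar>w\<bar> - w\<close> vanishes, so \<open>w\<close>
  has a sign: \<open>\<bar>w\<bar> = w\<close> or \<open>\<bar>w\<bar> = - w\<close>. Both conditions are closed. Along the half circle from
  \<open>y\<close> to \<open>- y\<close> through \<open>z\<close> the sign changes, so by connectedness some point of the half circle
  has both signs and is 0.
\<close>

lemma dim_le_one_if_no_orthogonal_pair:
  fixes I :: "'a::unital_cstar_algebra set"
  assumes sa: "\<And>x. x \<in> I \<Longrightarrow> star x = x"
    and add: "\<And>x y. x \<in> I \<Longrightarrow> y \<in> I \<Longrightarrow> x + y \<in> I"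
    and scale: "\<And>r x. x \<in> I \<Longrightarrow> r *\<^sub>R x \<in> I"
    and abs: "\<And>x. x \<in> I \<Longrightarrow> norm x \<le> 1 \<Longrightarrow> absolute_value x \<in> I"
    and no_orth: "\<And>x y. x \<in> I \<Longrightarrow> y \<in> I \<Longrightarrow> x * y = 0 \<Longrightarrow> x = 0 \<or> y = 0"
    and y: "y \<in> I" and z: "z \<in> I" "z \<noteq> 0"
  shows "\<exists>t. y = t *\<^sub>R z"
proof -
  \<comment> \<open>Scaling by \<open>s\<close> keeps the half circle in the unit ball, where absolute values are defined.\<close>
  define s where "s = inverse (norm y + norm z)"
  define w where "w t = s *\<^sub>R (cos t *\<^sub>R y + sin t *\<^sub>R z)" for t
  have s: "0 < s"
    using z by (simp add: s_def add_nonneg_pos)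
  have wI: "w t \<in> I" for t
    unfolding w_def by (intro add scale y z)
  have w1: "norm (w t) \<le> 1" for t
  proof -
    have "norm (cos t *\<^sub>R y + sin t *\<^sub>R z) \<le> \<bar>cos t\<bar> * norm y + \<bar>sin t\<bar> * norm z"
      by (rule order_trans[OF norm_triangle_ineq]) simp
    also have "\<dots> \<le> 1 * norm y + 1 * norm z"
      by (intro add_mono mult_right_mono) simp_all
    finally have "norm (w t) \<le> s * (norm y + norm z)"
      using s by (simp add: w_def)
    then show ?thesis using s by (simp add: s_def)
  qed
  have dichotomy: "absolute_value (w t) = w t \<or> absolute_value (w t) = - w t" for t
  proof -
    let ?a = "absolute_value (w t)"
    have "(?a + w t) * (?a - w t) = 0"
      using absolute_value_square[OF sa[OF wI] w1] absolute_value_commute[OF sa[OF wI] w1]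
      by (simp add: algebra_simps)
    moreover have "?a + w t \<in> I" "?a - w t \<in> I"
      using add[OF abs[OF wI w1] wI] add[OF abs[OF wI w1] scale[OF wI, of "-1"]] by simp_all
    ultimately show ?thesis
      using no_orth by (fastforce simp: eq_neg_iff_add_eq_0)
  qed
  have cont_w: "continuous_on {0..pi} w"
    unfolding w_def by (intro continuous_intros)
  have cont_a: "continuous_on {0..pi} (\<lambda>t. absolute_value (w t))"
    unfolding absolute_value_def
  proof (rule continuous_on_compose2[OF continuous_on_sqrt_one_minus])
    show "continuous_on {0..pi} (\<lambda>t. 1 - w t * w t)"
      by (intro continuous_intros cont_w)
    show "(\<lambda>t. 1 - w t * w t) ` {0..pi} \<subseteq> cball 0 1"
      using norm_one_minus_square_le[OF sa[OF wI] w1] by auto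
  qed
  let ?P = "{t \<in> {0..pi}. absolute_value (w t) - w t = 0}"
  let ?N = "{t \<in> {0..pi}. absolute_value (w t) + w t = 0}"
  have "closed ?P" "closed ?N"
    by (intro continuous_closed_preimage_constant continuous_intros cont_w cont_a closed_atLeastAtMost)+
  moreover have "{0..pi} \<subseteq> ?P \<union> ?N"
    using dichotomy by (auto simp: eq_neg_iff_add_eq_0)
  \<comment> \<open>The endpoints of the half circle are negatives of each other and so have opposite signs.\<close>
  moreover have "?P \<inter> {0..pi} \<noteq> {} \<and> ?N \<inter> {0..pi} \<noteq> {}"
  proof -
    have "w pi = - w 0" by (simp add: w_def)
    then have "0 \<in> ?P \<and> pi \<in> ?N \<or> 0 \<in> ?N \<and> pi \<in> ?P"
      using dichotomy[of 0] by (auto simp: absolute_value_minus)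
    then show ?thesis by blast
  qed
  ultimately have "?P \<inter> ?N \<inter> {0..pi} \<noteq> {}"
    using connected_Icc[of 0 pi] unfolding connected_closed by blast
  then obtain t where "absolute_value (w t) = w t" "absolute_value (w t) + w t = 0"
    by auto
  then have "2 *\<^sub>R w t = 0" by (simp add: scaleR_2)
  then have wt: "cos t *\<^sub>R y + sin t *\<^sub>R z = 0"
    using s by (simp add: w_def)
  have "cos t \<noteq> 0"
  proof
    assume c: "cos t = 0"
    then have "sin t \<noteq> 0" using sin_cos_squared_add[of t] by auto
    with c wt z show False by simp
  qed
  then have "y = inverse (cos t) *\<^sub>R (cos t *\<^sub>R y)" by simp
  also have "cos t *\<^sub>R y = - (sin t *\<^sub>R z)"
    using wt by (simp add: eq_neg_iff_add_eq_0)
  finally have "y = (- inverse (cos t) * sin t) *\<^sub>R z" by simp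
  then show ?thesis by blast
qed

definition orthogonal_family :: "'a::unital_cstar_algebra set \<Rightarrow> bool" where
  "orthogonal_family F \<longleftrightarrow>
    (\<forall>x\<in>F. star x = x \<and> x \<noteq> 0) \<and> pairwise (\<lambda>x y. x * y = 0) F"

text \<open>For self-adjoint elements, \<open>x y = 0\<close> implies \<open>y x = 0\<close>.\<close>

lemma orthogonal_family_insert:
  assumes "orthogonal_family F" "star x = x" "x \<noteq> 0" "\<And>y. y \<in> F \<Longrightarrow> x * y = 0"
  shows "orthogonal_family (insert x F)" "x \<notin> F"
proof -
  have "y * x = 0" if "y \<in> F" for y
    using assms that unfolding orthogonal_family_def by (metis star_mult star_zero)
  then show "orthogonal_family (insert x F)"
    using assms by (auto simp: orthogonal_family_def pairwise_insert)
  show "x \<notin> F"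
    using assms self_adjoint_square_zero by blast
qed

lemma orthogonal_family_subset: "orthogonal_family F \<Longrightarrow> E \<subseteq> F \<Longrightarrow> orthogonal_family E"
  unfolding orthogonal_family_def by (blast intro: pairwise_subset)

text \<open>
  In a direct sum of full matrix algebras such a set consists of the diagonal matrix units.
\<close>

locale minimal_projections =
  fixes P :: "'a::unital_cstar_algebra set"
  assumes finite_P: "finite P"
    and nonzero: "p \<in> P \<Longrightarrow> p \<noteq> 0"
    and self_adjoint: "p \<in> P \<Longrightarrow> star p = p"
    and idempotent: "p \<in> P \<Longrightarrow> p * p = p"
    and orthogonal: "p \<in> P \<Longrightarrow> q \<in> P \<Longrightarrow> p \<noteq> q \<Longrightarrow> p * q = 0"
    and sum_eq_1: "\<Sum>P = 1"
    and minimal: "p \<in> P \<Longrightarrow> \<exists>c. p * x * p = c *\<^sub>C p"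

text \<open>
  Take an orthogonal family \<open>F\<close> of maximal size. For \<open>h \<in> F\<close> let \<open>I h\<close> be the self-adjoint
  elements orthogonal to the rest of \<open>F\<close>. Two orthogonal nonzero elements of \<open>I h\<close> could replace
  \<open>h\<close> and enlarge the family, so \<open>I h\<close> is the line through \<open>h\<close>. As \<open>h\<^sup>2 \<in> I h\<close>, a multiple \<open>p\<close>
  of \<open>h\<close> is a projection, and \<open>p a p \<in> I h\<close> for every self-adjoint \<open>a\<close>. The defect of the sum of
  these projections from 1 is orthogonal to \<open>F\<close>, hence 0.
\<close>

theorem minimal_projections_if_bounded:
  assumes bound: "\<And>F :: 'a::unital_cstar_algebra set. finite F \<Longrightarrow> orthogonal_family F \<Longrightarrow> card F \<le> N"
  obtains P :: "'a::unital_cstar_algebra set" where "minimal_projections P"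
proof -
  let ?fam = "\<lambda>F :: 'a set. finite F \<and> orthogonal_family F"
  have "\<exists>F. ?fam F \<and> (\<forall>E. ?fam E \<longrightarrow> card E \<le> card F)"
    by (rule ex_has_greatest_nat[where k = "{}" and b = "Suc N"])
      (simp_all add: orthogonal_family_def[of "{}"] less_Suc_eq_le bound)
  then obtain F where F: "?fam F" and max: "\<And>E. ?fam E \<Longrightarrow> card E \<le> card F"
    by meson
  have maximal: "x = 0" if "star x = x" "\<And>y. y \<in> F \<Longrightarrow> x * y = 0" for x
  proof (rule ccontr)
    assume "x \<noteq> 0"
    then have "orthogonal_family (insert x F)" "x \<notin> F"
      using orthogonal_family_insert F that by blast+
    then show False using max[of "insert x F"] F by simp
  qed
  define I where "I h = {x. star x = x \<and> (\<forall>k\<in>F - {h}. x * k = 0)}" for h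
  have one_dim: "\<exists>t. y = t *\<^sub>R h" if h: "h \<in> F" and y: "y \<in> I h" for h y
  proof (rule dim_le_one_if_no_orthogonal_pair[where I = "I h"])
    show "star x = x" if "x \<in> I h" for x using that by (simp add: I_def)
    show "x + y \<in> I h" if "x \<in> I h" "y \<in> I h" for x y
      using that by (simp add: I_def star_add distrib_right)
    show "r *\<^sub>R x \<in> I h" if "x \<in> I h" for r x
      using that by (simp add: I_def star_scaleR)
    show "absolute_value x \<in> I h" if "x \<in> I h" "norm x \<le> 1" for x
      using that by (simp add: I_def star_absolute_value absolute_value_annihilates)
    show "h \<in> I h" "h \<noteq> 0"
      using F h by (auto simp: I_def orthogonal_family_def pairwise_def)
    show "x = 0 \<or> y = 0" if x: "x \<in> I h" and y: "y \<in> I h" and xy: "x * y = 0" for x y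
    proof (rule ccontr)
      assume "\<not> (x = 0 \<or> y = 0)"
      then have "x \<noteq> 0" "y \<noteq> 0" by auto
      have Fh: "orthogonal_family (F - {h})"
        using F by (rule conjunct2[THEN orthogonal_family_subset]) blast
      have xs: "star x = x" "\<And>k. k \<in> F - {h} \<Longrightarrow> x * k = 0"
        and ys: "star y = y" "\<And>k. k \<in> F - {h} \<Longrightarrow> y * k = 0"
        using x y by (simp_all add: I_def)
      have E: "orthogonal_family (insert y (F - {h}))" "y \<notin> F - {h}"
        using orthogonal_family_insert[OF Fh ys(1) \<open>y \<noteq> 0\<close>] ys(2) by blast+
      have "x * k = 0" if "k \<in> insert y (F - {h})" for k
        using that xy xs(2) by blast
      then have E': "orthogonal_family (insert x (insert y (F - {h})))" "x \<notin> insert y (F - {h})"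
        using orthogonal_family_insert[OF E(1) xs(1) \<open>x \<noteq> 0\<close>] by blast+
      have "card (insert x (insert y (F - {h}))) = Suc (Suc (card (F - {h})))"
        using F card_insert_disjoint[OF _ E'(2)] card_insert_disjoint[OF _ E(2)]
        by (simp only: finite_insert finite_Diff)
      also have "\<dots> = Suc (card F)"
        using F h by (simp only: card_Suc_Diff1)
      finally have "card (insert x (insert y (F - {h}))) = Suc (card F)" .
      then show False
        using max[of "insert x (insert y (F - {h}))"] F E'(1) by simp
    qed
  qed (use y in auto)
  have "\<exists>t. t \<noteq> 0 \<and> h * h = t *\<^sub>R h" if h: "h \<in> F" for h
  proof -
    have "star h = h" "\<And>k. k \<in> F - {h} \<Longrightarrow> h * k = 0"
      using F h by (auto simp: orthogonal_family_def pairwise_def)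
    then have "h * h \<in> I h"
      by (simp add: I_def star_mult mult.assoc)
    then obtain t where t: "h * h = t *\<^sub>R h"
      using one_dim[OF h] by blast
    moreover have "t \<noteq> 0"
    proof
      assume "t = 0"
      then have "h = 0" using t F h self_adjoint_square_zero by (auto simp: orthogonal_family_def)
      then show False using F h by (auto simp: orthogonal_family_def)
    qed
    ultimately show ?thesis by blast
  qed
  then obtain t where t: "\<And>h. h \<in> F \<Longrightarrow> t h \<noteq> 0 \<and> h * h = t h *\<^sub>R h" by metis
  define proj where "proj h = inverse (t h) *\<^sub>R h" for h
  have h_eq: "h = t h *\<^sub>R proj h" if "h \<in> F" for h
    using t[OF that] by (simp add: proj_def)
  have idem: "proj h * proj h = proj h" if "h \<in> F" for h
    using t[OF that] by (simp add: proj_def)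
  have sa: "star (proj h) = proj h" if "h \<in> F" for h
    using F that by (simp add: proj_def star_scaleR orthogonal_family_def)
  have orth: "proj h * proj k = 0" if "h \<in> F" "k \<in> F" "h \<noteq> k" for h k
    using F that by (auto simp: proj_def orthogonal_family_def pairwise_def)
  have nz: "proj h \<noteq> 0" if "h \<in> F" for h
    using F t[OF that] that by (auto simp: proj_def orthogonal_family_def)
  have inj: "inj_on proj F"
    using orth idem nz by (metis inj_onI)
  have "minimal_projections (proj ` F)"
  proof
    show "\<Sum>(proj ` F) = 1"
    proof -
      have "1 - (\<Sum>h\<in>F. proj h) = 0"
      proof (rule maximal)
        show "star (1 - (\<Sum>h\<in>F. proj h)) = 1 - (\<Sum>h\<in>F. proj h)"
          by (simp add: star_diff star_sum sa)
        fix k assume k: "k \<in> F"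
        have "(\<Sum>h\<in>F. proj h) * proj k = (\<Sum>h\<in>F. if h = k then proj k else 0)"
          unfolding sum_distrib_right using k by (intro sum.cong) (auto simp: idem orth)
        also have "\<dots> = proj k" using F k by simp
        finally have "(1 - (\<Sum>h\<in>F. proj h)) * proj k = 0" by (simp add: left_diff_distrib)
        then have "(1 - (\<Sum>h\<in>F. proj h)) * (t k *\<^sub>R proj k) = 0" by simp
        then show "(1 - (\<Sum>h\<in>F. proj h)) * k = 0" using h_eq[OF k] by simp
      qed
      then show ?thesis by (simp add: sum.reindex[OF inj])
    qed
    fix p x assume "p \<in> proj ` F"
    then obtain h where h: "h \<in> F" "p = proj h" by blast
    have *: "\<exists>r. p * a * p = r *\<^sub>R p" if "star a = a" for a
    proof -
      have "p * k = 0" if "k \<in> F - {h}" for k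
      proof -
        have "p * k = p * (t k *\<^sub>R proj k)" using h_eq[of k] that by simp
        then show ?thesis using orth[of h k] that h by auto
      qed
      then have "p * a * p \<in> I h"
        using that sa h by (auto simp: I_def star_mult mult.assoc)
      then obtain r where "p * a * p = r *\<^sub>R h" using one_dim h by blast
      then have "p * a * p = (r * t h) *\<^sub>R p"
        using h_eq[OF h(1)] h(2) by (metis scaleR_scaleR)
      then show ?thesis by blast
    qed
    obtain a b :: 'a where ab: "star a = a" "star b = b" "x = a + \<i> *\<^sub>C b"
      by (rule real_imaginary_parts)
    obtain r s where "p * a * p = r *\<^sub>R p" "p * b * p = s *\<^sub>R p"
      using * ab by blast
    then have "p * x * p = (of_real r + \<i> * of_real s) *\<^sub>C p"
      by (simp add: ab(3) distrib_left distrib_right scaleC_mult_left scaleC_mult_right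
          scaleC_add_left scaleC_of_real flip: scaleC_scaleC)
    then show "\<exists>c. p * x * p = c *\<^sub>C p" by blast
  qed (use F nz sa idem in \<open>auto intro!: orth\<close>)
  then show ?thesis by (rule that)
qed

section \<open>Finite-dimensional C*-algebras\<close>

text \<open>Multiplying a linear relation by one member of the family isolates its coefficient.\<close>

lemma card_orthogonal_family_le:
  fixes F B :: "'a::unital_cstar_algebra set"
  assumes B: "finite B" "cspan B = UNIV" and F: "orthogonal_family F"
  shows "card F \<le> card B"
proof -
  have "complex_vector.independent F"
    unfolding complex_vector.dependent_explicit
  proof (clarify)
    fix t u v assume t: "finite t" "t \<subseteq> F" "(\<Sum>v\<in>t. u v *\<^sub>C v) = 0" and v: "v \<in> t" "u v \<noteq> 0"
    have "0 = (\<Sum>w\<in>t. u w *\<^sub>C w) * v" by (simp add: t)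
    also have "\<dots> = (\<Sum>w\<in>t. if w = v then u v *\<^sub>C (v * v) else 0)"
      unfolding sum_distrib_right using F t(2) v(1)
      by (intro sum.cong) (auto simp: orthogonal_family_def pairwise_def scaleC_mult_left subset_iff)
    also have "\<dots> = u v *\<^sub>C (v * v)" using t(1) v(1) by simp
    finally have "v * v = 0" using v(2) by simp
    moreover have "star v = v" "v \<noteq> 0"
      using F t(2) v(1) by (auto simp: orthogonal_family_def)
    ultimately show False using self_adjoint_square_zero by blast
  qed
  then show ?thesis
    using complex_vector.independent_span_bound[OF B(1)] B(2) by auto
qed

context minimal_projections
begin

lemma norm_projection: "p \<in> P \<Longrightarrow> norm p = 1"
  using norm_square_self_adjoint[of p] self_adjoint idempotent nonzero
  by (simp add: power2_eq_square)

lemma mult_projections: "p \<in> P \<Longrightarrow> q \<in> P \<Longrightarrow> p * q = (if p = q then p else 0)"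
  by (simp add: idempotent orthogonal)

lemma mult_projections_assoc:
  "p \<in> P \<Longrightarrow> q \<in> P \<Longrightarrow> p * (q * x) = (if p = q then p * x else 0)"
  by (simp add: mult_projections flip: mult.assoc)

lemma sum_left_corners: "(\<Sum>p\<in>P. p * x) = x"
  by (simp add: sum_eq_1 flip: sum_distrib_right)

lemma sum_right_corners: "(\<Sum>p\<in>P. x * p) = x"
  by (simp add: sum_eq_1 flip: sum_distrib_left)

lemma sum_corners: "(\<Sum>p\<in>P. \<Sum>q\<in>P. p * x * q) = x"
  by (simp add: sum_right_corners sum_left_corners)

text \<open>
  For a matrix algebra and a diagonal matrix unit \<open>p\<close>, \<open>tau p x\<close> is the corresponding diagonal
  entry of \<open>x\<close>.
\<close>

definition tau :: "'a \<Rightarrow> 'a \<Rightarrow> complex" where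
  "tau p x = (THE c. p * x * p = c *\<^sub>C p)"

lemma tau_eqI:
  assumes "p \<in> P" "p * x * p = c *\<^sub>C p" shows "tau p x = c"
  unfolding tau_def
  by (rule the_equality) (use assms nonzero in auto)

lemma corner_eq: "p \<in> P \<Longrightarrow> p * x * p = tau p x *\<^sub>C p"
  using minimal tau_eqI by metis

lemma tau_add: "p \<in> P \<Longrightarrow> tau p (x + y) = tau p x + tau p y"
  by (rule tau_eqI) (simp_all add: distrib_left distrib_right corner_eq scaleC_add_left)

lemma tau_scaleC: "p \<in> P \<Longrightarrow> tau p (c *\<^sub>C x) = c * tau p x"
  by (rule tau_eqI) (simp_all add: scaleC_mult_left scaleC_mult_right corner_eq scaleC_scaleC)

lemma tau_star:
  assumes p: "p \<in> P" shows "tau p (star x) = cnj (tau p x)"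
proof (rule tau_eqI[OF p])
  have "p * star x * p = star (p * x * p)"
    using p by (simp add: star_mult self_adjoint mult.assoc)
  then show "p * star x * p = cnj (tau p x) *\<^sub>C p"
    using p by (simp add: corner_eq star_scaleC self_adjoint)
qed

lemma norm_tau: "p \<in> P \<Longrightarrow> cmod (tau p x) = norm (p * x * p)"
  by (simp add: corner_eq norm_scaleC norm_projection)

lemma norm_corner_le: "p \<in> P \<Longrightarrow> q \<in> P \<Longrightarrow> norm (p * x * q) \<le> norm x"
  using norm_mult_ineq[of "p * x" q] norm_mult_ineq[of p x] by (simp add: norm_projection)

lemma bounded_linear_tau: "p \<in> P \<Longrightarrow> bounded_linear (tau p)"
proof (rule bounded_linear_intro[where K = 1])
  show "tau p (r *\<^sub>R x) = r *\<^sub>R tau p x" if "p \<in> P" for r x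
    using tau_scaleC[OF that, of "of_real r" x] by (simp add: scaleC_of_real scaleR_conv_of_real)
qed (simp_all add: tau_add norm_tau norm_corner_le)

text \<open>
  If \<open>z\<close> is a nonzero element of \<open>p A q\<close>, then \<open>z* z = l q\<close> with \<open>l \<noteq> 0\<close> and \<open>y z* = m p\<close> for
  each \<open>y\<close> in \<open>p A q\<close>, by minimality of \<open>q\<close> and \<open>p\<close>. Hence \<open>l y = y z* z = m z\<close>.
\<close>

lemma corner_one_dimensional:
  assumes p: "p \<in> P" and q: "q \<in> P"
  shows "\<exists>e. (e = 0 \<or> norm e = 1) \<and> p * e * q = e \<and> (\<forall>x. \<exists>c. p * x * q = c *\<^sub>C e)"
proof (cases "\<forall>x. p * x * q = 0")
  case True
  then show ?thesis by (intro exI[of _ 0]) simp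
next
  case False
  then obtain x where x: "p * x * q \<noteq> 0" by blast
  define z where "z = p * x * q"
  have pz: "p * z = z" and zq: "z * q = z" and z: "z \<noteq> 0"
    using x p q by (simp_all add: z_def mult.assoc mult_projections mult_projections_assoc)
  have sz: "star z * p = star z" "q * star z = star z"
    using arg_cong[OF pz, of star] arg_cong[OF zq, of star] by (simp_all add: star_mult self_adjoint p q)
  define l where "l = tau q (star z * z)"
  have l: "star z * z = l *\<^sub>C q"
    using corner_eq[OF q, of "star z * z"] by (simp add: l_def sz zq mult.assoc flip: mult.assoc[of q])
  have "l \<noteq> 0"
    using l z cstar_identity[of z] by auto
  have ex: "\<exists>c. p * y * q = c *\<^sub>C z" for y
  proof -
    define m where "m = tau p (p * y * q * star z)"
    have "p * (p * y * q * star z) * p = m *\<^sub>C p"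
      unfolding m_def by (rule corner_eq[OF p])
    then have "p * y * q * star z = m *\<^sub>C p"
      by (simp add: mult.assoc sz mult_projections_assoc p)
    then have "p * y * q * (star z * z) = m *\<^sub>C z"
      by (simp add: scaleC_mult_left pz flip: mult.assoc)
    then have "l *\<^sub>C (p * y * q) = m *\<^sub>C z"
      by (simp add: l scaleC_mult_right mult.assoc idempotent q)
    then have "p * y * q = (m / l) *\<^sub>C z"
      using \<open>l \<noteq> 0\<close> by (metis (no_types, lifting) complex_vector.scale_left_imp_eq
          nonzero_mult_div_cancel_left scaleC_scaleC times_divide_eq_right)
    then show ?thesis by blast
  qed
  let ?e = "of_real (inverse (norm z)) *\<^sub>C z"
  have "norm ?e = 1" using z by (simp add: norm_scaleC norm_inverse)
  moreover have "p * ?e * q = ?e" by (simp add: scaleC_mult_left scaleC_mult_right pz zq)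
  moreover have "\<exists>c. p * y * q = c *\<^sub>C ?e" for y
  proof -
    obtain c where "p * y * q = c *\<^sub>C z" using ex by blast
    then have "p * y * q = (c * of_real (norm z)) *\<^sub>C ?e"
      using z by (simp add: scaleC_scaleC)
    then show ?thesis by blast
  qed
  ultimately show ?thesis by blast
qed

theorem finite_dimensional: "finite_dimensional TYPE('a)"
proof -
  obtain e :: "'a \<Rightarrow> 'a \<Rightarrow> 'a" where e: "\<And>p q x. p \<in> P \<Longrightarrow> q \<in> P \<Longrightarrow> \<exists>c. p * x * q = c *\<^sub>C e p q"
    using corner_one_dimensional by metis
  let ?B = "(\<lambda>(p, q). e p q) ` (P \<times> P)"
  have "x \<in> cspan ?B" for x
  proof -
    have "p * x * q \<in> cspan ?B" if pq: "p \<in> P" "q \<in> P" for p q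
    proof -
      obtain c where "p * x * q = c *\<^sub>C e p q" using e[OF pq] by blast
      moreover have "e p q \<in> ?B" using pq by force
      ultimately show ?thesis
        by (simp add: complex_vector.span_scale complex_vector.span_base)
    qed
    then have "(\<Sum>p\<in>P. \<Sum>q\<in>P. p * x * q) \<in> cspan ?B"
      by (intro complex_vector.span_sum)
    then show ?thesis by (simp only: sum_corners)
  qed
  then show ?thesis
    unfolding finite_dimensional_def by (intro exI[of _ ?B]) (auto simp: finite_P)
qed

text \<open>
  The coordinates are the real and imaginary parts of the matrix entries: if \<open>p x q = c e\<close> with
  \<open>e\<close> of norm 1, then \<open>\<bar>c\<bar>\<close> is both \<open>\<parallel>p x q\<parallel>\<close> and \<open>\<bar>tau q (e* x)\<bar>\<close>. They serve as a real
  coordinate system that is bounded in both directions.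
\<close>

theorem coordinate_functionals:
  obtains n and l :: "nat \<Rightarrow> 'a \<Rightarrow> real"
  where "\<And>k. k < n \<Longrightarrow> bounded_linear (l k)" "\<And>x. norm x \<le> (\<Sum>k<n. \<bar>l k x\<bar>)"
proof -
  obtain e :: "'a \<Rightarrow> 'a \<Rightarrow> 'a" where e: "\<And>p q. p \<in> P \<Longrightarrow> q \<in> P \<Longrightarrow> (e p q = 0 \<or> norm (e p q) = 1)
      \<and> p * e p q * q = e p q \<and> (\<forall>x. \<exists>c. p * x * q = c *\<^sub>C e p q)"
    using corner_one_dimensional by metis
  define f where "f = (\<lambda>(p, q, b) x. (if b then Re else Im) (tau q (star (e p q) * x)))"
  let ?J = "P \<times> P \<times> (UNIV :: bool set)"
  have lin: "bounded_linear (f j)" if "j \<in> ?J" for j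
  proof -
    have "bounded_linear (\<lambda>x. tau q (star (e p q) * x))" if "q \<in> P" for p q
      by (rule bounded_linear_compose[OF bounded_linear_tau[OF that] bounded_linear_mult_right])
    then show ?thesis
      using that by (auto simp: f_def intro!: bounded_linear_compose[OF bounded_linear_Re]
          bounded_linear_compose[OF bounded_linear_Im])
  qed
  have le: "norm (p * x * q) \<le> (\<Sum>b\<in>UNIV. \<bar>f (p, q, b) x\<bar>)" if p: "p \<in> P" and q: "q \<in> P" for p q x
  proof -
    obtain c where c: "p * x * q = c *\<^sub>C e p q" using e p q by blast
    have "q * star (e p q) * p = star (e p q)"
      using e[OF p q] self_adjoint p q by (metis mult.assoc star_mult)
    then have se: "q * star (e p q) = star (e p q)" "star (e p q) * p = star (e p q)"
      using p q by (metis idempotent mult.assoc)+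
    have "cmod (tau q (star (e p q) * x)) = norm (q * (star (e p q) * x) * q)"
      by (rule norm_tau[OF q])
    also have "q * (star (e p q) * x) * q = star (e p q) * (p * x * q)"
      using se by (metis mult.assoc)
    also have "norm \<dots> = norm c * norm (star (e p q) * e p q)"
      by (simp add: c scaleC_mult_right norm_scaleC)
    also have "\<dots> = cmod c * (norm (e p q))\<^sup>2"
      by (simp add: cstar_identity)
    also have "\<dots> = norm (p * x * q)"
      using e[OF p q] by (auto simp: c norm_scaleC)
    finally have "norm (p * x * q) = cmod (tau q (star (e p q) * x))" ..
    also have "\<dots> \<le> \<bar>Re (tau q (star (e p q) * x))\<bar> + \<bar>Im (tau q (star (e p q) * x))\<bar>"
      by (rule cmod_le)
    finally show ?thesis by (simp add: f_def UNIV_bool)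
  qed
  have bound: "norm x \<le> (\<Sum>j\<in>?J. \<bar>f j x\<bar>)" for x
  proof -
    have "norm x = norm (\<Sum>p\<in>P. \<Sum>q\<in>P. p * x * q)" by (simp only: sum_corners)
    also have "\<dots> \<le> (\<Sum>p\<in>P. \<Sum>q\<in>P. norm (p * x * q))"
      by (intro order_trans[OF norm_sum] sum_mono norm_sum)
    also have "\<dots> \<le> (\<Sum>p\<in>P. \<Sum>q\<in>P. \<Sum>b\<in>UNIV. \<bar>f (p, q, b) x\<bar>)"
      by (intro sum_mono le)
    finally show ?thesis by (simp add: sum.cartesian_product)
  qed
  obtain h where h: "bij_betw h {0..<card ?J} ?J"
    using ex_bij_betw_nat_finite[of ?J] finite_P by auto
  show ?thesis
  proof (rule that[of "card ?J" "\<lambda>k. f (h k)"])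
    show "bounded_linear (f (h k))" if "k < card ?J" for k
      using that bij_betw_apply[OF h, of k] by (intro lin) simp
    show "norm x \<le> (\<Sum>k<card ?J. \<bar>f (h k) x\<bar>)" for x
      using bound[of x] sum.reindex_bij_betw[OF h, of "\<lambda>j. \<bar>f j x\<bar>"]
      by (simp add: atLeast0LessThan)
  qed
qed

text \<open>
  As \<open>z\<^sup>2 = 0\<close> and \<open>z z* = l q\<close>, the self-adjoint element \<open>z + z*\<close> has the square \<open>l (p + q)\<close>.
  For negative \<open>l\<close> this would be the negative of the square of \<open>sqrt (- l) (p + q)\<close>.
\<close>

lemma off_diagonal_corner_nonneg:
  assumes p: "p \<in> P" and q: "q \<in> P" and "p \<noteq> q" and z: "q * z * p = z"
    and l: "star z * z = of_real l *\<^sub>C p"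
  shows "0 \<le> l"
proof (rule ccontr)
  assume "\<not> 0 \<le> l"
  then have "l < 0" by simp
  have zp: "z * p = z" and qz: "q * z = z"
    using z p q by (metis idempotent mult.assoc)+
  have sz: "star z * q = star z" "p * star z = star z"
    using arg_cong[OF qz, of star] arg_cong[OF zp, of star] by (simp_all add: star_mult self_adjoint p q)
  have pq: "p * q = 0" "q * p = 0" using p q \<open>p \<noteq> q\<close> orthogonal by auto
  have pz: "p * z = 0" "z * q = 0" "star z * p = 0" "q * star z = 0"
    using pq zp qz sz by (metis mult.assoc mult_zero_left mult_zero_right)+
  have zz: "z * z = 0" "star z * star z = 0"
    using pz zp sz by (metis mult.assoc mult_zero_left mult_zero_right)+
  obtain m where "q * (z * star z) * q = m *\<^sub>C q" using minimal[OF q] by blast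
  then have m: "z * star z = m *\<^sub>C q"
    using qz sz by (simp add: mult.assoc flip: mult.assoc[of q z])
  have "z \<noteq> 0"
    using l \<open>l < 0\<close> nonzero[OF p] by auto
  have "of_real l *\<^sub>C z = z * (star z * z)" by (simp add: l scaleC_mult_right zp)
  also have "\<dots> = m *\<^sub>C z" by (simp add: m scaleC_mult_left qz flip: mult.assoc)
  finally have ml: "m = of_real l" using \<open>z \<noteq> 0\<close> by simp
  \<comment> \<open>For negative \<open>l\<close> the squares of these two commuting elements add up to 0.\<close>
  let ?s = "z + star z" and ?r = "sqrt (- l) *\<^sub>R (p + q)"
  have "?s * ?s + ?r * ?r = 0"
    using \<open>l < 0\<close> p q
    by (simp add: algebra_simps zz l m ml pq idempotent scaleC_of_real)
  moreover have "?s * ?r = ?r * ?s"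
    by (simp add: algebra_simps zp qz sz pz)
  moreover have "star ?s = ?s" "star ?r = ?r"
    by (simp_all add: star_add star_star star_scaleR self_adjoint p q add.commute)
  ultimately have "?r = 0" by (intro self_adjoint_sum_squares_zero(2)[of ?s ?r])
  then have "p + q = 0" using \<open>l < 0\<close> by simp
  then have "p * (p + q) = 0" by simp
  then show False using p q pq nonzero by (simp add: distrib_left idempotent)
qed

text \<open>
  Only the sign of \<open>tau p (x* x)\<close> has to be determined. It is the sum over \<open>q \<in> P\<close> of the
  contributions of the entries \<open>q x p\<close>, and these are nonnegative by the preceding lemma for
  \<open>q \<noteq> p\<close> and as \<open>\<bar>tau p x\<bar>\<^sup>2\<close> for \<open>q = p\<close>.
\<close>

lemma tau_star_mult_self:
  assumes p: "p \<in> P" shows "tau p (star x * x) = of_real ((norm (x * p))\<^sup>2)"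
proof -
  have corner: "star (q * x * p) * (q * x * p) = p * (star x * q * x) * p" if "q \<in> P" for q
    using p that by (simp add: star_mult self_adjoint mult.assoc mult_projections_assoc)
  have nonneg: "\<exists>l\<ge>0. tau p (star x * q * x) = of_real l" if q: "q \<in> P" for q
  proof -
    define t where "t = tau p (star x * q * x)"
    have "cnj t = t"
      unfolding t_def using p q
      by (simp add: star_mult star_star self_adjoint mult.assoc flip: tau_star)
    then obtain l where l: "t = of_real l"
      by (metis Reals_cases complex_is_Real_iff Reals_cnj_iff)
    have sq: "star (q * x * p) * (q * x * p) = of_real l *\<^sub>C p"
      using corner[OF q] corner_eq[OF p, of "star x * q * x"] l t_def by simp
    have "0 \<le> l"
    proof (cases "p = q")
      case False
      show ?thesis
        by (rule off_diagonal_corner_nonneg[OF p q False _ sq])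
          (simp add: mult.assoc mult_projections mult_projections_assoc p q)
    next
      case True
      then have "(cnj (tau p x) * tau p x) *\<^sub>C p = of_real l *\<^sub>C p"
        using sq p by (simp add: corner_eq star_scaleC self_adjoint scaleC_mult_left
            scaleC_mult_right scaleC_scaleC idempotent mult.commute)
      then have "cnj (tau p x) * tau p x = of_real l"
        using nonzero[OF p] by (simp add: mult.commute)
      then have "complex_of_real l = complex_of_real ((cmod (tau p x))\<^sup>2)"
        by (simp only: complex_norm_square mult.commute[of "cnj (tau p x)"])
      then have "l = (cmod (tau p x))\<^sup>2"
        by (simp only: of_real_eq_iff)
      then show ?thesis by simp
    qed
    then show ?thesis using l by (intro exI[of _ l]) (simp add: t_def)
  qed
  then obtain l where l: "\<And>q. q \<in> P \<Longrightarrow> 0 \<le> l q \<and> tau p (star x * q * x) = of_real (l q)"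
    by metis
  have "(\<Sum>q\<in>P. star x * q * x) = star x * x"
    by (simp add: sum_right_corners flip: sum_distrib_right)
  then have "tau p (star x * x) = (\<Sum>q\<in>P. tau p (star x * q * x))"
    using linear_sum[OF bounded_linear.linear[OF bounded_linear_tau[OF p]],
        of "\<lambda>q. star x * q * x" P] by simp
  also have "\<dots> = of_real (\<Sum>q\<in>P. l q)" using l by simp
  finally have t: "tau p (star x * x) = of_real (\<Sum>q\<in>P. l q)" .
  have "(norm (x * p))\<^sup>2 = norm (p * (star x * x) * p)"
    using p by (simp add: star_mult self_adjoint mult.assoc flip: cstar_identity)
  also have "\<dots> = cmod (tau p (star x * x))" by (simp add: norm_tau p)
  also have "\<dots> = (\<Sum>q\<in>P. l q)"
    unfolding t norm_of_real using l by (simp add: sum_nonneg)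
  finally show ?thesis using t by simp
qed

text \<open>The Hilbert-Schmidt inner product of the trace \<open>\<Sum>p\<in>P. tau p\<close>.\<close>

definition trace_inner :: "'a \<Rightarrow> 'a \<Rightarrow> complex" where
  "trace_inner x y = (\<Sum>p\<in>P. tau p (star y * x))"

lemma trace_inner_self: "trace_inner x x = of_real (\<Sum>p\<in>P. (norm (x * p))\<^sup>2)"
  by (simp add: trace_inner_def tau_star_mult_self)

lemma trace_inner_add_left: "trace_inner (x + y) z = trace_inner x z + trace_inner y z"
  by (simp add: trace_inner_def distrib_left tau_add sum.distrib)

lemma trace_inner_scaleC_left: "trace_inner (c *\<^sub>C x) y = c * trace_inner x y"
  by (simp add: trace_inner_def scaleC_mult_right tau_scaleC sum_distrib_left)

lemma trace_inner_commute: "trace_inner y x = cnj (trace_inner x y)"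
  by (simp add: trace_inner_def star_mult star_star flip: tau_star)

lemma trace_inner_unitary: "star u * u = 1 \<Longrightarrow> trace_inner (u * x) (u * y) = trace_inner x y"
  by (simp add: trace_inner_def star_mult mult.assoc) (simp flip: mult.assoc[of "star u"])

lemma norm_le_trace_norm:
  "norm x \<le> sqrt (card P) * sqrt (Re (trace_inner x x))"
proof -
  have "norm x \<le> (\<Sum>p\<in>P. norm (x * p))"
    using norm_sum[of "\<lambda>p. x * p" P] by (simp add: sum_right_corners)
  also have "\<dots> \<le> sqrt (card P) * sqrt (\<Sum>p\<in>P. (norm (x * p))\<^sup>2)"
    using L2_set_mult_ineq[of "\<lambda>p. 1" "\<lambda>p. norm (x * p)" P] by (simp add: L2_set_def)
  finally show ?thesis by (simp add: trace_inner_self)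
qed

lemma trace_norm_le: "sqrt (Re (trace_inner x x)) \<le> sqrt (card P) * norm x"
proof -
  have "norm (x * p) \<le> norm x" if "p \<in> P" for p
    using norm_mult_ineq[of x p] that by (simp add: norm_projection)
  then have "(\<Sum>p\<in>P. (norm (x * p))\<^sup>2) \<le> (\<Sum>p\<in>P. (norm x)\<^sup>2)"
    by (intro sum_mono power_mono) auto
  then have "Re (trace_inner x x) \<le> card P * (norm x)\<^sup>2"
    by (simp add: trace_inner_self)
  then have "sqrt (Re (trace_inner x x)) \<le> sqrt (card P * (norm x)\<^sup>2)" by (rule real_sqrt_le_mono)
  then show ?thesis by (simp add: real_sqrt_mult)
qed

end

theorem finite_dimensional_iff_minimal_projections:
  "finite_dimensional TYPE('a::unital_cstar_algebra) \<longleftrightarrow>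
    (\<exists>P :: 'a set. minimal_projections P)"
proof
  assume "finite_dimensional TYPE('a)"
  then obtain B :: "'a set" where "finite B" "cspan B = UNIV"
    by (auto simp: finite_dimensional_def)
  then show "\<exists>P :: 'a set. minimal_projections P"
    using card_orthogonal_family_le minimal_projections_if_bounded by metis
qed (blast intro: minimal_projections.finite_dimensional)

section \<open>Geometry of Hilbert spaces on a carrier set\<close>

definition hnorm :: "('h, 'm) inner_product_space_scheme \<Rightarrow> 'h \<Rightarrow> real" where
  "hnorm H x = sqrt (Re (cinner H x x))"

text \<open>
  The axiom \<open>complete\<close> of \<^locale>\<open>complex_hilbert_space\<close> has its intended meaning only once \<open>hdist\<close> is
  known to be a metric, which in turn has to be available when completeness is verified. The
  metric facts are therefore proved from the other axioms.
\<close>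

locale complex_inner_product_space = Module.module complex_ring H
  for H :: "('h, 'm) inner_product_space_scheme" (structure) +
  assumes cinner_add_left:
      "\<lbrakk>x \<in> carrier H; y \<in> carrier H; z \<in> carrier H\<rbrakk> \<Longrightarrow>
        cinner H (x \<oplus> y) z = cinner H x z + cinner H y z"
    and cinner_smult_left:
      "\<lbrakk>x \<in> carrier H; y \<in> carrier H\<rbrakk> \<Longrightarrow> cinner H (c \<odot> x) y = c * cinner H x y"
    and cinner_commute:
      "\<lbrakk>x \<in> carrier H; y \<in> carrier H\<rbrakk> \<Longrightarrow> cinner H y x = cnj (cinner H x y)"
    and cinner_pos:
      "\<lbrakk>x \<in> carrier H; x \<noteq> \<zero>\<rbrakk> \<Longrightarrow> 0 < Re (cinner H x x)"
begin

lemma smult_closed' [simp]: "x \<in> carrier H \<Longrightarrow> c \<odot> x \<in> carrier H"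
  using smult_closed[of c x] by (simp add: complex_ring_def)

lemma smult_add_right:
  "x \<in> carrier H \<Longrightarrow> y \<in> carrier H \<Longrightarrow> c \<odot> (x \<oplus> y) = c \<odot> x \<oplus> c \<odot> y"
  using smult_r_distr[of c x y] by (simp add: complex_ring_def)

lemma smult_add_left: "x \<in> carrier H \<Longrightarrow> (c + d) \<odot> x = c \<odot> x \<oplus> d \<odot> x"
  using smult_l_distr[of c d x] by (simp add: complex_ring_def)

lemma smult_one': "x \<in> carrier H \<Longrightarrow> 1 \<odot> x = x"
  using smult_one[of x] by (simp add: complex_ring_def)

lemma cinner_zero_left: "y \<in> carrier H \<Longrightarrow> cinner H \<zero> y = 0"
  using cinner_add_left[of \<zero> \<zero> y] by simp

lemma cinner_minus_left:
  assumes "x \<in> carrier H" "y \<in> carrier H" shows "cinner H (\<ominus> x) y = - cinner H x y"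
proof -
  have "cinner H (\<ominus> x \<oplus> x) y = cinner H (\<ominus> x) y + cinner H x y"
    using assms by (intro cinner_add_left) auto
  then show ?thesis
    using assms by (simp add: l_neg cinner_zero_left eq_neg_iff_add_eq_0)
qed

lemma Re_cinner_commute:
  "x \<in> carrier H \<Longrightarrow> y \<in> carrier H \<Longrightarrow> Re (cinner H y x) = Re (cinner H x y)"
  by (subst cinner_commute) simp_all

lemma cinner_self_nonneg: "x \<in> carrier H \<Longrightarrow> 0 \<le> Re (cinner H x x)"
  using cinner_pos[of x] cinner_zero_left[of \<zero>] by (cases "x = \<zero>") auto

lemma hnorm_nonneg: "x \<in> carrier H \<Longrightarrow> 0 \<le> hnorm H x"
  by (simp add: hnorm_def cinner_self_nonneg)

lemma hnorm_square: "x \<in> carrier H \<Longrightarrow> (hnorm H x)\<^sup>2 = Re (cinner H x x)"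
  by (simp add: hnorm_def cinner_self_nonneg)

lemma hnorm_eq_0: "x \<in> carrier H \<Longrightarrow> hnorm H x = 0 \<longleftrightarrow> x = \<zero>"
  using cinner_pos[of x] cinner_zero_left[of \<zero>] by (cases "x = \<zero>") (simp_all add: hnorm_def)

lemma hnorm_add_square:
  assumes "x \<in> carrier H" "y \<in> carrier H"
  shows "(hnorm H (x \<oplus> y))\<^sup>2 = (hnorm H x)\<^sup>2 + 2 * Re (cinner H x y) + (hnorm H y)\<^sup>2"
proof -
  have "Re (cinner H z (x \<oplus> y)) = Re (cinner H x z) + Re (cinner H y z)" if "z \<in> carrier H" for z
    using assms that Re_cinner_commute[of z "x \<oplus> y"] by (simp add: cinner_add_left)
  then show ?thesis
    using assms by (simp add: hnorm_square cinner_add_left Re_cinner_commute[of x y])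
qed

lemma hnorm_minus:
  assumes "x \<in> carrier H" shows "hnorm H (\<ominus> x) = hnorm H x"
proof -
  have "Re (cinner H (\<ominus> x) (\<ominus> x)) = Re (cinner H x x)"
    using assms by (simp add: cinner_minus_left Re_cinner_commute[of "\<ominus> x" x])
  then show ?thesis by (simp add: hnorm_def)
qed

lemma hnorm_diff_square:
  assumes "x \<in> carrier H" "y \<in> carrier H"
  shows "(hnorm H (x \<ominus> y))\<^sup>2 = (hnorm H x)\<^sup>2 - 2 * Re (cinner H x y) + (hnorm H y)\<^sup>2"
  using hnorm_add_square[of x "\<ominus> y"] assms Re_cinner_commute[of x "\<ominus> y"]
  by (simp add: a_minus_def hnorm_minus cinner_minus_left Re_cinner_commute[of x y])

lemma hnorm_scale:
  assumes "x \<in> carrier H" shows "hnorm H (complex_of_real r \<odot> x) = \<bar>r\<bar> * hnorm H x"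
proof -
  have "Re (cinner H (complex_of_real r \<odot> x) (complex_of_real r \<odot> x)) = r\<^sup>2 * Re (cinner H x x)"
    using assms
    by (simp add: cinner_smult_left Re_cinner_commute[of "complex_of_real r \<odot> x" x] power2_eq_square)
  then show ?thesis by (simp add: hnorm_def real_sqrt_mult)
qed

lemma cauchy_schwarz:
  assumes x: "x \<in> carrier H" and y: "y \<in> carrier H"
  shows "Re (cinner H x y) \<le> hnorm H x * hnorm H y"
proof (cases "x = \<zero> \<or> y = \<zero>")
  case True
  then show ?thesis
    using x y Re_cinner_commute[of x y] by (auto simp: cinner_zero_left hnorm_def)
next
  case False
  let ?a = "hnorm H x" and ?b = "hnorm H y"
  have pos: "0 < ?a" "0 < ?b"
    using False x y hnorm_nonneg hnorm_eq_0 by (metis order_le_less)+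
  let ?u = "complex_of_real ?b \<odot> x" and ?v = "complex_of_real ?a \<odot> y"
  have "Re (cinner H ?u ?v) = ?b * (?a * Re (cinner H x y))"
    using x y Re_cinner_commute[of ?v x] by (simp add: cinner_smult_left Re_cinner_commute[of x y])
  then have "(hnorm H (?u \<ominus> ?v))\<^sup>2
      = (?b * ?a)\<^sup>2 - 2 * (?b * (?a * Re (cinner H x y))) + (?a * ?b)\<^sup>2"
    using x y pos by (simp add: hnorm_diff_square hnorm_scale)
  moreover have "0 \<le> (hnorm H (?u \<ominus> ?v))\<^sup>2" by simp
  ultimately have "(?a * ?b) * Re (cinner H x y) \<le> (?a * ?b) * (?a * ?b)"
    by (simp add: power2_eq_square mult.commute mult.left_commute)
  then show ?thesis using pos by simp
qed

lemma hnorm_triangle: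
  assumes x: "x \<in> carrier H" and y: "y \<in> carrier H"
  shows "hnorm H (x \<oplus> y) \<le> hnorm H x + hnorm H y"
proof (rule power2_le_imp_le)
  show "(hnorm H (x \<oplus> y))\<^sup>2 \<le> (hnorm H x + hnorm H y)\<^sup>2"
    using cauchy_schwarz[OF x y] by (simp add: hnorm_add_square x y power2_sum)
qed (simp add: hnorm_nonneg x y)

lemma hdist_eq: "x \<in> carrier H \<Longrightarrow> y \<in> carrier H \<Longrightarrow> hdist H x y = hnorm H (x \<ominus> y)"
  by (simp add: hdist_def hnorm_def)

lemma hdist_metric: "Metric_space (carrier H) (hdist H)"
proof
  show nonneg: "0 \<le> hdist H x y" for x y
    by (simp add: hdist_def cinner_self_nonneg)
  show comm: "hdist H x y = hdist H y x" for x y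
  proof (cases "x \<in> carrier H \<and> y \<in> carrier H")
    case True
    then have "\<ominus> (x \<ominus> y) = y \<ominus> x"
      by (simp add: a_minus_def minus_add a_comm)
    then show ?thesis
      using True hnorm_minus[of "x \<ominus> y"] by (simp add: hdist_eq)
  qed (auto simp: hdist_def)
  fix x y z assume x: "x \<in> carrier H" and y: "y \<in> carrier H"
  show "hdist H x y = 0 \<longleftrightarrow> x = y"
  proof -
    have "x \<ominus> y = \<zero> \<longleftrightarrow> x = y"
      using x y minus_equality[of x "\<ominus> y"] by (auto simp: a_minus_def r_neg)
    then show ?thesis using x y by (simp add: hdist_eq hnorm_eq_0)
  qed
  assume z: "z \<in> carrier H"
  have "(x \<ominus> y) \<oplus> (y \<ominus> z) = x \<ominus> z"
    using x y z by (simp add: a_minus_def a_assoc r_neg1)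
  then show "hdist H x z \<le> hdist H x y + hdist H y z"
    using hnorm_triangle[of "x \<ominus> y" "y \<ominus> z"] x y z by (simp add: hdist_eq)
qed

lemma unitary_operator_closed:
  "U \<in> unitary_operators H \<Longrightarrow> x \<in> carrier H \<Longrightarrow> U x \<in> carrier H"
  by (auto simp: unitary_operators_def Bij_def bij_betw_def)

lemma unitary_operator_add:
  "U \<in> unitary_operators H \<Longrightarrow> x \<in> carrier H \<Longrightarrow> y \<in> carrier H \<Longrightarrow> U (x \<oplus> y) = U x \<oplus> U y"
  by (simp add: unitary_operators_def)

lemma unitary_operator_smult:
  "U \<in> unitary_operators H \<Longrightarrow> x \<in> carrier H \<Longrightarrow> U (c \<odot> x) = c \<odot> U x"
  by (simp add: unitary_operators_def)

lemma unitary_operator_cinner: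
  "U \<in> unitary_operators H \<Longrightarrow> x \<in> carrier H \<Longrightarrow> y \<in> carrier H \<Longrightarrow> cinner H (U x) (U y) = cinner H x y"
  by (simp add: unitary_operators_def)

lemma unitary_operator_hnorm: "U \<in> unitary_operators H \<Longrightarrow> x \<in> carrier H \<Longrightarrow> hnorm H (U x) = hnorm H x"
  by (simp add: hnorm_def unitary_operator_cinner)

lemma unitary_operator_hdist:
  assumes "U \<in> unitary_operators H" "x \<in> carrier H" "y \<in> carrier H"
  shows "hdist H (U x) (U y) = hdist H x y"
proof -
  have "(hnorm H (U x \<ominus> U y))\<^sup>2 = (hnorm H (x \<ominus> y))\<^sup>2"
    using assms
    by (simp add: hnorm_diff_square unitary_operator_closed unitary_operator_cinner unitary_operator_hnorm)
  then show ?thesis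
    using assms by (simp add: hdist_eq unitary_operator_closed hnorm_nonneg power2_eq_iff_nonneg)
qed

definition midpoint :: "'h \<Rightarrow> 'h \<Rightarrow> 'h" where
  "midpoint x y = complex_of_real (1/2) \<odot> (x \<oplus> y)"

lemma midpoint_closed [simp]: "x \<in> carrier H \<Longrightarrow> y \<in> carrier H \<Longrightarrow> midpoint x y \<in> carrier H"
  unfolding midpoint_def by (intro smult_closed' a_closed)

lemma unitary_operator_midpoint:
  "U \<in> unitary_operators H \<Longrightarrow> x \<in> carrier H \<Longrightarrow> y \<in> carrier H \<Longrightarrow>
    U (midpoint x y) = midpoint (U x) (U y)"
  unfolding midpoint_def by (simp only: unitary_operator_smult unitary_operator_add a_closed)

lemma parallelogram:
  assumes "x \<in> carrier H" "y \<in> carrier H" "hnorm H x = r" "hnorm H y = r"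
  shows "(hnorm H (midpoint x y))\<^sup>2 + (hdist H x y)\<^sup>2 / 4 = r\<^sup>2"
proof -
  have "(hnorm H (midpoint x y))\<^sup>2 = (hnorm H (x \<oplus> y))\<^sup>2 / 4"
    using assms unfolding midpoint_def
    by (subst hnorm_scale) (simp_all add: power_mult_distrib power_divide)
  moreover have "(hnorm H (x \<oplus> y))\<^sup>2 = 2 * r\<^sup>2 + 2 * Re (cinner H x y)"
    "(hdist H x y)\<^sup>2 = 2 * r\<^sup>2 - 2 * Re (cinner H x y)"
    using assms by (simp_all add: hdist_eq hnorm_add_square hnorm_diff_square)
  ultimately show ?thesis by linarith
qed

lemma hdist_midpoint_le:
  assumes x: "x \<in> carrier H" and y: "y \<in> carrier H" and z: "z \<in> carrier H"
    and "hdist H x z \<le> r" "hdist H y z \<le> r"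
  shows "hdist H (midpoint x y) z \<le> r"
proof -
  let ?h = "complex_of_real (1/2)"
  have "z = ?h \<odot> z \<oplus> ?h \<odot> z"
    using smult_add_left[OF z, of ?h ?h] z by (simp add: smult_one')
  also have "?h \<odot> z \<oplus> ?h \<odot> z = ?h \<odot> (z \<oplus> z)"
    using z by (simp only: smult_add_right)
  finally have zz: "z = ?h \<odot> (z \<oplus> z)" .
  have neg: "\<ominus> (?h \<odot> w) = ?h \<odot> (\<ominus> w)" if "w \<in> carrier H" for w
  proof -
    have "?h \<odot> (\<ominus> w) \<oplus> ?h \<odot> w = ?h \<odot> (\<ominus> w \<oplus> w)"
      using that by (simp only: smult_add_right a_inv_closed)
    also have "\<dots> = \<zero>"
      using that smult_add_right[of \<zero> \<zero> ?h] by (simp add: l_neg)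
    finally show ?thesis using that by (intro minus_equality) simp_all
  qed
  have "midpoint x y \<ominus> z = ?h \<odot> (x \<oplus> y) \<oplus> ?h \<odot> (\<ominus> (z \<oplus> z))"
    using zz z neg[of "z \<oplus> z"] by (metis a_closed a_minus_def midpoint_def)
  also have "\<dots> = ?h \<odot> ((x \<oplus> y) \<oplus> \<ominus> (z \<oplus> z))"
    using x y z by (simp only: smult_add_right a_closed a_inv_closed)
  also have "(x \<oplus> y) \<oplus> \<ominus> (z \<oplus> z) = (x \<ominus> z) \<oplus> (y \<ominus> z)"
    using x y z by (simp add: a_minus_def minus_add a_ac)
  finally have "hdist H (midpoint x y) z = \<bar>1/2\<bar> * hnorm H ((x \<ominus> z) \<oplus> (y \<ominus> z))"
    using x y z by (simp only: hdist_eq midpoint_closed) (subst hnorm_scale, simp_all)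
  then show ?thesis
    using hnorm_triangle[of "x \<ominus> z" "y \<ominus> z"] assms by (simp add: hdist_eq)
qed

end

sublocale complex_hilbert_space \<subseteq> complex_inner_product_space
  by unfold_locales (rule cinner_add_left cinner_smult_left cinner_commute cinner_pos; assumption)+

section \<open>Averaging over signs in a unitary representation\<close>

text \<open>
  Factors may be omitted: this makes the set monotone in the list, so that a condition on it
  passes to the tails of the list, over which the averages below are formed.
\<close>

fun signed_subproducts :: "('g, 'm) monoid_scheme \<Rightarrow> 'g list \<Rightarrow> 'g set" where
  "signed_subproducts G [] = {\<one>\<^bsub>G\<^esub>}"
| "signed_subproducts G (g # gs) =
    (\<Union>w\<in>signed_subproducts G gs. {w, g \<otimes>\<^bsub>G\<^esub> w, inv\<^bsub>G\<^esub> g \<otimes>\<^bsub>G\<^esub> w})"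

lemma signed_subproducts_drop: "signed_subproducts G (drop k gs) \<subseteq> signed_subproducts G gs"
proof (induction gs arbitrary: k)
  case (Cons g gs)
  then show ?case by (cases k) fastforce+
qed simp

lemma (in group) signed_subproducts_closed:
  "set gs \<subseteq> carrier G \<Longrightarrow> signed_subproducts G gs \<subseteq> carrier G"
  by (induction gs) auto

locale unitary_representation = H: complex_hilbert_space H + G: group G
  for H :: "('h, 'n) inner_product_space_scheme" and G :: "('g, 'm) monoid_scheme" +
  fixes \<pi> :: "'g \<Rightarrow> 'h \<Rightarrow> 'h"
  assumes unitary: "g \<in> carrier G \<Longrightarrow> \<pi> g \<in> unitary_operators H"
    and mult: "g \<in> carrier G \<Longrightarrow> h \<in> carrier G \<Longrightarrow> x \<in> carrier H \<Longrightarrow>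
      \<pi> (g \<otimes>\<^bsub>G\<^esub> h) x = \<pi> g (\<pi> h x)"
begin

lemma closed [simp]: "g \<in> carrier G \<Longrightarrow> x \<in> carrier H \<Longrightarrow> \<pi> g x \<in> carrier H"
  by (rule H.unitary_operator_closed[OF unitary])

lemma isometry: "g \<in> carrier G \<Longrightarrow> x \<in> carrier H \<Longrightarrow> y \<in> carrier H \<Longrightarrow>
    hdist H (\<pi> g x) (\<pi> g y) = hdist H x y"
  by (rule H.unitary_operator_hdist[OF unitary])

lemma one: assumes "x \<in> carrier H" shows "\<pi> \<one>\<^bsub>G\<^esub> x = x"
proof -
  have "\<pi> \<one>\<^bsub>G\<^esub> (\<pi> \<one>\<^bsub>G\<^esub> x) = \<pi> \<one>\<^bsub>G\<^esub> x"
    using mult[of "\<one>\<^bsub>G\<^esub>" "\<one>\<^bsub>G\<^esub>" x] assms by simp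
  moreover have "inj_on (\<pi> \<one>\<^bsub>G\<^esub>) (carrier H)"
    using unitary[of "\<one>\<^bsub>G\<^esub>"] by (auto simp: unitary_operators_def Bij_def bij_betw_def)
  ultimately show ?thesis using assms by (simp add: inj_on_eq_iff)
qed

text \<open>
  The average of the vectors \<open>\<pi> w x\<close> over all choices of signs, taken one list element at a
  time.
\<close>

primrec sign_average :: "'h \<Rightarrow> 'g list \<Rightarrow> 'h" where
  "sign_average x [] = x"
| "sign_average x (g # gs) =
    H.midpoint (\<pi> g (sign_average x gs)) (\<pi> (inv\<^bsub>G\<^esub> g) (sign_average x gs))"

lemma sign_average_closed [simp]:
  "x \<in> carrier H \<Longrightarrow> set gs \<subseteq> carrier G \<Longrightarrow> sign_average x gs \<in> carrier H"
  by (induction gs) auto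

text \<open>
  The translation by \<open>z\<close> is what makes the induction work: peeling off \<open>g\<close> replaces \<open>z\<close> by \<open>z g\<close>
  and \<open>z g\<^sup>-\<^sup>1\<close>.
\<close>

lemma translated_sign_average_close:
  assumes "x \<in> carrier H" "set gs \<subseteq> carrier G" "z \<in> carrier G"
    and "\<And>w. w \<in> signed_subproducts G gs \<Longrightarrow> hdist H (\<pi> (z \<otimes>\<^bsub>G\<^esub> w) x) x \<le> r"
  shows "hdist H (\<pi> z (sign_average x gs)) x \<le> r"
  using assms
proof (induction gs arbitrary: z)
  case (Cons g gs)
  have g: "g \<in> carrier G" and gs: "set gs \<subseteq> carrier G" using Cons.prems by auto
  have step: "hdist H (\<pi> z (\<pi> h (sign_average x gs))) x \<le> r"
    if h: "h = g \<or> h = inv\<^bsub>G\<^esub> g" for h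
  proof -
    have hc: "h \<in> carrier G" using h g by auto
    have "hdist H (\<pi> (z \<otimes>\<^bsub>G\<^esub> h) (sign_average x gs)) x \<le> r"
    proof (rule Cons.IH)
      fix w assume w: "w \<in> signed_subproducts G gs"
      then have "w \<in> carrier G" using G.signed_subproducts_closed[OF gs] by auto
      then have "z \<otimes>\<^bsub>G\<^esub> h \<otimes>\<^bsub>G\<^esub> w = z \<otimes>\<^bsub>G\<^esub> (h \<otimes>\<^bsub>G\<^esub> w)"
        using hc Cons.prems by (simp add: G.m_assoc)
      then show "hdist H (\<pi> (z \<otimes>\<^bsub>G\<^esub> h \<otimes>\<^bsub>G\<^esub> w) x) x \<le> r"
        using Cons.prems(4)[of "h \<otimes>\<^bsub>G\<^esub> w"] w h by auto
    qed (use Cons.prems gs hc in auto)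
    then show ?thesis using mult hc Cons.prems gs by simp
  qed
  have "\<pi> z (sign_average x (g # gs))
      = H.midpoint (\<pi> z (\<pi> g (sign_average x gs))) (\<pi> z (\<pi> (inv\<^bsub>G\<^esub> g) (sign_average x gs)))"
    using Cons.prems g gs by (simp add: H.unitary_operator_midpoint[OF unitary])
  then show ?case
    using step Cons.prems g gs by (simp only:) (intro H.hdist_midpoint_le; simp)
qed simp

lemma sign_average_close:
  assumes "x \<in> carrier H" "set gs \<subseteq> carrier G"
    and "\<And>w. w \<in> signed_subproducts G gs \<Longrightarrow> hdist H (\<pi> w x) x \<le> r"
  shows "hdist H (sign_average x gs) x \<le> r"
proof -
  have "hdist H (\<pi> \<one>\<^bsub>G\<^esub> (sign_average x gs)) x \<le> r"
  proof (rule translated_sign_average_close[OF assms(1,2)])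
    show "hdist H (\<pi> (\<one>\<^bsub>G\<^esub> \<otimes>\<^bsub>G\<^esub> w) x) x \<le> r" if "w \<in> signed_subproducts G gs" for w
      using that assms G.signed_subproducts_closed[OF assms(2)] by auto
  qed simp
  then show ?thesis using assms one by simp
qed

text \<open>The parallelogram law, telescoped over the tails of the list.\<close>

lemma sum_square_increments:
  assumes "x \<in> carrier H" "set gs \<subseteq> carrier G"
  shows "(hnorm H (sign_average x gs))\<^sup>2 +
    (\<Sum>k<length gs. (hdist H (\<pi> (gs ! k) (sign_average x (drop (Suc k) gs)))
        (\<pi> (inv\<^bsub>G\<^esub> (gs ! k)) (sign_average x (drop (Suc k) gs))))\<^sup>2 / 4) = (hnorm H x)\<^sup>2"
  using assms(2)
proof (induction gs)
  case (Cons g gs)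
  let ?v = "sign_average x gs"
  have "(hnorm H (H.midpoint (\<pi> g ?v) (\<pi> (inv\<^bsub>G\<^esub> g) ?v)))\<^sup>2
      + (hdist H (\<pi> g ?v) (\<pi> (inv\<^bsub>G\<^esub> g) ?v))\<^sup>2 / 4 = (hnorm H ?v)\<^sup>2"
    using Cons.prems assms(1)
    by (intro H.parallelogram) (simp_all add: H.unitary_operator_hnorm[OF unitary])
  then show ?case
    using Cons by (simp only: length_Cons sum.lessThan_Suc_shift) simp
qed simp

text \<open>
  Applying \<open>\<pi> g\<close> to both arguments shows that \<open>\<parallel>g v - g\<^sup>-\<^sup>1 v\<parallel>\<close> is the displacement of \<open>v\<close> under
  \<open>g\<^sup>2\<close>; each further factor \<open>g\<^sup>2\<close> contributes at most this amount.
\<close>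

lemma displacement_even_power:
  assumes v: "v \<in> carrier H" and g: "g \<in> carrier G"
  shows "hdist H (\<pi> (g [^]\<^bsub>G\<^esub> (2 * m :: nat)) v) v \<le> real m * hdist H (\<pi> g v) (\<pi> (inv\<^bsub>G\<^esub> g) v)"
proof (induction m)
  case 0
  then show ?case using v by (simp add: one Metric_space.mdist_zero[OF H.hdist_metric])
next
  case (Suc m)
  interpret M: Metric_space "carrier H" "hdist H" by (rule H.hdist_metric)
  let ?h = "g [^]\<^bsub>G\<^esub> (2 * m)" and ?u = "\<pi> (inv\<^bsub>G\<^esub> g) v"
  have hc: "?h \<in> carrier G" using g by simp
  have "\<pi> g ?u = v"
    using mult[of g "inv\<^bsub>G\<^esub> g" v] v g by (simp add: one)
  have "g [^]\<^bsub>G\<^esub> (2 * Suc m) = ?h \<otimes>\<^bsub>G\<^esub> (g \<otimes>\<^bsub>G\<^esub> g)"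
    using g by (simp add: G.m_assoc)
  then have "hdist H (\<pi> (g [^]\<^bsub>G\<^esub> (2 * Suc m)) v) (\<pi> ?h v) = hdist H (\<pi> g (\<pi> g v)) v"
    using g v hc by (simp add: mult isometry)
  also have "\<dots> = hdist H (\<pi> g (\<pi> g v)) (\<pi> g ?u)"
    by (simp only: \<open>\<pi> g ?u = v\<close>)
  also have "\<dots> = hdist H (\<pi> g v) ?u"
    using g v by (intro isometry) simp_all
  finally have "hdist H (\<pi> (g [^]\<^bsub>G\<^esub> (2 * Suc m)) v) v
      \<le> hdist H (\<pi> g v) ?u + hdist H (\<pi> ?h v) v"
    using M.triangle[of "\<pi> (g [^]\<^bsub>G\<^esub> (2 * Suc m)) v" "\<pi> ?h v" v] g v by simp
  then show ?case using Suc.IH by (simp add: algebra_simps)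
qed

text \<open>
  The sum over the list of the squared increments is bounded independently of its length, so one
  of them is small. The corresponding \<open>g\<^sup>2\<close> hardly moves an average \<open>v\<close> that is close to \<open>x\<close>.
  The power \<open>g\<^sup>2\<^sup>m\<close> is compared on \<open>x\<close> and on \<open>v\<close>: the triangle inequality through \<open>g\<^sup>2\<^sup>m v\<close> and
  \<open>v\<close> gives at most \<open>e/6 + e/3 + e/6\<close>. Summing over the finite set \<open>F\<close> lets one and the same \<open>g\<close>
  serve all its vectors.
\<close>

theorem some_even_powers_small:
  assumes F: "finite F" "F \<subseteq> carrier H" and e: "0 < e"
    and W: "\<And>w x. w \<in> W \<Longrightarrow> x \<in> F \<Longrightarrow> hdist H (\<pi> w x) x \<le> e / 6"
  shows "\<exists>n. \<forall>gs. n \<le> length gs \<longrightarrow> set gs \<subseteq> carrier G \<longrightarrow> signed_subproducts G gs \<subseteq> W \<longrightarrow>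
    (\<exists>g\<in>set gs. \<forall>m\<le>M. \<forall>x\<in>F. hdist H (\<pi> (g [^]\<^bsub>G\<^esub> (2 * m :: nat)) x) x < e)"
proof -
  interpret M: Metric_space "carrier H" "hdist H" by (rule H.hdist_metric)
  define S where "S = (\<Sum>x\<in>F. (hnorm H x)\<^sup>2)"
  have S0: "0 \<le> S" by (simp add: S_def sum_nonneg)
  \<comment> \<open>With this \<open>n\<close>, an increment whose square is at most \<open>4 S / n\<close> satisfies \<open>M d \<le> e / 3\<close>.\<close>
  obtain n where n: "36 * (real M)\<^sup>2 * S / e\<^sup>2 < real n"
    using reals_Archimedean2 by blast
  have "\<exists>g\<in>set gs. \<forall>m\<le>M. \<forall>x\<in>F. hdist H (\<pi> (g [^]\<^bsub>G\<^esub> (2 * m)) x) x < e"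
    if len: "n \<le> length gs" and gs: "set gs \<subseteq> carrier G" and sub: "signed_subproducts G gs \<subseteq> W" for gs
  proof -
    define v where "v k x = sign_average x (drop (Suc k) gs)" for k x
    define d where "d k x = hdist H (\<pi> (gs ! k) (v k x)) (\<pi> (inv\<^bsub>G\<^esub> (gs ! k)) (v k x))" for k x
    have set_drop: "set (drop (Suc k) gs) \<subseteq> carrier G" for k
      by (rule subset_trans[OF set_drop_subset gs])
    have vc: "v k x \<in> carrier H" if "x \<in> F" for k x
      unfolding v_def using that F(2) set_drop by (intro sign_average_closed) auto
    have vclose: "hdist H (v k x) x \<le> e / 6" if "x \<in> F" for k x
    proof -
      have "x \<in> carrier H" using that F by blast
      moreover have "w \<in> W" if "w \<in> signed_subproducts G (drop (Suc k) gs)" for w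
        using that signed_subproducts_drop[of G "Suc k" gs] sub by blast
      ultimately show ?thesis
        unfolding v_def by (intro sign_average_close set_drop W that)
    qed
    have "(\<Sum>k<length gs. (d k x)\<^sup>2 / 4) \<le> (hnorm H x)\<^sup>2" if "x \<in> F" for x
    proof -
      have "x \<in> carrier H" using that F by blast
      from sum_square_increments[OF this gs] show ?thesis
        unfolding d_def v_def using zero_le_power2[of "hnorm H (sign_average x gs)"] by linarith
    qed
    then have "(\<Sum>x\<in>F. \<Sum>k<length gs. (d k x)\<^sup>2 / 4) \<le> S"
      unfolding S_def by (rule sum_mono)
    then have total: "(\<Sum>k<length gs. \<Sum>x\<in>F. (d k x)\<^sup>2 / 4) \<le> S"
      by (subst (asm) sum.swap)
    have lpos: "0 < real (length gs)"
    proof -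
      have "0 \<le> 36 * (real M)\<^sup>2 * S / e\<^sup>2" using S0 by simp
      then show ?thesis using n len by linarith
    qed
    have "\<exists>k<length gs. (\<Sum>x\<in>F. (d k x)\<^sup>2 / 4) \<le> S / length gs"
    proof (rule ccontr)
      assume "\<not> ?thesis"
      then have "(\<Sum>k<length gs. S / length gs) < (\<Sum>k<length gs. \<Sum>x\<in>F. (d k x)\<^sup>2 / 4)"
        using lpos by (intro sum_strict_mono) auto
      then show False using total lpos by simp
    qed
    then obtain k where k: "k < length gs" "(\<Sum>x\<in>F. (d k x)\<^sup>2 / 4) \<le> S / length gs" by blast
    let ?g = "gs ! k"
    have g: "?g \<in> set gs" "?g \<in> carrier G" using k gs by auto
    have "hdist H (\<pi> (?g [^]\<^bsub>G\<^esub> (2 * m)) x) x < e" if m: "m \<le> M" and x: "x \<in> F" for m x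
    proof -
      have xc: "x \<in> carrier H" using x F by blast
      let ?h = "?g [^]\<^bsub>G\<^esub> (2 * m)"
      have hc: "?h \<in> carrier G" using g by simp
      have "(d k x)\<^sup>2 / 4 \<le> (\<Sum>x\<in>F. (d k x)\<^sup>2 / 4)"
        using F x by (intro member_le_sum) auto
      then have "(d k x)\<^sup>2 \<le> 4 * S / length gs" using k by simp
      then have "(real M * d k x)\<^sup>2 \<le> (real M)\<^sup>2 * (4 * S / length gs)"
        unfolding power_mult_distrib by (rule mult_left_mono) simp
      also have "\<dots> \<le> e\<^sup>2 / 9"
      proof -
        have "36 * (real M)\<^sup>2 * S / e\<^sup>2 \<le> real (length gs)" using n len by linarith
        then have "36 * (real M)\<^sup>2 * S \<le> real (length gs) * e\<^sup>2"
          using e by (simp add: pos_divide_le_eq)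
        then show ?thesis using lpos by (simp add: field_simps)
      qed
      finally have "(real M * d k x)\<^sup>2 \<le> (e / 3)\<^sup>2" by (simp add: power_divide)
      then have "real M * d k x \<le> e / 3" by (rule power2_le_imp_le) (use e in simp)
      moreover have "0 \<le> d k x" by (simp add: d_def)
      then have "real m * d k x \<le> real M * d k x"
        using m by (intro mult_right_mono) auto
      moreover have "hdist H (\<pi> ?h (v k x)) (v k x) \<le> real m * d k x"
        unfolding d_def by (rule displacement_even_power[OF vc[OF x] g(2)])
      ultimately have 1: "hdist H (\<pi> ?h (v k x)) (v k x) \<le> e / 3" by linarith
      have 2: "hdist H (\<pi> ?h x) (\<pi> ?h (v k x)) \<le> e / 6"
        using vclose[OF x, of k] isometry[OF hc xc vc[OF x]] by (simp add: M.commute)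
      have "hdist H (\<pi> ?h x) x \<le> hdist H (\<pi> ?h x) (\<pi> ?h (v k x)) + hdist H (\<pi> ?h (v k x)) x"
        using hc xc vc[OF x] by (intro M.triangle) auto
      also have "hdist H (\<pi> ?h (v k x)) x \<le> hdist H (\<pi> ?h (v k x)) (v k x) + hdist H (v k x) x"
        using hc xc vc[OF x] by (intro M.triangle) auto
      finally show ?thesis using 1 2 vclose[OF x, of k] e by linarith
    qed
    then show ?thesis using g(1) by blast
  qed
  then show ?thesis by blast
qed

end

section \<open>Obstruction to strong unitary representability\<close>

lemma continuous_map_orbit:
  assumes "continuous_map T (subtopology (strong_operator_topology H) K) f" "x \<in> carrier H"
  shows "continuous_map T (Metric_space.mtopology (carrier H) (hdist H)) (\<lambda>g. f g x)"
proof -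
  have "continuous_map T
      (product_topology (\<lambda>_. Metric_space.mtopology (carrier H) (hdist H)) (carrier H)) f"
    using assms(1) unfolding strong_operator_topology_def
    by (meson continuous_map_in_subtopology)
  from continuous_map_compose[OF this continuous_map_product_projection[OF assms(2)]]
  show ?thesis by (simp add: o_def)
qed

text \<open>
  A neighbourhood of the identity in the strong operator topology is given by finitely many
  vectors and a radius, so the preceding estimate becomes a statement about the topological
  group alone. The order of the quantifiers matters: \<open>W\<close> depends on \<open>V\<close> only, and \<open>n\<close> on \<open>M\<close>.
\<close>

theorem even_powers_small_if_representable:
  assumes sur: "strongly_unitarily_representable TYPE('h) G T"
    and V: "openin T V" "\<one>\<^bsub>G\<^esub> \<in> V"
  obtains W where "openin T W" "\<one>\<^bsub>G\<^esub> \<in> W"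
    "\<And>M. \<exists>n. \<forall>gs. n \<le> length gs \<longrightarrow> set gs \<subseteq> carrier G \<longrightarrow> signed_subproducts G gs \<subseteq> W \<longrightarrow>
      (\<exists>g\<in>set gs. \<forall>m\<le>M. g [^]\<^bsub>G\<^esub> (2 * m :: nat) \<in> V)"
proof -
  from sur obtain H :: "'h inner_product_space" and K f where
    H: "complex_hilbert_space H" and K: "subgroup K (unitary_operator_group H)"
    and f: "f \<in> iso G (unitary_operator_group H\<lparr>carrier := K\<rparr>)"
    and homeo: "homeomorphic_map T (subtopology (strong_operator_topology H) K) f"
    and top: "topological_group G T"
    unfolding strongly_unitarily_representable_def by blast
  interpret H: complex_hilbert_space H by (rule H)
  interpret M: Metric_space "carrier H" "hdist H" by (rule H.hdist_metric)
  from top have G: "group G" and topT: "topspace T = carrier G"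
    by (auto simp: topological_group_def)
  have KU: "K \<subseteq> unitary_operators H"
    using K by (auto simp: subgroup_def unitary_operator_group_def)
  have fK: "f g \<in> K" if "g \<in> carrier G" for g
    using f that by (auto simp: iso_def hom_def)
  have inj: "inj_on f (carrier G)"
    using f by (auto simp: iso_def bij_betw_def)
  interpret G: group G by (rule G)
  interpret unitary_representation H G f
  proof
    show u: "f g \<in> unitary_operators H" if "g \<in> carrier G" for g
      using fK KU that by blast
    show "f (g \<otimes>\<^bsub>G\<^esub> h) x = f g (f h x)"
      if "g \<in> carrier G" "h \<in> carrier G" "x \<in> carrier H" for g h x
    proof -
      have "f g \<in> Bij (carrier H)" "f h \<in> Bij (carrier H)"
        using u that by (auto simp: unitary_operators_def)
      moreover have "f (g \<otimes>\<^bsub>G\<^esub> h) = f g \<otimes>\<^bsub>unitary_operator_group H\<^esub> f h"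
        using f that by (auto simp: iso_def hom_def)
      ultimately show ?thesis
        using that by (simp add: unitary_operator_group_def BijGroup_def compose_def)
    qed
  qed
  let ?prod = "product_topology (\<lambda>_. M.mtopology) (carrier H)"
  have "openin (subtopology (strong_operator_topology H) K) (f ` V)"
    using homeomorphic_imp_open_map[OF homeo] V(1) by (auto simp: open_map_def)
  then obtain S where S: "openin ?prod S" "f ` V = S \<inter> (unitary_operators H \<inter> K)"
    by (auto simp: strong_operator_topology_def subtopology_subtopology openin_subtopology)
  have "f \<one>\<^bsub>G\<^esub> \<in> S" using S(2) V(2) by blast
  then have "\<exists>U. finite {x \<in> carrier H. U x \<noteq> topspace M.mtopology} \<and>
      (\<forall>x\<in>carrier H. openin M.mtopology (U x)) \<and>
      f \<one>\<^bsub>G\<^esub> \<in> Pi\<^sub>E (carrier H) U \<and> Pi\<^sub>E (carrier H) U \<subseteq> S"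
    by (rule bspec[OF S(1)[unfolded openin_product_topology_alt]])
  then obtain U where U: "finite {x \<in> carrier H. U x \<noteq> topspace M.mtopology}"
      "\<And>x. x \<in> carrier H \<Longrightarrow> openin M.mtopology (U x)" "f \<one>\<^bsub>G\<^esub> \<in> Pi\<^sub>E (carrier H) U"
      "Pi\<^sub>E (carrier H) U \<subseteq> S"
    by meson
  define F where "F = {x \<in> carrier H. U x \<noteq> carrier H}"
  have F: "finite F" "F \<subseteq> carrier H" using U(1) by (auto simp: F_def)
  have "\<exists>r>0. M.mball x r \<subseteq> U x" if "x \<in> F" for x
  proof -
    have x: "x \<in> carrier H" using that F by blast
    then have "x \<in> U x" using PiE_mem[OF U(3) x] one by simp
    then show ?thesis using U(2)[OF x] by (auto simp: M.openin_mtopology)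
  qed
  then obtain r where r: "\<And>x. x \<in> F \<Longrightarrow> 0 < r x \<and> M.mball x (r x) \<subseteq> U x" by metis
  define e where "e = Min (insert 1 (r ` F))"
  have e: "0 < e" "\<And>x. x \<in> F \<Longrightarrow> e \<le> r x"
    using F(1) r by (auto simp: e_def)
  have VI: "g \<in> V" if g: "g \<in> carrier G" and small: "\<And>x. x \<in> F \<Longrightarrow> hdist H (f g x) x < e" for g
  proof -
    have "f g x \<in> U x" if x: "x \<in> carrier H" for x
    proof (cases "x \<in> F")
      case True
      then have "f g x \<in> M.mball x (r x)"
        using small[OF True] e(2)[OF True] x g by (simp add: M.commute)
      then show ?thesis using r[OF True] by blast
    next
      case False
      then show ?thesis using x g by (simp add: F_def)
    qed
    moreover have "f g \<in> extensional (carrier H)"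
      using unitary[OF g] by (auto simp: unitary_operators_def Bij_def)
    ultimately have "f g \<in> S" using U(4) by (auto simp: PiE_def)
    then have "f g \<in> f ` V" using S(2) unitary[OF g] fK[OF g] by blast
    moreover have "V \<subseteq> carrier G" using openin_subset[OF V(1)] topT by simp
    ultimately show ?thesis using inj g by (simp add: inj_on_image_mem_iff)
  qed
  define W where "W = (\<Inter>x\<in>F. {g \<in> topspace T. f g x \<in> M.mball x (e / 6)}) \<inter> topspace T"
  have "continuous_map T (subtopology (strong_operator_topology H) K) f"
    using homeo by (rule homeomorphic_imp_continuous_map)
  then have "openin T {g \<in> topspace T. f g x \<in> M.mball x (e / 6)}" if "x \<in> F" for x
    using that F by (intro openin_continuous_map_preimage[OF continuous_map_orbit]) auto
  then have "openin T W" unfolding W_def using F(1) by (intro openin_INT) auto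
  moreover have "\<one>\<^bsub>G\<^esub> \<in> W" using topT F e(1) by (auto simp: W_def one)
  moreover have "\<exists>n. \<forall>gs. n \<le> length gs \<longrightarrow> set gs \<subseteq> carrier G \<longrightarrow> signed_subproducts G gs \<subseteq> W \<longrightarrow>
      (\<exists>g\<in>set gs. \<forall>m\<le>M. g [^]\<^bsub>G\<^esub> (2 * m :: nat) \<in> V)" for M
  proof -
    have "hdist H (f w x) x \<le> e / 6" if "w \<in> W" "x \<in> F" for w x
      using that by (auto simp: W_def M.commute)
    from some_even_powers_small[OF F e(1) this, where M = M] obtain n where
      n: "\<And>gs. n \<le> length gs \<Longrightarrow> set gs \<subseteq> carrier G \<Longrightarrow> signed_subproducts G gs \<subseteq> W \<Longrightarrow>
        \<exists>g\<in>set gs. \<forall>m\<le>M. \<forall>x\<in>F. hdist H (f (g [^]\<^bsub>G\<^esub> (2 * m :: nat)) x) x < e"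
      by metis
    show ?thesis
    proof (intro exI[of _ n] allI impI)
      fix gs assume gs: "n \<le> length gs" "set gs \<subseteq> carrier G" "signed_subproducts G gs \<subseteq> W"
      from n[OF this] obtain g where
        g: "g \<in> set gs" "\<And>m x. m \<le> M \<Longrightarrow> x \<in> F \<Longrightarrow> hdist H (f (g [^]\<^bsub>G\<^esub> (2 * m)) x) x < e"
        by blast
      then have "g [^]\<^bsub>G\<^esub> (2 * m) \<in> V" if "m \<le> M" for m
        using that gs(2) by (intro VI) auto
      then show "\<exists>g\<in>set gs. \<forall>m\<le>M. g [^]\<^bsub>G\<^esub> (2 * m) \<in> V" using g(1) by blast
    qed
  qed
  ultimately show ?thesis by (rule that)
qed

section \<open>Orthogonal sequences in infinite-dimensional C*-algebras\<close>

definition orthonormal_list :: "'a::unital_cstar_algebra list \<Rightarrow> bool" where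
  "orthonormal_list hs \<longleftrightarrow>
    (\<forall>h\<in>set hs. star h = h \<and> norm h = 1) \<and> sorted_wrt (\<lambda>x y. x * y = 0) hs"

lemma long_orthonormal_list:
  assumes "\<not> finite_dimensional TYPE('a::unital_cstar_algebra)"
  obtains hs :: "'a::unital_cstar_algebra list" where "orthonormal_list hs" "n \<le> length hs"
proof -
  have "\<exists>F :: 'a set. finite F \<and> orthogonal_family F \<and> n < card F"
    using assms minimal_projections_if_bounded[of n]
    by (meson finite_dimensional_iff_minimal_projections not_le)
  then obtain F :: "'a set" where F: "finite F" "orthogonal_family F" "n < card F" by blast
  obtain fs where fs: "set fs = F" "distinct fs"
    using finite_distinct_list[OF F(1)] by blast
  let ?hs = "map (\<lambda>h. inverse (norm h) *\<^sub>R h) fs"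
  have "sorted_wrt (\<lambda>x y. x * y = 0) fs"
    unfolding sorted_wrt_iff_nth_less
  proof (intro allI impI)
    fix i j assume ij: "i < j" "j < length fs"
    then have "fs ! i \<in> F" "fs ! j \<in> F" "fs ! i \<noteq> fs ! j"
      using fs by (auto simp: nth_eq_iff_index_eq)
    then show "fs ! i * fs ! j = 0"
      using F(2) by (auto simp: orthogonal_family_def pairwise_def)
  qed
  then have "sorted_wrt (\<lambda>x y. x * y = 0) ?hs"
    unfolding sorted_wrt_map by (rule sorted_wrt_mono_rel[rotated]) simp
  moreover have "\<forall>h\<in>set ?hs. star h = h \<and> norm h = 1"
    using F(2) fs by (auto simp: orthogonal_family_def star_scaleR)
  ultimately have "orthonormal_list ?hs"
    unfolding orthonormal_list_def by (intro conjI)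
  moreover have "n \<le> length ?hs"
    using F(3) fs distinct_card[of fs] by simp
  ultimately show ?thesis by (rule that)
qed

fun signed_subsums :: "'a::ab_group_add list \<Rightarrow> 'a set" where
  "signed_subsums [] = {0}"
| "signed_subsums (h # hs) = (\<Union>w\<in>signed_subsums hs. {w, h + w, - h + w})"

lemma signed_subsums_orthogonal:
  fixes w :: "'a::unital_cstar_algebra"
  assumes "w \<in> signed_subsums hs" "\<And>h. h \<in> set hs \<Longrightarrow> k * h = 0"
  shows "k * w = 0"
  using assms
proof (induction hs arbitrary: w)
  case (Cons h hs)
  then obtain v where v: "v \<in> signed_subsums hs" "w = v \<or> w = h + v \<or> w = - h + v"
    by auto
  have "k * v = 0" "k * h = 0" using Cons.IH[OF v(1)] Cons.prems(2) by auto
  then show ?case using v(2) by (auto simp: distrib_left right_diff_distrib)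
qed simp

lemma signed_subsums_self_adjoint:
  assumes "orthonormal_list hs" "w \<in> signed_subsums hs" shows "star w = w"
  using assms
proof (induction hs arbitrary: w)
  case (Cons h hs)
  then obtain v where v: "v \<in> signed_subsums hs" "w = v \<or> w = h + v \<or> w = - h + v"
    by auto
  have "star v = v" "star h = h"
    using Cons.IH[OF _ v(1)] Cons.prems(1) by (auto simp: orthonormal_list_def)
  then show ?case using v(2) by (auto simp: star_add star_minus star_diff)
qed simp

text \<open>Each new summand is orthogonal to the sum formed before.\<close>

lemma norm_signed_subsums_le:
  assumes "orthonormal_list hs" "w \<in> signed_subsums hs" shows "norm w \<le> 1"
  using assms
proof (induction hs arbitrary: w)
  case (Cons h hs)
  have hs: "orthonormal_list hs" and h: "star h = h" "norm h = 1" "\<And>k. k \<in> set hs \<Longrightarrow> h * k = 0"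
    using Cons.prems(1) by (auto simp: orthonormal_list_def)
  from Cons.prems(2) obtain v where v: "v \<in> signed_subsums hs" "w = v \<or> w = h + v \<or> w = - h + v"
    by auto
  have "norm v \<le> 1" "star v = v" "h * v = 0"
    using Cons.IH[OF hs v(1)] signed_subsums_self_adjoint[OF hs v(1)]
      signed_subsums_orthogonal[OF v(1)] h(3) by auto
  then have "norm (h + v) \<le> 1" "norm (- h + v) \<le> 1"
    using h by (intro norm_add_orthogonal; simp add: star_minus)+
  then show ?case using v(2) \<open>norm v \<le> 1\<close> by auto
qed simp

section \<open>Representability forces finite dimension\<close>

lemma additive_group_simps [simp]:
  "carrier (additive_group S) = S"
  "x \<otimes>\<^bsub>additive_group S\<^esub> y = x + y"
  "\<one>\<^bsub>additive_group S\<^esub> = 0"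
  by (simp_all add: additive_group_def)

lemma inv_additive_group:
  assumes "group (additive_group S)" "x \<in> S" "- x \<in> S"
  shows "inv\<^bsub>additive_group S\<^esub> x = - x"
  using group.inv_equality[OF assms(1), of "- x" x] assms(2,3) by simp

lemma nat_pow_additive_group:
  "x [^]\<^bsub>additive_group S\<^esub> (n::nat) = real n *\<^sub>R (x :: 'a::real_vector)"
  by (induction n) (simp_all add: nat_pow_def scaleR_left_distrib add.commute)

lemma signed_subproducts_additive_group:
  fixes hs :: "'a::real_vector list"
  assumes "group (additive_group S)" "\<And>h. h \<in> set hs \<Longrightarrow> r *\<^sub>R h \<in> S \<and> - (r *\<^sub>R h) \<in> S"
  shows "signed_subproducts (additive_group S) (map ((*\<^sub>R) r) hs) \<subseteq> (*\<^sub>R) r ` signed_subsums hs"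
  using assms(2)
proof (induction hs)
  case (Cons h hs)
  show ?case
  proof
    fix w assume "w \<in> signed_subproducts (additive_group S) (map ((*\<^sub>R) r) (h # hs))"
    then obtain v where v: "v \<in> signed_subproducts (additive_group S) (map ((*\<^sub>R) r) hs)"
      "w = v \<or> w = r *\<^sub>R h + v \<or> w = - (r *\<^sub>R h) + v"
      using Cons.prems inv_additive_group[OF assms(1), of "r *\<^sub>R h"] by auto
    have "signed_subproducts (additive_group S) (map ((*\<^sub>R) r) hs) \<subseteq> (*\<^sub>R) r ` signed_subsums hs"
      by (rule Cons.IH) (simp add: Cons.prems)
    then obtain u where u: "u \<in> signed_subsums hs" "v = r *\<^sub>R u"
      using v(1) by blast
    have "w = r *\<^sub>R u \<or> w = r *\<^sub>R (h + u) \<or> w = r *\<^sub>R (- h + u)"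
      using v(2) by (simp only: u(2) scaleR_add_right scaleR_minus_right)
    moreover have "u \<in> signed_subsums (h # hs)" "h + u \<in> signed_subsums (h # hs)"
      "- h + u \<in> signed_subsums (h # hs)"
      using u(1) by auto
    ultimately show "w \<in> (*\<^sub>R) r ` signed_subsums (h # hs)" by blast
  qed
qed simp

text \<open>
  Otherwise there are arbitrarily long orthogonal lists of norm 1. For a small \<open>r\<close> all signed
  sums of the \<open>r h\<close> are near 0, but \<open>2 M r h\<close> has norm above 1 as soon as \<open>M\<close> is large, for
  every \<open>h\<close>.
\<close>

theorem finite_dimensional_if_additive_group_representable:
  fixes S :: "'a::unital_cstar_algebra set"
  assumes sur: "strongly_unitarily_representable TYPE('h) (additive_group S) (top_of_set S)"
    and S: "self_adjoints \<subseteq> S"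
  shows "finite_dimensional TYPE('a)"
proof (rule ccontr)
  assume inf: "\<not> finite_dimensional TYPE('a)"
  have G: "group (additive_group S)"
    using sur by (simp add: strongly_unitarily_representable_def topological_group_def)
  have "0 \<in> S" using S by (auto simp: self_adjoints_def)
  then have V: "openin (top_of_set S) (S \<inter> ball 0 1)" "0 \<in> S \<inter> ball 0 1"
    by (auto intro: openin_open_Int)
  obtain W where W: "openin (top_of_set S) W" "0 \<in> W"
    and small: "\<And>M. \<exists>n. \<forall>gs. n \<le> length gs \<longrightarrow> set gs \<subseteq> S \<longrightarrow>
      signed_subproducts (additive_group S) gs \<subseteq> W \<longrightarrow>
      (\<exists>g\<in>set gs. \<forall>m\<le>M. g [^]\<^bsub>additive_group S\<^esub> (2 * m :: nat) \<in> S \<inter> ball 0 1)"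
    by (rule even_powers_small_if_representable[OF sur V(1), unfolded additive_group_simps, OF V(2)])
      (rule that)
  obtain d where d: "0 < d" "S \<inter> ball 0 d \<subseteq> W"
    using W by (auto simp: openin_contains_ball Int_commute)
  define r where "r = d / 2"
  have r: "0 < r" "r < d" using d by (auto simp: r_def)
  obtain M where M: "1 < real M * r"
    using ex_less_of_nat_mult[OF r(1)] by blast
  obtain n where n: "\<And>gs. n \<le> length gs \<Longrightarrow> set gs \<subseteq> S \<Longrightarrow>
      signed_subproducts (additive_group S) gs \<subseteq> W \<Longrightarrow>
      \<exists>g\<in>set gs. \<forall>m\<le>M. g [^]\<^bsub>additive_group S\<^esub> (2 * m :: nat) \<in> S \<inter> ball 0 1"
    using small[of M] by metis
  obtain hs :: "'a list" where hs: "orthonormal_list hs" "n \<le> length hs"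
    by (rule long_orthonormal_list[OF inf])
  let ?gs = "map ((*\<^sub>R) r) hs"
  have sa: "r *\<^sub>R h \<in> S" "- (r *\<^sub>R h) \<in> S" if "star h = h" for h
    using S that by (auto simp: self_adjoints_def star_scaleR star_minus)
  have sah: "star h = h" "norm h = 1" if "h \<in> set hs" for h
    using hs(1) that by (auto simp: orthonormal_list_def)
  have "signed_subproducts (additive_group S) ?gs \<subseteq> (*\<^sub>R) r ` signed_subsums hs"
    using sa sah by (intro signed_subproducts_additive_group[OF G]) auto
  also have "\<dots> \<subseteq> S \<inter> ball 0 d"
  proof clarify
    fix w assume w: "w \<in> signed_subsums hs"
    have "norm (r *\<^sub>R w) \<le> r"
      using norm_signed_subsums_le[OF hs(1) w] r by (simp add: mult_left_le)
    then have "norm (r *\<^sub>R w) < d" using r by linarith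
    then show "r *\<^sub>R w \<in> S \<inter> ball 0 d"
      using sa(1)[OF signed_subsums_self_adjoint[OF hs(1) w]] by (simp del: norm_scaleR)
  qed
  finally have "signed_subproducts (additive_group S) ?gs \<subseteq> W" using d by blast
  moreover have "set ?gs \<subseteq> S" using sa sah by auto
  ultimately obtain g where g: "g \<in> set ?gs"
    "g [^]\<^bsub>additive_group S\<^esub> (2 * M) \<in> S \<inter> ball 0 1"
    using n[of ?gs] hs(2) by auto
  then obtain h where h: "h \<in> set hs" "g = r *\<^sub>R h" by auto
  have "norm ((real (2 * M) * r) *\<^sub>R h) < 1"
    using g(2) by (simp add: nat_pow_additive_group h(2) del: norm_scaleR)
  then have "real (2 * M) * r < 1"
    using sah[OF h(1)] r by (simp add: abs_mult)
  then show False using M by simp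
qed

text \<open>On orthogonal elements every power series is additive up to its constant term.\<close>

lemma sqrt_one_minus_mult_orthogonal:
  fixes x y :: "'a::unital_cstar_algebra"
  assumes "norm x \<le> 1" "norm y \<le> 1" "x * y = 0" "y * x = 0"
  shows "sqrt_one_minus x * sqrt_one_minus y = sqrt_one_minus (x + y)"
proof -
  have "(\<lambda>n. if n = 0 then 1 :: 'a else 0) sums 1"
    using sums_single[of 0 "\<lambda>_. 1 :: 'a"] by simp
  then have "(\<lambda>n. sqrt_coeff n *\<^sub>R x ^ n + sqrt_coeff n *\<^sub>R y ^ n - (if n = 0 then 1 else 0))
      sums (sqrt_one_minus x + sqrt_one_minus y - 1)"
    unfolding sqrt_one_minus_def
    by (intro sums_diff sums_add summable_sums summable_sqrt assms)
  moreover have "sqrt_coeff n *\<^sub>R x ^ n + sqrt_coeff n *\<^sub>R y ^ n - (if n = 0 then 1 else 0)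
      = sqrt_coeff n *\<^sub>R (x + y) ^ n" for n
    using power_add_orthogonal[OF assms(3,4)]
    by (cases n) (simp_all add: scaleR_add_right del: power_Suc)
  ultimately have sum: "sqrt_one_minus (x + y) = sqrt_one_minus x + sqrt_one_minus y - 1"
    unfolding sqrt_one_minus_def[of "x + y"] by (simp add: sums_iff)
  have "x * sqrt_one_minus y = x"
    using sqrt_one_minus_mult_annihilated[OF assms(2,4)] sqrt_one_minus_commute[OF assms(2), of x] assms
    by simp
  then have "x * (sqrt_one_minus y - 1) = 0" by (simp add: right_diff_distrib)
  from sqrt_one_minus_mult_annihilated[OF assms(1) this]
  show ?thesis by (simp add: sum algebra_simps)
qed

lemma cis_arcsin_add:
  fixes h k :: "'a::unital_cstar_algebra"
  assumes h: "star h = h" "norm h \<le> 1" and k: "star k = k" "norm k \<le> 1" and hk: "h * k = 0"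
  shows "cis_arcsin h * cis_arcsin k
    = cis_arcsin (h + k)"
proof -
  have kh: "k * h = 0" using h(1) k(1) hk by (metis star_mult star_zero)
  have 1: "norm (h * h) \<le> 1" "norm (k * k) \<le> 1"
    using norm_square_le_1 h k by blast+
  have 2: "h * h * (k * k) = 0" "k * k * (h * h) = 0" "h * h * k = 0" "k * k * h = 0"
      "h * (k * k) = 0"
    using hk kh by (simp_all add: mult.assoc) (simp_all flip: mult.assoc)
  have "sqrt_one_minus (h * h) * k = k"
    by (intro sqrt_one_minus_mult_annihilated 1 2)
  moreover have "h * sqrt_one_minus (k * k) = h"
    using sqrt_one_minus_mult_annihilated[OF 1(2) 2(4)] sqrt_one_minus_commute[OF 1(2), of h] 2
    by simp
  moreover have "(h + k) * (h + k) = h * h + k * k"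
    by (simp add: algebra_simps hk kh)
  ultimately show ?thesis
    using sqrt_one_minus_mult_orthogonal[OF 1 2(1,2)] hk
    by (simp add: cis_arcsin_def algebra_simps scaleC_mult_left
        scaleC_mult_right scaleC_add_right scaleC_scaleC)
qed

lemma cis_arcsin_0 [simp]: "cis_arcsin 0 = 1"
  using sqrt_one_minus_mult_annihilated[of 0 1] by (simp add: cis_arcsin_def)

lemma norm_le_cis_arcsin_minus_one:
  assumes "star h = h" "norm h \<le> 1"
  shows "norm h \<le> norm (cis_arcsin h - 1)"
proof -
  have "norm h \<le> norm (sqrt_one_minus (h * h) - 1 + \<i> *\<^sub>C h)"
    using assms by (intro norm_imaginary_part_le) (simp_all add: star_diff star_sqrt_one_minus_square)
  then show ?thesis by (simp add: cis_arcsin_def algebra_simps)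
qed

lemma cis_arcsin_near_1:
  assumes "0 < d"
  obtains r where "0 < r" "r \<le> 1"
    "\<And>h :: 'a::unital_cstar_algebra. norm h \<le> r \<Longrightarrow> norm (cis_arcsin h - 1) < d"
proof -
  have lin: "bounded_linear (\<lambda>x :: 'a. \<i> *\<^sub>C x)"
    by (rule bounded_linear_intro[where K = 1])
      (simp_all add: scaleC_add_right norm_scaleC scaleC_scaleC mult.commute flip: scaleC_of_real)
  have "norm (h * h) \<le> 1" if "norm h \<le> 1" for h :: 'a
    using norm_mult_ineq[of h h] mult_le_one[OF that norm_ge_zero that] by linarith
  then have "continuous_on (cball 0 1) (\<lambda>h :: 'a. sqrt_one_minus (h * h) + \<i> *\<^sub>C h)"
    by (intro continuous_intros bounded_linear.continuous_on[OF lin]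
        continuous_on_compose2[OF continuous_on_sqrt_one_minus]) auto
  then have "continuous_on (cball 0 1) (cis_arcsin :: 'a \<Rightarrow> 'a)"
    by (simp add: cis_arcsin_def[abs_def])
  then obtain s where s: "0 < s" "\<And>h :: 'a. norm h \<le> 1 \<Longrightarrow> norm h < s \<Longrightarrow>
      norm (cis_arcsin h - 1) < d"
    using assms unfolding continuous_on_iff
    by (metis dist_norm diff_zero mem_cball_0 norm_zero cis_arcsin_0 zero_le_one)
  show ?thesis
    by (rule that[of "min 1 (s / 2)"]) (use s in auto)
qed

lemma unitary_group_simps [simp]:
  "carrier unitary_group = unitaries"
  "x \<otimes>\<^bsub>unitary_group\<^esub> y = x * y"
  "\<one>\<^bsub>unitary_group\<^esub> = 1"
  by (simp_all add: unitary_group_def)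

lemma group_unitary_group: "group (unitary_group :: 'a::unital_cstar_algebra monoid)"
proof (rule groupI)
  fix x y :: 'a assume "x \<in> carrier unitary_group" "y \<in> carrier unitary_group"
  then show "x \<otimes>\<^bsub>unitary_group\<^esub> y \<in> carrier unitary_group"
    by (simp add: unitaries_def star_mult mult.assoc) (simp flip: mult.assoc[of "star _"] mult.assoc[of _ "star _"])
next
  fix x :: 'a assume "x \<in> carrier unitary_group"
  then show "\<exists>y\<in>carrier unitary_group. y \<otimes>\<^bsub>unitary_group\<^esub> x = \<one>\<^bsub>unitary_group\<^esub>"
    by (intro bexI[of _ "star x"]) (auto simp: unitaries_def star_star)
qed (auto simp: unitaries_def mult.assoc)

lemma inv_unitary_group:
  assumes "u \<in> unitaries" shows "inv\<^bsub>unitary_group\<^esub> u = star u"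
  using assms by (intro group.inv_equality[OF group_unitary_group]) (auto simp: unitaries_def star_star)

lemma nat_pow_unitary_group: "x [^]\<^bsub>unitary_group\<^esub> (n::nat) = x ^ n"
  by (induction n) (simp_all add: nat_pow_def power_commutes)

lemma cis_arcsin_in_unitaries:
  assumes "star h = h" "norm h \<le> 1" shows "cis_arcsin h \<in> unitaries"
  using assms by (simp add: unitaries_def star_cis_arcsin cis_arcsin_unitary)

lemma signed_subproducts_unitary_group:
  fixes hs :: "'a::unital_cstar_algebra list"
  assumes hs: "orthonormal_list hs" and r: "0 < r" "r \<le> 1"
  shows "signed_subproducts unitary_group (map (\<lambda>h. cis_arcsin (r *\<^sub>R h)) hs)
    \<subseteq> (\<lambda>w. cis_arcsin (r *\<^sub>R w)) ` signed_subsums hs"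
  using hs
proof (induction hs)
  case (Cons h hs)
  let ?u = "\<lambda>h :: 'a. cis_arcsin (r *\<^sub>R h)"
  have hs: "orthonormal_list hs" and h: "star h = h" "norm h = 1" "\<And>k. k \<in> set hs \<Longrightarrow> h * k = 0"
    using Cons.prems by (auto simp: orthonormal_list_def)
  have rh: "star (r *\<^sub>R h) = r *\<^sub>R h" "norm (r *\<^sub>R h) \<le> 1"
    using h r by (simp_all add: star_scaleR)
  have inv: "inv\<^bsub>unitary_group\<^esub> (?u h) = ?u (- h)"
    using rh by (simp add: inv_unitary_group cis_arcsin_in_unitaries
        star_cis_arcsin)
  show ?case
  proof
    fix w assume "w \<in> signed_subproducts unitary_group (map ?u (h # hs))"
    then obtain v where "v \<in> signed_subproducts unitary_group (map ?u hs)"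
      "w = v \<or> w = ?u h * v \<or> w = ?u (- h) * v"
      using inv by auto
    then obtain k where k: "k \<in> signed_subsums hs"
      "w = ?u k \<or> w = ?u h * ?u k \<or> w = ?u (- h) * ?u k"
      using Cons.IH[OF hs] by blast
    have rk: "star (r *\<^sub>R k) = r *\<^sub>R k" "norm (r *\<^sub>R k) \<le> 1" "h * k = 0"
      using signed_subsums_self_adjoint[OF hs k(1)] norm_signed_subsums_le[OF hs k(1)]
        signed_subsums_orthogonal[OF k(1)] h(3) r
      by (auto simp: star_scaleR mult_le_one)
    have "?u h * ?u k = ?u (h + k)" "?u (- h) * ?u k = ?u (- h + k)"
      using rh rk cis_arcsin_add[of "r *\<^sub>R h" "r *\<^sub>R k"]
        cis_arcsin_add[of "- (r *\<^sub>R h)" "r *\<^sub>R k"]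
      by (simp_all add: scaleR_add_right star_minus scaleR_diff_right)
    with k show "w \<in> ?u ` signed_subsums (h # hs)" by auto
  qed
qed simp

text \<open>
  With \<open>y = g - 1\<close> one has \<open>g\<^sup>2 - 1 = 2 y + y\<^sup>2\<close>, so squaring stretches the distance from 1 by
  at least \<open>3/2\<close> as long as it is below \<open>1/2\<close>.
\<close>

lemma repeated_squaring_escapes:
  fixes g :: "'a::unital_cstar_algebra"
  assumes g: "\<And>j. j \<le> J \<Longrightarrow> norm (g ^ (2 ^ j) - 1) < 1/2" and j: "j \<le> J"
  shows "norm (g - 1) * (3/2) ^ j \<le> norm (g ^ (2 ^ j) - 1)"
  using j
proof (induction j)
  case (Suc j)
  let ?y = "g ^ (2 ^ j) - 1"
  have "g ^ (2 ^ Suc j) - 1 = 2 *\<^sub>R ?y + ?y * ?y"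
    by (simp add: mult_2 power_add algebra_simps scaleR_2)
  then have "2 * norm ?y - norm ?y * norm ?y \<le> norm (g ^ (2 ^ Suc j) - 1)"
    using norm_diff_ineq[of "2 *\<^sub>R ?y" "?y * ?y"] norm_mult_ineq[of ?y ?y] by simp
  moreover have "norm ?y * norm ?y \<le> 1/2 * norm ?y"
    using g[of j] Suc.prems by (intro mult_right_mono) auto
  ultimately show ?case using Suc by simp
qed simp

text \<open>
  The map \<open>h \<mapsto> exp (\<i> arcsin (r h))\<close> carries signed sums of an orthogonal list to signed
  products, which are therefore near 1 for small \<open>r\<close>. On the other hand \<open>exp (\<i> arcsin (r h))\<close>
  has distance at least \<open>r\<close> from 1, and a number of squarings that depends on \<open>r\<close> only takes it
  out of the ball of radius \<open>1/2\<close>.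
\<close>

theorem finite_dimensional_if_unitary_group_representable:
  assumes sur: "strongly_unitarily_representable TYPE('h)
    (unitary_group :: 'a::unital_cstar_algebra monoid) (top_of_set unitaries)"
  shows "finite_dimensional TYPE('a)"
proof (rule ccontr)
  assume inf: "\<not> finite_dimensional TYPE('a)"
  let ?U = "unitaries :: 'a set" and ?G = "unitary_group :: 'a monoid"
  have V: "openin (top_of_set ?U) (?U \<inter> ball 1 (1/2))" "1 \<in> ?U \<inter> ball 1 (1/2)"
    by (auto intro: openin_open_Int simp: unitaries_def)
  obtain W where W: "openin (top_of_set ?U) W" "1 \<in> W"
    and small: "\<And>M. \<exists>n. \<forall>gs. n \<le> length gs \<longrightarrow> set gs \<subseteq> ?U \<longrightarrow>
      signed_subproducts ?G gs \<subseteq> W \<longrightarrow>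
      (\<exists>g\<in>set gs. \<forall>m\<le>M. g [^]\<^bsub>?G\<^esub> (2 * m :: nat) \<in> ?U \<inter> ball 1 (1/2))"
    by (rule even_powers_small_if_representable[OF sur V(1), unfolded unitary_group_simps, OF V(2)])
      (rule that)
  obtain d where d: "0 < d" "?U \<inter> ball 1 d \<subseteq> W"
    using W by (auto simp: openin_contains_ball Int_commute)
  obtain r where r: "0 < r" "r \<le> 1"
    and near: "\<And>h :: 'a. norm h \<le> r \<Longrightarrow> norm (cis_arcsin h - 1) < min d (1/2)"
    using cis_arcsin_near_1[of "min d (1/2)"] d(1) by auto
  obtain J where J: "1 / r < (3/2) ^ J"
    using real_arch_pow[of "3/2"] by auto
  obtain n where n: "\<And>gs. n \<le> length gs \<Longrightarrow> set gs \<subseteq> ?U \<Longrightarrow> signed_subproducts ?G gs \<subseteq> W \<Longrightarrow>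
      \<exists>g\<in>set gs. \<forall>m\<le>2 ^ J. g [^]\<^bsub>?G\<^esub> (2 * m :: nat) \<in> ?U \<inter> ball 1 (1/2)"
    using small[of "2 ^ J"] by metis
  obtain hs :: "'a list" where hs: "orthonormal_list hs" "n \<le> length hs"
    by (rule long_orthonormal_list[OF inf])
  let ?u = "\<lambda>h :: 'a. cis_arcsin (r *\<^sub>R h)"
  have u: "?u h \<in> ?U" "norm (?u h - 1) < min d (1/2)" if "star h = h" "norm h \<le> 1" for h
  proof -
    have "norm (r *\<^sub>R h) \<le> r" using that r by (simp add: mult_left_le)
    moreover from this have "norm (r *\<^sub>R h) \<le> 1" using r by linarith
    ultimately show "?u h \<in> ?U" "norm (?u h - 1) < min d (1/2)"
      using near[of "r *\<^sub>R h"] that(1)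
      by (auto intro!: cis_arcsin_in_unitaries simp: star_scaleR simp del: norm_scaleR)
  qed
  have sah: "star h = h" "norm h = 1" if "h \<in> set hs" for h
    using hs(1) that by (auto simp: orthonormal_list_def)
  have "signed_subproducts ?G (map ?u hs) \<subseteq> ?u ` signed_subsums hs"
    by (rule signed_subproducts_unitary_group[OF hs(1) r])
  also have "\<dots> \<subseteq> ?U \<inter> ball 1 d"
    using u signed_subsums_self_adjoint[OF hs(1)] norm_signed_subsums_le[OF hs(1)]
    by (force simp: dist_norm norm_minus_commute)
  finally have "signed_subproducts ?G (map ?u hs) \<subseteq> W" using d by blast
  moreover have "set (map ?u hs) \<subseteq> ?U" using u sah by auto
  ultimately obtain h where h: "h \<in> set hs"
    "\<And>m :: nat. m \<le> 2 ^ J \<Longrightarrow> ?u h [^]\<^bsub>?G\<^esub> (2 * m) \<in> ball 1 (1/2)"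
    using n[of "map ?u hs"] hs(2) by auto
  have "norm (?u h ^ (2 ^ j) - 1) < 1/2" if "j \<le> J" for j
  proof (cases j)
    case 0
    then show ?thesis using u[of h] sah[OF h(1)] by simp
  next
    case (Suc i)
    have "(2::nat) ^ i \<le> 2 ^ J" using that Suc by (intro power_increasing) auto
    from h(2)[OF this] show ?thesis
      using Suc by (simp add: nat_pow_unitary_group dist_norm norm_minus_commute)
  qed
  then have "norm (?u h - 1) * (3/2) ^ J \<le> norm (?u h ^ (2 ^ J) - 1)"
    and "norm (?u h ^ (2 ^ J) - 1) < 1/2"
    using repeated_squaring_escapes[of J "?u h" J] by auto
  moreover have "r \<le> norm (?u h - 1)"
    using norm_le_cis_arcsin_minus_one[of "r *\<^sub>R h"] sah[OF h(1)] r
    by (simp add: star_scaleR)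
  then have "r * (3/2) ^ J \<le> norm (?u h - 1) * (3/2) ^ J" by (intro mult_right_mono) auto
  moreover have "1 < r * (3/2) ^ J" using J r by (simp add: field_simps)
  ultimately show False by linarith
qed

section \<open>Unitary representations with a closed embedded orbit\<close>

context complex_inner_product_space
begin

lemma group_unitary_operator_group: "group (unitary_operator_group H)"
proof -
  interpret B: group "BijGroup (carrier H)" by (rule group_BijGroup)
  have "subgroup (unitary_operators H) (BijGroup (carrier H))"
  proof (rule B.subgroupI)
    show "unitary_operators H \<subseteq> carrier (BijGroup (carrier H))"
      by (auto simp: unitary_operators_def BijGroup_def)
    have "(\<lambda>x\<in>carrier H. x) \<in> unitary_operators H"
      by (auto simp: unitary_operators_def id_Bij)
    then show "unitary_operators H \<noteq> {}" by blast
  next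
    fix U assume U: "U \<in> unitary_operators H"
    then have bij: "U \<in> Bij (carrier H)" by (simp add: unitary_operators_def)
    define V where "V = (\<lambda>x\<in>carrier H. inv_into (carrier H) U x)"
    have bb: "bij_betw U (carrier H) (carrier H)" using bij by (simp add: Bij_def)
    have V: "V x \<in> carrier H" "U (V x) = x" if "x \<in> carrier H" for x
      using bb that by (simp_all add: V_def bij_betw_def inv_into_into f_inv_into_f)
    have inj: "x = y" if "U x = U y" "x \<in> carrier H" "y \<in> carrier H" for x y
      using bb that by (auto simp: bij_betw_def inj_on_def)
    have "V \<in> Bij (carrier H)" unfolding V_def by (rule restrict_inv_into_Bij[OF bij])
    moreover have "V (x \<oplus> y) = V x \<oplus> V y" if "x \<in> carrier H" "y \<in> carrier H" for x y
      by (rule inj) (use that V in \<open>simp_all add: unitary_operator_add[OF U]\<close>)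
    moreover have "V (c \<odot> x) = c \<odot> V x" if "x \<in> carrier H" for c x
      by (rule inj) (use that V in \<open>simp_all add: unitary_operator_smult[OF U]\<close>)
    moreover have "cinner H (V x) (V y) = cinner H x y" if "x \<in> carrier H" "y \<in> carrier H" for x y
      using that V unitary_operator_cinner[OF U, of "V x" "V y"] by simp
    ultimately have "V \<in> unitary_operators H" by (simp add: unitary_operators_def)
    then show "inv\<^bsub>BijGroup (carrier H)\<^esub> U \<in> unitary_operators H"
      by (simp add: inv_BijGroup[OF bij] V_def)
  next
    fix U V assume UV: "U \<in> unitary_operators H" "V \<in> unitary_operators H"
    then have "U \<in> Bij (carrier H)" "V \<in> Bij (carrier H)" by (simp_all add: unitary_operators_def)
    then have "U \<otimes>\<^bsub>BijGroup (carrier H)\<^esub> V = compose (carrier H) U V"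
      "compose (carrier H) U V \<in> Bij (carrier H)"
      by (simp_all add: BijGroup_def compose_Bij)
    moreover have "compose (carrier H) U V x = U (V x)" if "x \<in> carrier H" for x
      using that by (simp add: compose_def)
    ultimately show "U \<otimes>\<^bsub>BijGroup (carrier H)\<^esub> V \<in> unitary_operators H"
      using UV unfolding unitary_operators_def
      by (simp add: unitary_operator_closed[OF UV(2)])
  qed
  then show ?thesis
    unfolding unitary_operator_group_def by (rule subgroup.subgroup_is_group) (rule group_BijGroup)
qed

lemma mult_unitary_operator_group:
  assumes "U \<in> unitary_operators H" "V \<in> unitary_operators H"
  shows "U \<otimes>\<^bsub>unitary_operator_group H\<^esub> V = compose (carrier H) U V"
  using assms by (simp add: unitary_operator_group_def BijGroup_def unitary_operators_def)

end

text \<open>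
  If \<open>p\<close> recovers \<open>g\<close> from \<open>f g v\<close>, then \<open>U \<mapsto> p (U v)\<close> is the continuous inverse of \<open>f\<close> on its
  image. The image is closed because it is cut out by closed conditions: \<open>U v\<close> lies in the orbit
  of \<open>v\<close>, and \<open>U a = f (p (U v)) a\<close> for every vector \<open>a\<close>.
\<close>

theorem representable_if_closed_embedded_orbit:
  fixes H :: "'h inner_product_space"
  assumes H: "complex_hilbert_space H"
    and top: "topological_group G T" and haus: "Hausdorff_space T"
    and hom: "f \<in> hom G (unitary_operator_group H)"
    and cont: "\<And>a. a \<in> carrier H \<Longrightarrow>
      continuous_map T (Metric_space.mtopology (carrier H) (hdist H)) (\<lambda>g. f g a)"
    and v: "v \<in> carrier H"
    and closed: "closedin (Metric_space.mtopology (carrier H) (hdist H)) ((\<lambda>g. f g v) ` carrier G)"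
    and p: "continuous_map (subtopology (Metric_space.mtopology (carrier H) (hdist H))
        ((\<lambda>g. f g v) ` carrier G)) T p"
    and pf: "\<And>g. g \<in> carrier G \<Longrightarrow> p (f g v) = g"
  shows "strongly_unitarily_representable TYPE('h) G T"
proof -
  interpret H: complex_hilbert_space H by (rule H)
  interpret M: Metric_space "carrier H" "hdist H" by (rule H.hdist_metric)
  have G: "group G" and topT: "topspace T = carrier G"
    using top by (auto simp: topological_group_def)
  interpret U: group "unitary_operator_group H" by (rule H.group_unitary_operator_group)
  interpret hom: group_hom G "unitary_operator_group H" f
    by (intro group_hom.intro group_hom_axioms.intro G U.group_axioms hom)
  let ?SOT = "strong_operator_topology H" and ?O = "(\<lambda>g. f g v) ` carrier G"
  define K where "K = f ` carrier G"
  have fU: "f g \<in> unitary_operators H" if "g \<in> carrier G" for g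
    using hom that by (auto simp: hom_def unitary_operator_group_def)
  have K: "subgroup K (unitary_operator_group H)"
    unfolding K_def by (rule hom.img_is_subgroup)
  have topSOT: "topspace ?SOT = unitary_operators H"
    by (auto simp: strong_operator_topology_def unitary_operators_def Bij_def PiE_def bij_betw_def)
  have eval: "continuous_map ?SOT M.mtopology (\<lambda>U. U a)" if "a \<in> carrier H" for a
    unfolding strong_operator_topology_def
    by (intro continuous_map_from_subtopology continuous_map_product_projection that)
  define A where "A = {U \<in> topspace ?SOT. U v \<in> ?O}"
  have A: "closedin ?SOT A"
    unfolding A_def by (rule closedin_continuous_map_preimage[OF eval[OF v] closed])
  have "continuous_map (subtopology ?SOT A) M.mtopology (\<lambda>U. U v)"
    by (rule continuous_map_from_subtopology[OF eval[OF v]])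
  then have "continuous_map (subtopology ?SOT A) (subtopology M.mtopology ?O) (\<lambda>U. U v)"
    by (intro continuous_map_into_subtopology) (auto simp: A_def)
  then have r: "continuous_map (subtopology ?SOT A) T (\<lambda>U. p (U v))"
    using continuous_map_compose[OF _ p] by (simp add: o_def)
  have eqA: "closedin (subtopology ?SOT A)
      {U \<in> topspace (subtopology ?SOT A). U a = f (p (U v)) a}" if a: "a \<in> carrier H" for a
  proof (rule closedin_continuous_maps_eq[OF M.Hausdorff_space_mtopology])
    show "continuous_map (subtopology ?SOT A) M.mtopology (\<lambda>U. U a)"
      by (rule continuous_map_from_subtopology[OF eval[OF a]])
    show "continuous_map (subtopology ?SOT A) M.mtopology (\<lambda>U. f (p (U v)) a)"
      using continuous_map_compose[OF r cont[OF a]] by (simp add: o_def)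
  qed
  have "closedin (subtopology ?SOT A)
      (\<Inter>a\<in>carrier H. {U \<in> topspace (subtopology ?SOT A). U a = f (p (U v)) a})"
    using v eqA by (intro closedin_INT) auto
  also have "(\<Inter>a\<in>carrier H. {U \<in> topspace (subtopology ?SOT A). U a = f (p (U v)) a}) = K"
  proof (intro equalityI subsetI)
    fix U assume U: "U \<in> (\<Inter>a\<in>carrier H. {U \<in> topspace (subtopology ?SOT A). U a = f (p (U v)) a})"
    then have "U \<in> A" using v by auto
    then obtain g where g: "g \<in> carrier G" "U v = f g v" and UU: "U \<in> unitary_operators H"
      by (auto simp: A_def topSOT)
    have "U = f g"
    proof (rule extensionalityI)
      show "U \<in> extensional (carrier H)" "f g \<in> extensional (carrier H)"
        using UU fU[OF g(1)] by (auto simp: unitary_operators_def Bij_def)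
      show "U a = f g a" if "a \<in> carrier H" for a
        using U that g pf by auto
    qed
    then show "U \<in> K" using g by (simp add: K_def)
  next
    fix U assume "U \<in> K"
    then obtain g where "g \<in> carrier G" "U = f g" by (auto simp: K_def)
    then show "U \<in> (\<Inter>a\<in>carrier H. {U \<in> topspace (subtopology ?SOT A). U a = f (p (U v)) a})"
      using fU pf by (auto simp: A_def topSOT)
  qed
  finally have closedK: "closedin ?SOT K"
    using A closedin_trans_full by blast
  have KA: "K \<subseteq> A" using fU by (auto simp: K_def A_def topSOT)
  have f_cont: "continuous_map T (subtopology ?SOT K) f"
  proof -
    have "f ` topspace T \<subseteq> extensional (carrier H)"
      using fU topT by (auto simp: unitary_operators_def Bij_def)
    then have "continuous_map T (product_topology (\<lambda>_. M.mtopology) (carrier H)) f"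
      using cont by (simp add: continuous_map_componentwise)
    then show ?thesis
      using fU topT unfolding strong_operator_topology_def
      by (auto simp: continuous_map_in_subtopology K_def)
  qed
  have r_cont: "continuous_map (subtopology ?SOT K) T (\<lambda>U. p (U v))"
    using continuous_map_from_subtopology_mono[OF r KA] .
  have "homeomorphic_maps T (subtopology ?SOT K) f (\<lambda>U. p (U v))"
    using f_cont r_cont pf topT by (auto simp: homeomorphic_maps_def K_def)
  then have "homeomorphic_map T (subtopology ?SOT K) f"
    unfolding homeomorphic_map_maps by blast
  moreover have "f \<in> iso G (unitary_operator_group H\<lparr>carrier := K\<rparr>)"
  proof -
    have "inj_on f (carrier G)" using pf by (metis inj_onI)
    then show ?thesis
      using hom by (auto simp: iso_def hom_def K_def bij_betw_def)
  qed
  ultimately show ?thesis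
    using H K closedK top haus unfolding strongly_unitarily_representable_def by blast
qed

text \<open>
  The elements of \<open>C\<close> represent the vectors of a Hilbert space, and \<open>code\<close> names the vector
  represented by an element of \<open>C\<close> by a point of the type \<open>'h\<close>. Taking equivalence classes and
  moving the space into \<open>'h\<close> is thus done in one step. For square-integrable functions \<open>code\<close>
  identifies functions that agree almost everywhere; for a space of genuine vectors it is
  injective.
\<close>

locale hilbert_presentation =
  fixes C :: "'b::ab_group_add set"
    and sc :: "complex \<Rightarrow> 'b \<Rightarrow> 'b"
    and ip :: "'b \<Rightarrow> 'b \<Rightarrow> complex"
    and code :: "'b \<Rightarrow> 'h"
  assumes zero_mem: "0 \<in> C"
    and add_mem: "x \<in> C \<Longrightarrow> y \<in> C \<Longrightarrow> x + y \<in> C"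
    and sc_mem: "x \<in> C \<Longrightarrow> sc c x \<in> C"
    and sc_add_right: "x \<in> C \<Longrightarrow> y \<in> C \<Longrightarrow> sc c (x + y) = sc c x + sc c y"
    and sc_add_left: "x \<in> C \<Longrightarrow> sc (c + d) x = sc c x + sc d x"
    and sc_sc: "x \<in> C \<Longrightarrow> sc (c * d) x = sc c (sc d x)"
    and sc_one: "x \<in> C \<Longrightarrow> sc 1 x = x"
    and ip_add_left: "x \<in> C \<Longrightarrow> y \<in> C \<Longrightarrow> z \<in> C \<Longrightarrow> ip (x + y) z = ip x z + ip y z"
    and ip_sc_left: "x \<in> C \<Longrightarrow> y \<in> C \<Longrightarrow> ip (sc c x) y = c * ip x y"
    and ip_commute: "x \<in> C \<Longrightarrow> y \<in> C \<Longrightarrow> ip y x = cnj (ip x y)"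
    and ip_pos: "x \<in> C \<Longrightarrow> code x \<noteq> code 0 \<Longrightarrow> 0 < Re (ip x x)"
    and code_add: "x \<in> C \<Longrightarrow> x' \<in> C \<Longrightarrow> y \<in> C \<Longrightarrow> y' \<in> C \<Longrightarrow>
      code x = code x' \<Longrightarrow> code y = code y' \<Longrightarrow> code (x + y) = code (x' + y')"
    and code_sc: "x \<in> C \<Longrightarrow> x' \<in> C \<Longrightarrow> code x = code x' \<Longrightarrow> code (sc c x) = code (sc c x')"
    and code_ip: "x \<in> C \<Longrightarrow> x' \<in> C \<Longrightarrow> y \<in> C \<Longrightarrow> y' \<in> C \<Longrightarrow>
      code x = code x' \<Longrightarrow> code y = code y' \<Longrightarrow> ip x y = ip x' y'"
    and seq_complete: "\<And>X :: nat \<Rightarrow> 'b. (\<And>n. X n \<in> C) \<Longrightarrow>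
      (\<And>e. 0 < e \<Longrightarrow> \<exists>N. \<forall>m\<ge>N. \<forall>n\<ge>N. sqrt (Re (ip (X m - X n) (X m - X n))) < e) \<Longrightarrow>
      \<exists>l\<in>C. \<forall>e>0. \<exists>N. \<forall>n\<ge>N. sqrt (Re (ip (X n - l) (X n - l))) < e"
begin

definition rep :: "'h \<Rightarrow> 'b" where "rep = inv_into C code"

definition H :: "'h inner_product_space" where
  "H = \<lparr>carrier = code ` C, monoid.mult = undefined, one = undefined, zero = code 0,
    add = (\<lambda>a b. code (rep a + rep b)), smult = (\<lambda>c a. code (sc c (rep a))),
    cinner = (\<lambda>a b. ip (rep a) (rep b))\<rparr>"

definition nrm :: "'b \<Rightarrow> real" where "nrm x = sqrt (Re (ip x x))"

lemma rep_mem: "x \<in> C \<Longrightarrow> rep (code x) \<in> C"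
  by (simp add: rep_def inv_into_into)

lemma code_rep: "x \<in> C \<Longrightarrow> code (rep (code x)) = code x"
  by (simp add: rep_def f_inv_into_f)

lemma carrier_H: "carrier H = code ` C" and zero_H: "\<zero>\<^bsub>H\<^esub> = code 0"
  by (simp_all add: H_def)

lemma add_H: "x \<in> C \<Longrightarrow> y \<in> C \<Longrightarrow> code x \<oplus>\<^bsub>H\<^esub> code y = code (x + y)"
  by (auto simp: H_def intro!: code_add rep_mem code_rep)

lemma smult_H: "x \<in> C \<Longrightarrow> c \<odot>\<^bsub>H\<^esub> code x = code (sc c x)"
  by (auto simp: H_def intro!: code_sc rep_mem code_rep)

lemma cinner_H: "x \<in> C \<Longrightarrow> y \<in> C \<Longrightarrow> cinner H (code x) (code y) = ip x y"
  by (auto simp: H_def intro!: code_ip rep_mem code_rep)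

lemma sc_minus_one: assumes "x \<in> C" shows "sc (- 1) x = - x"
proof -
  have "sc 0 x = 0" using sc_add_left[OF assms, of 0 0] by simp
  then show ?thesis
    using sc_add_left[OF assms, of "-1" 1] sc_one[OF assms] by (simp add: eq_neg_iff_add_eq_0)
qed

lemma uminus_mem: "x \<in> C \<Longrightarrow> - x \<in> C"
  using sc_mem[of x "- 1"] by (simp add: sc_minus_one)

lemma diff_mem: "x \<in> C \<Longrightarrow> y \<in> C \<Longrightarrow> x - y \<in> C"
  using add_mem[of x "- y"] uminus_mem by simp

lemma cring_complex_ring: "cring complex_ring"
proof (rule cringI)
  show "abelian_group complex_ring"
    by (rule abelian_groupI)
      (auto simp: complex_ring_def algebra_simps intro: exI[of _ "- _"] left_minus)
  show "comm_monoid complex_ring"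
    by (rule comm_monoidI) (simp_all add: complex_ring_def)
qed (simp add: complex_ring_def distrib_right)

lemma abelian_group_H: "abelian_group H"
proof (rule abelian_groupI)
  fix a assume "a \<in> carrier H"
  then obtain x where x: "x \<in> C" "a = code x" by (auto simp: carrier_H)
  have "code (- x) \<oplus>\<^bsub>H\<^esub> a = \<zero>\<^bsub>H\<^esub>"
    using x by (simp add: add_H uminus_mem zero_H)
  then show "\<exists>b\<in>carrier H. b \<oplus>\<^bsub>H\<^esub> a = \<zero>\<^bsub>H\<^esub>"
    using x by (auto simp: carrier_H uminus_mem intro!: bexI[of _ "code (- x)"])
qed (auto simp: carrier_H zero_H add_H add_mem zero_mem ac_simps)

sublocale complex_inner_product_space H
proof (intro complex_inner_product_space.intro moduleI cring_complex_ring abelian_group_H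
    complex_inner_product_space_axioms.intro)
  show "0 < Re (cinner H a a)" if "a \<in> carrier H" "a \<noteq> \<zero>\<^bsub>H\<^esub>" for a
    using that by (auto simp: carrier_H zero_H cinner_H intro: ip_pos)
qed (auto simp: complex_ring_def carrier_H add_H smult_H cinner_H sc_mem add_mem sc_add_left
    sc_add_right sc_sc sc_one ip_add_left ip_sc_left intro: ip_commute)

lemma hdist_code: assumes "x \<in> C" "y \<in> C" shows "hdist H (code x) (code y) = nrm (x - y)"
proof -
  have m: "code (- y) = \<ominus>\<^bsub>H\<^esub> code y"
    using assms by (intro minus_equality[symmetric]) (simp_all add: add_H uminus_mem zero_H carrier_H)
  have "code x \<ominus>\<^bsub>H\<^esub> code y = code (x - y)"
    using assms by (simp add: a_minus_def uminus_mem add_H flip: m)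
  then show ?thesis
    using assms by (simp add: hdist_eq carrier_H hnorm_def nrm_def cinner_H diff_mem)
qed

lemma code_eq_iff: "x \<in> C \<Longrightarrow> y \<in> C \<Longrightarrow> code x = code y \<longleftrightarrow> nrm (x - y) = 0"
  using Metric_space.zero[OF hdist_metric, of "code x" "code y"] by (simp add: hdist_code carrier_H)

text \<open>
  Completeness is the sequential completeness of the representatives, because \<open>hdist\<close> on codes
  is \<open>nrm\<close> of the difference.
\<close>

lemma hilbert_H: "complex_hilbert_space H"
proof -
  interpret M: Metric_space "carrier H" "hdist H" by (rule hdist_metric)
  have "M.mcomplete"
    unfolding M.mcomplete_def
  proof (intro allI impI)
    fix X :: "nat \<Rightarrow> 'h" assume X: "M.MCauchy X"
    define Y where "Y n = rep (X n)" for n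
    have "range X \<subseteq> carrier H" using X by (simp add: M.MCauchy_def)
    then have XC: "X n \<in> code ` C" for n by (auto simp: carrier_H)
    have Y: "Y n \<in> C" "code (Y n) = X n" for n
      using XC[of n] by (auto simp: Y_def rep_mem code_rep)
    have d: "hdist H (X m) (X n) = nrm (Y m - Y n)" for m n
      using hdist_code[OF Y(1) Y(1), of m n] by (simp add: Y(2))
    have "\<exists>l\<in>C. \<forall>e>0. \<exists>N. \<forall>n\<ge>N. nrm (Y n - l) < e"
      unfolding nrm_def
    proof (rule seq_complete[OF Y(1)])
      show "\<exists>N. \<forall>m\<ge>N. \<forall>n\<ge>N. sqrt (Re (ip (Y m - Y n) (Y m - Y n))) < e" if "0 < e" for e
        using X that unfolding M.MCauchy_def d nrm_def by meson
    qed
    then obtain l where l: "l \<in> C" "\<And>e. 0 < e \<Longrightarrow> \<exists>N. \<forall>n\<ge>N. nrm (Y n - l) < e" by blast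
    have "hdist H (X n) (code l) = nrm (Y n - l)" for n
      using hdist_code[OF Y(1) l(1), of n] by (simp add: Y(2))
    then have "limitin M.mtopology X (code l) sequentially"
      unfolding M.limit_metric_sequentially using l XC by (simp add: carrier_H)
    then show "\<exists>x. limitin M.mtopology X x sequentially" by blast
  qed
  then show ?thesis
    by (intro complex_hilbert_space.intro complex_hilbert_space_axioms.intro module_axioms
        cinner_add_left cinner_smult_left cinner_commute cinner_pos)
qed

text \<open>
  A Cauchy sequence in the orbit of \<open>v\<close> comes from a Cauchy sequence in \<open>S\<close> because the inverse
  of the orbit map is uniformly continuous. Completeness of \<open>S\<close> therefore makes the orbit
  closed.
\<close>

theorem representable_if_uniform_orbit:
  fixes G :: "('g::metric_space, 'm) monoid_scheme"
  assumes top: "topological_group G (top_of_set S)" and S: "complete S"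
    and closed: "\<And>g x. g \<in> S \<Longrightarrow> x \<in> C \<Longrightarrow> \<pi> g x \<in> C"
    and add: "\<And>g x y. g \<in> S \<Longrightarrow> x \<in> C \<Longrightarrow> y \<in> C \<Longrightarrow> \<pi> g (x + y) = \<pi> g x + \<pi> g y"
    and scale: "\<And>g c x. g \<in> S \<Longrightarrow> x \<in> C \<Longrightarrow> \<pi> g (sc c x) = sc c (\<pi> g x)"
    and inner: "\<And>g x y. g \<in> S \<Longrightarrow> x \<in> C \<Longrightarrow> y \<in> C \<Longrightarrow> ip (\<pi> g x) (\<pi> g y) = ip x y"
    and mult: "\<And>g h x. g \<in> S \<Longrightarrow> h \<in> S \<Longrightarrow> x \<in> C \<Longrightarrow> \<pi> (g \<otimes>\<^bsub>G\<^esub> h) x = \<pi> g (\<pi> h x)"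
    and one: "\<And>x. x \<in> C \<Longrightarrow> \<pi> \<one>\<^bsub>G\<^esub> x = x"
    and cont: "\<And>g x e. g \<in> S \<Longrightarrow> x \<in> C \<Longrightarrow> 0 < e \<Longrightarrow>
      \<exists>d>0. \<forall>h\<in>S. dist h g < d \<longrightarrow> nrm (\<pi> h x - \<pi> g x) < e"
    and v: "v \<in> C"
    and orbit: "\<And>e. 0 < e \<Longrightarrow> \<exists>d>0. \<forall>g\<in>S. \<forall>h\<in>S. nrm (\<pi> g v - \<pi> h v) < d \<longrightarrow> dist g h < e"
  shows "strongly_unitarily_representable TYPE('h) G (top_of_set S)"
proof -
  interpret M: Metric_space "carrier H" "hdist H" by (rule hdist_metric)
  have G: "group G" and carrier: "carrier G = S"
    using top by (auto simp: topological_group_def)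
  interpret G: group G by (rule G)
  have \<pi>_code: "code (\<pi> g x) = code (\<pi> g y)" if "g \<in> S" "x \<in> C" "y \<in> C" "code x = code y" for g x y
  proof -
    have "\<pi> g x = \<pi> g (x - y) + \<pi> g y"
      using add[OF that(1) diff_mem[OF that(2,3)] that(3)] by simp
    then have "nrm (\<pi> g x - \<pi> g y) = nrm (x - y)"
      using that by (simp add: nrm_def inner diff_mem)
    then show ?thesis using that by (simp add: code_eq_iff closed)
  qed
  define f where "f g = (\<lambda>a\<in>carrier H. code (\<pi> g (rep a)))" for g
  have f: "f g (code x) = code (\<pi> g x)" if "g \<in> S" "x \<in> C" for g x
    using that by (auto simp: f_def carrier_H intro!: \<pi>_code rep_mem code_rep)
  have inv: "f (inv\<^bsub>G\<^esub> g) (f g a) = a" "f g (f (inv\<^bsub>G\<^esub> g) a) = a"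
    if g: "g \<in> S" and a: "a \<in> carrier H" for g a
  proof -
    obtain x where x: "x \<in> C" "a = code x" using a by (auto simp: carrier_H)
    have i: "inv\<^bsub>G\<^esub> g \<in> S" using g carrier by auto
    show "f (inv\<^bsub>G\<^esub> g) (f g a) = a" "f g (f (inv\<^bsub>G\<^esub> g) a) = a"
      using g x i carrier by (simp_all add: f closed one flip: mult)
  qed
  have fU: "f g \<in> unitary_operators H" if g: "g \<in> S" for g
  proof -
    have fc: "f h a \<in> carrier H" if "h \<in> S" "a \<in> carrier H" for h a
      using that by (auto simp: carrier_H f closed)
    have "inv\<^bsub>G\<^esub> g \<in> S" using g carrier by auto
    then have "bij_betw (f g) (carrier H) (carrier H)"
      using g inv fc by (intro bij_betw_byWitness[where f' = "f (inv\<^bsub>G\<^esub> g)"]) auto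
    then have "f g \<in> Bij (carrier H)" by (simp add: Bij_def f_def)
    then show ?thesis
      using g by (auto simp: unitary_operators_def carrier_H add_H smult_H cinner_H f closed
          add_mem sc_mem add scale inner)
  qed
  have hom: "f \<in> hom G (unitary_operator_group H)"
  proof (rule homI)
    show "f g \<in> carrier (unitary_operator_group H)" if "g \<in> carrier G" for g
      using fU that carrier by (simp add: unitary_operator_group_def)
    show "f (g \<otimes>\<^bsub>G\<^esub> h) = f g \<otimes>\<^bsub>unitary_operator_group H\<^esub> f h"
      if "g \<in> carrier G" "h \<in> carrier G" for g h
    proof -
      have gh: "g \<in> S" "h \<in> S" "g \<otimes>\<^bsub>G\<^esub> h \<in> S" using that carrier by auto
      have "f (g \<otimes>\<^bsub>G\<^esub> h) = compose (carrier H) (f g) (f h)"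
      proof (rule extensionalityI[of _ "carrier H"])
        show "f (g \<otimes>\<^bsub>G\<^esub> h) a = compose (carrier H) (f g) (f h) a" if "a \<in> carrier H" for a
          using that gh by (auto simp: carrier_H compose_eq f mult closed)
      qed (simp_all add: f_def)
      then show ?thesis using fU gh by (simp add: mult_unitary_operator_group)
    qed
  qed
  have fcont: "continuous_map (top_of_set S) M.mtopology (\<lambda>g. f g a)" if a: "a \<in> carrier H" for a
  proof -
    obtain x where x: "x \<in> C" "a = code x" using a by (auto simp: carrier_H)
    show ?thesis
      unfolding M.continuous_map_to_metric
    proof (intro ballI allI impI)
      fix g and e :: real assume "g \<in> topspace (top_of_set S)" "0 < e"
      then have g: "g \<in> S" "0 < e" by auto
      obtain d where d: "0 < d" "\<And>h. h \<in> S \<Longrightarrow> dist h g < d \<Longrightarrow> nrm (\<pi> h x - \<pi> g x) < e"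
        using cont[OF g(1) x(1) g(2)] by blast
      have "f h a \<in> M.mball (f g a) e" if "h \<in> S \<inter> ball g d" for h
      proof -
        have h: "h \<in> S" "dist h g < d" using that by (auto simp: dist_commute)
        have "hdist H (f g a) (f h a) = hdist H (f h a) (f g a)" by (rule M.commute)
        also have "\<dots> < e" using d(2)[OF h] x h g by (simp add: f hdist_code closed)
        finally have "hdist H (f g a) (f h a) < e" .
        moreover have "f h a \<in> carrier H" "f g a \<in> carrier H"
          using x h g by (auto simp: f carrier_H closed)
        ultimately show ?thesis by simp
      qed
      then show "\<exists>U. openin (top_of_set S) U \<and> g \<in> U \<and> (\<forall>h\<in>U. f h a \<in> M.mball (f g a) e)"
        using g d(1) by (intro exI[of _ "S \<inter> ball g d"]) (auto intro: openin_open_Int)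
    qed
  qed
  have vH: "code v \<in> carrier H" using v by (simp add: carrier_H)
  define q where "q g = f g (code v)" for g
  have q_dist: "hdist H (q g) (q h) = nrm (\<pi> g v - \<pi> h v)" if "g \<in> S" "h \<in> S" for g h
    using that v by (simp add: q_def f hdist_code closed)
  have qH: "q g \<in> carrier H" if "g \<in> S" for g
    using that v by (auto simp: q_def f closed carrier_H)
  have q_inj: "inj_on q S"
  proof (rule inj_onI)
    fix g h assume gh: "g \<in> S" "h \<in> S" "q g = q h"
    then have "nrm (\<pi> g v - \<pi> h v) = 0"
      using q_dist[of g h] qH by (simp add: M.mdist_zero)
    then have "dist g h < e" if "0 < e" for e
      using orbit[OF that] gh by auto
    from this[of "dist g h"] show "g = h"
      by (cases "g = h") simp_all
  qed
  have orbit_eq: "(\<lambda>g. f g (code v)) ` carrier G = q ` S"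
    using carrier by (simp add: q_def)
  have closed_orbit: "closedin M.mtopology (q ` S)"
    unfolding M.metric_closedin_iff_sequentially_closed
  proof (intro conjI allI impI)
    show "q ` S \<subseteq> carrier H" using qH by blast
    fix X l assume X: "range X \<subseteq> q ` S \<and> limitin M.mtopology X l sequentially"
    then have XS: "X n \<in> q ` S" for n by blast
    define g where "g n = inv_into S q (X n)" for n
    have g: "g n \<in> S" "X n = q (g n)" for n
      using XS[of n] by (simp_all add: g_def inv_into_into f_inv_into_f)
    have "M.MCauchy X"
      using X qH by (intro M.convergent_imp_MCauchy) auto
    have "Cauchy g"
    proof (rule metric_CauchyI)
      fix e :: real assume "0 < e"
      then obtain d where d: "0 < d" "\<And>g h. g \<in> S \<Longrightarrow> h \<in> S \<Longrightarrow> nrm (\<pi> g v - \<pi> h v) < d \<Longrightarrow> dist g h < e"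
        using orbit by meson
      obtain N where "\<And>m n. N \<le> m \<Longrightarrow> N \<le> n \<Longrightarrow> hdist H (X m) (X n) < d"
        using \<open>M.MCauchy X\<close> d(1) unfolding M.MCauchy_def by meson
      then have "dist (g m) (g n) < e" if "N \<le> m" "N \<le> n" for m n
        using that d(2) g q_dist by metis
      then show "\<exists>N. \<forall>m\<ge>N. \<forall>n\<ge>N. dist (g m) (g n) < e" by blast
    qed
    then obtain h where h: "h \<in> S" "g \<longlonglongrightarrow> h"
      using S g(1) unfolding complete_def by blast
    then have "limitin (top_of_set S) g h sequentially"
      using g(1) by (simp add: limitin_subtopology)
    then have "limitin M.mtopology (\<lambda>n. q (g n)) (q h) sequentially"
      using continuous_map_limit[OF fcont[OF vH]] by (simp add: q_def o_def)
    then have "limitin M.mtopology X (q h) sequentially"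
      by (simp flip: g(2))
    then have "l = q h"
      using X M.limitin_metric_unique trivial_limit_sequentially by blast
    then show "l \<in> q ` S" using h by blast
  qed
  define p where "p = inv_into S q"
  have pq: "p (q g) = g" if "g \<in> S" for g
    using that q_inj by (simp add: p_def inv_into_f_f)
  have "continuous_map (subtopology M.mtopology (q ` S)) (top_of_set S) p"
    unfolding continuous_map_in_subtopology
  proof
    show "p \<in> topspace (subtopology M.mtopology (q ` S)) \<rightarrow> S"
      using pq by auto
    have "continuous_map (subtopology M.mtopology (q ` S)) Met_TC.mtopology p"
      unfolding Met_TC.continuous_map_to_metric
    proof (intro ballI allI impI)
      fix a and e :: real assume "a \<in> topspace (subtopology M.mtopology (q ` S))" "0 < e"
      then obtain g where g: "g \<in> S" "a = q g" and e: "0 < e" by auto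
      obtain d where d: "0 < d" "\<And>g h. g \<in> S \<Longrightarrow> h \<in> S \<Longrightarrow> nrm (\<pi> g v - \<pi> h v) < d \<Longrightarrow> dist g h < e"
        using orbit[OF e] by meson
      have "p b \<in> Met_TC.mball (p a) e" if "b \<in> q ` S \<inter> M.mball a d" for b
        using that g d(2) q_dist pq by auto
      then show "\<exists>U. openin (subtopology M.mtopology (q ` S)) U \<and> a \<in> U \<and>
          (\<forall>b\<in>U. p b \<in> Met_TC.mball (p a) e)"
        using g d(1) qH by (intro exI[of _ "q ` S \<inter> M.mball a d"])
          (auto simp: openin_subtopology_Int2)
    qed
    then show "continuous_map (subtopology M.mtopology (q ` S)) euclidean p"
      by (simp add: mtopology_is_euclidean)
  qed
  then show ?thesis
    using closed_orbit pq fcont carrier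
    by (intro representable_if_closed_embedded_orbit[OF hilbert_H top _ hom _ vH, of p])
      (simp_all add: orbit_eq q_def[symmetric] Hausdorff_space_subtopology)
qed

end

section \<open>Square-integrable functions\<close>

definition L2 :: "'x measure \<Rightarrow> ('x \<Rightarrow> complex) set" where
  "L2 M = {f \<in> borel_measurable M. integrable M (\<lambda>x. (cmod (f x))\<^sup>2)}"

definition L2_inner :: "'x measure \<Rightarrow> ('x \<Rightarrow> complex) \<Rightarrow> ('x \<Rightarrow> complex) \<Rightarrow> complex" where
  "L2_inner M f g = (\<integral>x. f x * cnj (g x) \<partial>M)"

lemma L2_measurable: "f \<in> L2 M \<Longrightarrow> f \<in> borel_measurable M"
  by (simp add: L2_def)

lemma L2_square: "f \<in> L2 M \<Longrightarrow> integrable M (\<lambda>x. (cmod (f x))\<^sup>2)"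
  by (simp add: L2_def)

lemma L2_inner_integrable:
  assumes "f \<in> L2 M" "g \<in> L2 M"
  shows "integrable M (\<lambda>x. f x * cnj (g x))"
proof (rule Bochner_Integration.integrable_bound)
  show "integrable M (\<lambda>x. (cmod (f x))\<^sup>2 + (cmod (g x))\<^sup>2)"
    by (intro Bochner_Integration.integrable_add L2_square assms)
  have [measurable]: "f \<in> borel_measurable M" "g \<in> borel_measurable M"
    using assms by (simp_all add: L2_measurable)
  have [measurable]: "cnj \<in> borel_measurable borel"
    by (intro borel_measurable_continuous_onI continuous_intros)
  show "(\<lambda>x. f x * cnj (g x)) \<in> borel_measurable M" by measurable
  have "cmod a * cmod b \<le> (cmod a)\<^sup>2 + (cmod b)\<^sup>2" for a b
  proof -
    have "0 \<le> cmod a * cmod b" by simp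
    then show ?thesis using sum_squares_bound[of "cmod a" "cmod b"] by linarith
  qed
  then show "AE x in M. norm (f x * cnj (g x)) \<le> norm ((cmod (f x))\<^sup>2 + (cmod (g x))\<^sup>2)"
    by (simp add: norm_mult)
qed

lemma L2_add: assumes "f \<in> L2 M" "g \<in> L2 M" shows "f + g \<in> L2 M"
proof -
  have [measurable]: "f \<in> borel_measurable M" "g \<in> borel_measurable M"
    using assms by (simp_all add: L2_measurable)
  have "(cmod (a + b))\<^sup>2 \<le> 2 * (cmod a)\<^sup>2 + 2 * (cmod b)\<^sup>2" for a b
  proof -
    have "(cmod (a + b))\<^sup>2 \<le> (cmod a + cmod b)\<^sup>2"
      by (intro power_mono norm_triangle_ineq) simp
    also have "\<dots> \<le> 2 * (cmod a)\<^sup>2 + 2 * (cmod b)\<^sup>2"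
      using sum_squares_bound[of "cmod a" "cmod b"] by (simp add: power2_sum)
    finally show ?thesis .
  qed
  then have "integrable M (\<lambda>x. (cmod (f x + g x))\<^sup>2)"
    by (intro Bochner_Integration.integrable_bound[OF
          Bochner_Integration.integrable_add[OF integrable_mult_right[OF L2_square[OF assms(1)], of 2]
            integrable_mult_right[OF L2_square[OF assms(2)], of 2]]]) auto
  then show ?thesis by (simp add: L2_def plus_fun_def)
qed

lemma L2_bounded_mult:
  assumes f: "f \<in> L2 M" and [measurable]: "h \<in> borel_measurable M" and h: "\<And>x. cmod (h x) \<le> B"
  shows "(\<lambda>x. h x * f x) \<in> L2 M"
proof -
  have [measurable]: "f \<in> borel_measurable M" by (rule L2_measurable[OF f])
  have "(cmod (h x))\<^sup>2 * (cmod (f x))\<^sup>2 \<le> B\<^sup>2 * (cmod (f x))\<^sup>2" for x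
    using h[of x] by (intro mult_right_mono power_mono) auto
  then have "integrable M (\<lambda>x. (cmod (h x * f x))\<^sup>2)"
    by (intro Bochner_Integration.integrable_bound[OF integrable_mult_right[OF L2_square[OF f], of "B\<^sup>2"]])
      (auto simp: norm_mult power_mult_distrib)
  then show ?thesis by (simp add: L2_def)
qed

lemma L2_scale: "f \<in> L2 M \<Longrightarrow> (\<lambda>x. c * f x) \<in> L2 M"
  by (rule L2_bounded_mult[where B = "cmod c"]) simp_all

lemma L2_diff: assumes "f \<in> L2 M" "g \<in> L2 M" shows "f - g \<in> L2 M"
proof -
  have eq: "f - g = f + (\<lambda>x. -1 * g x)" by (auto simp: fun_eq_iff)
  show ?thesis unfolding eq by (intro L2_add L2_scale assms)
qed

lemma L2_inner_self: "L2_inner M f f = of_real (\<integral>x. (cmod (f x))\<^sup>2 \<partial>M)"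
  unfolding L2_inner_def complex_norm_square[symmetric] by (rule integral_complex_of_real)

lemma (in finite_measure) L2_integrable:
  assumes "f \<in> L2 M" shows "integrable M f"
proof (rule Bochner_Integration.integrable_bound)
  show "integrable M (\<lambda>x. 1 + (cmod (f x))\<^sup>2)"
    by (intro Bochner_Integration.integrable_add L2_square assms) simp
  have "a \<le> 1 + a\<^sup>2" for a :: real
    using zero_le_power2[of "a - 1/2"] by (simp add: power2_diff power_divide)
  then show "AE x in M. norm (f x) \<le> norm (1 + (cmod (f x))\<^sup>2)" by simp
qed (rule L2_measurable[OF assms])

text \<open>
  The Riesz-Fischer theorem. On a finite measure space a Cauchy sequence in \<open>L\<^sup>2\<close> is one in
  \<open>L\<^sup>1\<close>, so a subsequence converges almost everywhere; Fatou's lemma shows that its limit is the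
  limit in \<open>L\<^sup>2\<close>.
\<close>

theorem (in finite_measure) L2_complete:
  fixes X :: "nat \<Rightarrow> 'a \<Rightarrow> complex"
  assumes X: "\<And>n. X n \<in> L2 M"
    and cauchy: "\<And>e. 0 < e \<Longrightarrow> \<exists>N. \<forall>m\<ge>N. \<forall>n\<ge>N. (\<integral>x. (cmod (X m x - X n x))\<^sup>2 \<partial>M) < e"
  shows "\<exists>l\<in>L2 M. \<forall>e>0. \<exists>N. \<forall>n\<ge>N. (\<integral>x. (cmod (X n x - l x))\<^sup>2 \<partial>M) < e"
proof -
  let ?sq = "\<lambda>m n. \<integral>x. (cmod (X m x - X n x))\<^sup>2 \<partial>M"
  have [measurable]: "X n \<in> borel_measurable M" for n by (rule L2_measurable[OF X])
  have diff: "integrable M (\<lambda>x. (cmod (X m x - X n x))\<^sup>2)" for m n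
    using L2_square[OF L2_diff[OF X X], of m n] by simp
  have "\<exists>N. \<forall>i\<ge>N. \<forall>j\<ge>N. LINT x|M. norm (X i x - X j x) < e" if e: "0 < e" for e
  proof -
    \<comment> \<open>From \<open>t \<le> c + t\<^sup>2 / c\<close> a square integral below \<open>c\<^sup>2\<close> bounds the integral of \<open>t\<close> by \<open>c (\<mu> + 1) = e\<close>.\<close>
    define c where "c = e / (measure M (space M) + 1)"
    have mpos: "0 < measure M (space M) + 1" using measure_nonneg[of M "space M"] by linarith
    have c: "0 < c" using e mpos by (simp add: c_def)
    have "(LINT x|M. norm (X i x - X j x)) < e" if "?sq i j < c\<^sup>2" for i j
    proof -
      have "norm (X i x - X j x) \<le> c + (cmod (X i x - X j x))\<^sup>2 / c" for x
      proof -
        let ?t = "cmod (X i x - X j x)"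
        have "0 \<le> c * ?t" using c by simp
        then have "?t * c \<le> c\<^sup>2 + ?t\<^sup>2"
          using sum_squares_bound[of c ?t] by (simp add: mult.commute)
        then have "?t \<le> (c\<^sup>2 + ?t\<^sup>2) / c" using c by (simp add: pos_le_divide_eq)
        then show ?thesis using c by (simp add: add_divide_distrib power2_eq_square)
      qed
      then have "(LINT x|M. norm (X i x - X j x)) \<le> (LINT x|M. c + (cmod (X i x - X j x))\<^sup>2 / c)"
        by (intro integral_mono integrable_norm Bochner_Integration.integrable_diff
            Bochner_Integration.integrable_add integrable_divide L2_integrable X diff) auto
      also have "\<dots> = c * measure M (space M) + ?sq i j / c"
        by (subst Bochner_Integration.integral_add) (use diff in \<open>simp_all add: mult.commute\<close>)
      also have "\<dots> < c * measure M (space M) + c"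
        using that c by (simp add: pos_divide_less_eq power2_eq_square)
      also have "\<dots> = c * (measure M (space M) + 1)" by (simp add: distrib_left)
      also have "\<dots> = e" using mpos by (simp add: c_def)
      finally show ?thesis .
    qed
    then show ?thesis using cauchy[of "c\<^sup>2"] c by (meson zero_less_power)
  qed
  with L2_integrable[OF X] obtain r where r: "strict_mono r" "AE x in M. Cauchy (\<lambda>i. X (r i) x)"
    by (rule cauchy_L1_AE_cauchy_subseq)
  define l where "l x = lim (\<lambda>i. X (r i) x)" for x
  have [measurable]: "l \<in> borel_measurable M" unfolding l_def by measurable
  have lim: "AE x in M. (\<lambda>i. X (r i) x) \<longlonglongrightarrow> l x"
    using r(2) by eventually_elim (simp add: l_def Cauchy_convergent_iff convergent_LIMSEQ_iff)
  have fatou: "(\<integral>\<^sup>+x. ennreal ((cmod (X n x - l x))\<^sup>2) \<partial>M) \<le> ennreal e"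
    if N: "\<And>m n. N \<le> m \<Longrightarrow> N \<le> n \<Longrightarrow> ?sq m n < e" and n: "N \<le> n" for N n e
  proof -
    have "AE x in M. ennreal ((cmod (X n x - l x))\<^sup>2)
        = liminf (\<lambda>i. ennreal ((cmod (X n x - X (r i) x))\<^sup>2))"
      using lim
    proof eventually_elim
      case (elim x)
      have "(\<lambda>i. ennreal ((cmod (X n x - X (r i) x))\<^sup>2)) \<longlonglongrightarrow> ennreal ((cmod (X n x - l x))\<^sup>2)"
        by (intro tendsto_intros tendsto_ennrealI elim)
      from lim_imp_Liminf[OF _ this] show ?case by simp
    qed
    then have "(\<integral>\<^sup>+x. ennreal ((cmod (X n x - l x))\<^sup>2) \<partial>M)
        = (\<integral>\<^sup>+x. liminf (\<lambda>i. ennreal ((cmod (X n x - X (r i) x))\<^sup>2)) \<partial>M)"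
      by (rule nn_integral_cong_AE)
    also have "\<dots> \<le> liminf (\<lambda>i. \<integral>\<^sup>+x. ennreal ((cmod (X n x - X (r i) x))\<^sup>2) \<partial>M)"
      by (rule nn_integral_liminf) measurable
    also have "\<dots> \<le> ennreal e"
    proof (rule Liminf_le)
      show "\<forall>\<^sub>F i in sequentially. (\<integral>\<^sup>+x. ennreal ((cmod (X n x - X (r i) x))\<^sup>2) \<partial>M) \<le> ennreal e"
        using eventually_ge_at_top[of N]
      proof eventually_elim
        case (elim i)
        then have "N \<le> r i" using seq_suble[OF r(1), of i] by linarith
        then have "?sq n (r i) \<le> e" using N n by (simp add: less_imp_le)
        then show ?case
          by (subst nn_integral_eq_integral[OF diff]) (simp_all add: ennreal_leI)
      qed
    qed simp
    finally show ?thesis .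
  qed
  have mem: "X n - l \<in> L2 M" and small: "(\<integral>x. (cmod (X n x - l x))\<^sup>2 \<partial>M) \<le> e"
    if N: "\<And>m n. N \<le> m \<Longrightarrow> N \<le> n \<Longrightarrow> ?sq m n < e" and n: "N \<le> n" and e: "0 < e" for N n e
  proof -
    have fin: "(\<integral>\<^sup>+x. ennreal ((cmod (X n x - l x))\<^sup>2) \<partial>M) \<le> ennreal e"
      by (rule fatou[OF N n])
    also have "ennreal e < \<infinity>" by simp
    finally have i: "integrable M (\<lambda>x. (cmod (X n x - l x))\<^sup>2)"
      by (intro integrableI_nonneg) auto
    then show "X n - l \<in> L2 M" by (simp add: L2_def fun_diff_def)
    show "(\<integral>x. (cmod (X n x - l x))\<^sup>2 \<partial>M) \<le> e"
      using fin nn_integral_eq_integral[OF i] e by simp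
  qed
  obtain N where N: "\<And>m n. N \<le> m \<Longrightarrow> N \<le> n \<Longrightarrow> ?sq m n < 1"
    using cauchy[of 1] by (auto)
  have "X N - l \<in> L2 M" by (rule mem[of N 1]) (use N in auto)
  then have "X N - (X N - l) \<in> L2 M" by (rule L2_diff[OF X])
  then have "l \<in> L2 M" by simp
  moreover have "\<exists>N. \<forall>n\<ge>N. (\<integral>x. (cmod (X n x - l x))\<^sup>2 \<partial>M) < e" if e: "0 < e" for e
  proof -
    obtain N where N: "\<And>m n. N \<le> m \<Longrightarrow> N \<le> n \<Longrightarrow> ?sq m n < e / 2"
      using cauchy[of "e / 2"] e by auto
    have "(\<integral>x. (cmod (X n x - l x))\<^sup>2 \<partial>M) < e" if "N \<le> n" for n
    proof -
      have "(\<integral>x. (cmod (X n x - l x))\<^sup>2 \<partial>M) \<le> e / 2"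
        by (rule small[of N "e / 2"]) (use N that e in auto)
      then show ?thesis using e by linarith
    qed
    then show ?thesis by blast
  qed
  ultimately show ?thesis by blast
qed

lemma (in finite_measure) hilbert_presentation_L2:
  assumes code: "\<And>f g. f \<in> L2 M \<Longrightarrow> g \<in> L2 M \<Longrightarrow> code f = code g \<longleftrightarrow> (AE x in M. f x = g x)"
  shows "hilbert_presentation (L2 M) (\<lambda>c f x. c * f x) (L2_inner M) code"
proof
  show zero: "0 \<in> L2 M" by (simp add: L2_def zero_fun_def)
  show "f + g \<in> L2 M" if "f \<in> L2 M" "g \<in> L2 M" for f g using that by (rule L2_add)
  show sc: "(\<lambda>x. c * f x) \<in> L2 M" if "f \<in> L2 M" for c f using that by (rule L2_scale)
  show "L2_inner M (f + g) h = L2_inner M f h + L2_inner M g h"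
    if "f \<in> L2 M" "g \<in> L2 M" "h \<in> L2 M" for f g h
    using that by (simp add: L2_inner_def distrib_right L2_inner_integrable)
  show "L2_inner M (\<lambda>x. c * f x) g = c * L2_inner M f g" for c f g
    by (simp add: L2_inner_def mult.assoc)
  show "L2_inner M g f = cnj (L2_inner M f g)" for f g
    by (simp add: L2_inner_def mult.commute flip: Bochner_Integration.integral_cnj)
  show "0 < Re (L2_inner M f f)" if f: "f \<in> L2 M" and "code f \<noteq> code 0" for f
  proof -
    have "\<not> (AE x in M. (cmod (f x))\<^sup>2 = 0)"
      using that code[OF f zero] by simp
    then have "(\<integral>x. (cmod (f x))\<^sup>2 \<partial>M) \<noteq> 0"
      using integral_nonneg_eq_0_iff_AE[OF L2_square[OF f]] by simp
    then show ?thesis by (simp add: L2_inner_self order_less_le)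
  qed
  show "code (f + g) = code (f' + g')"
    if f: "f \<in> L2 M" "f' \<in> L2 M" and g: "g \<in> L2 M" "g' \<in> L2 M" and "code f = code f'" "code g = code g'"
    for f f' g g'
  proof -
    have "AE x in M. f x = f' x" "AE x in M. g x = g' x" using that code by auto
    then have "AE x in M. (f + g) x = (f' + g') x" by eventually_elim simp
    then show ?thesis using f g by (simp add: code L2_add)
  qed
  show "code (\<lambda>x. c * f x) = code (\<lambda>x. c * f' x)"
    if f: "f \<in> L2 M" "f' \<in> L2 M" and "code f = code f'" for c f f'
  proof -
    have "AE x in M. f x = f' x" using that code by auto
    then have "AE x in M. c * f x = c * f' x" by eventually_elim simp
    then show ?thesis using f by (simp add: code sc)
  qed
  show "L2_inner M f g = L2_inner M f' g'"
    if f: "f \<in> L2 M" "f' \<in> L2 M" and g: "g \<in> L2 M" "g' \<in> L2 M" and "code f = code f'" "code g = code g'"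
    for f f' g g'
  proof -
    have "AE x in M. f x = f' x" "AE x in M. g x = g' x" using that code by auto
    then have "AE x in M. f x * cnj (g x) = f' x * cnj (g' x)" by eventually_elim simp
    then show ?thesis
      unfolding L2_inner_def using f g
      by (intro integral_cong_AE borel_measurable_integrable L2_inner_integrable)
  qed
  fix X :: "nat \<Rightarrow> 'a \<Rightarrow> complex"
  assume X: "\<And>n. X n \<in> L2 M"
    and cauchy: "\<And>e. 0 < e \<Longrightarrow>
      \<exists>N. \<forall>m\<ge>N. \<forall>n\<ge>N. sqrt (Re (L2_inner M (X m - X n) (X m - X n))) < e"
  have "\<exists>N. \<forall>m\<ge>N. \<forall>n\<ge>N. (\<integral>x. (cmod (X m x - X n x))\<^sup>2 \<partial>M) < e" if "0 < e" for e
    using cauchy[of "sqrt e"] that by (simp add: L2_inner_self)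
  from L2_complete[OF X this] obtain l where
    l: "l \<in> L2 M" "\<And>e. 0 < e \<Longrightarrow> \<exists>N. \<forall>n\<ge>N. (\<integral>x. (cmod (X n x - l x))\<^sup>2 \<partial>M) < e" by blast
  have "\<exists>N. \<forall>n\<ge>N. sqrt (Re (L2_inner M (X n - l) (X n - l))) < e" if "0 < e" for e
    using l(2)[of "e\<^sup>2"] that by (simp add: L2_inner_self real_sqrt_less_iff[of _ "e\<^sup>2", symmetric]
        del: real_sqrt_less_iff)
  then show "\<exists>l\<in>L2 M. \<forall>e>0. \<exists>N. \<forall>n\<ge>N. sqrt (Re (L2_inner M (X n - l) (X n - l))) < e"
    using l(1) by blast
qed (simp_all add: algebra_simps fun_eq_iff)

section \<open>Cardinality of the space of square-integrable functions\<close>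

lemma inj_nat_real_functions: "\<exists>\<phi> :: (nat \<Rightarrow> real) \<Rightarrow> real. inj \<phi>"
proof -
  obtain r :: "real \<Rightarrow> nat set" where r: "bij r"
    using eqpoll_sym[OF nat_sets_eqpoll_reals] by (auto simp: eqpoll_def)
  obtain s :: "nat set \<Rightarrow> real" where s: "bij s"
    using nat_sets_eqpoll_reals by (auto simp: eqpoll_def)
  define t where "t f = {prod_encode (k, j) | k j. j \<in> r (f k)}" for f :: "nat \<Rightarrow> real"
  have "inj t"
  proof (rule injI)
    fix f g assume "t f = t g"
    then have "prod_encode (k, j) \<in> t f \<longleftrightarrow> prod_encode (k, j) \<in> t g" for k j by simp
    then have "r (f k) = r (g k)" for k by (auto simp: t_def)
    then show "f = g" using r by (auto simp: fun_eq_iff bij_def inj_eq)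
  qed
  then have "inj (s \<circ> t)" using s by (intro inj_compose) (auto simp: bij_def)
  then show ?thesis by blast
qed

text \<open>
  By dominated convergence the integrals over all rays vanish. Then the measures with densities
  \<open>max 0 f\<close> and \<open>max 0 (- f)\<close> agree on rays, hence everywhere, and the two densities agree
  almost everywhere.
\<close>

lemma AE_zero_if_integrals_over_rational_rays_zero:
  fixes f :: "real \<Rightarrow> real"
  assumes "finite_measure M" and sets: "sets M = sets borel" and f: "integrable M f"
    and rat: "\<And>q. (\<integral>x. indicator {real_of_rat q<..} x * f x \<partial>M) = 0"
  shows "AE x in M. f x = 0"
proof -
  interpret finite_measure M by fact
  have [measurable]: "f \<in> borel_measurable M" using f by simp
  have [measurable_cong]: "sets M = sets borel" by (rule sets)
  have int: "integrable M (\<lambda>x. indicator {a<..} x * g x)" if "integrable M g" for a :: real and g :: "real \<Rightarrow> real"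
    using integrable_mult_indicator[OF _ that, of "{a<..}"] sets by simp
  have all: "(\<integral>x. indicator {a<..} x * f x \<partial>M) = 0" for a
  proof -
    have "\<exists>q. a < real_of_rat q \<and> real_of_rat q < a + 1 / real (Suc n)" for n
      using of_rat_dense[of a "a + 1 / real (Suc n)"] by simp
    then obtain q where q: "\<And>n. a < real_of_rat (q n) \<and> real_of_rat (q n) < a + 1 / real (Suc n)"
      by metis
    have "(\<lambda>n. \<integral>x. indicator {real_of_rat (q n)<..} x * f x \<partial>M)
        \<longlonglongrightarrow> (\<integral>x. indicator {a<..} x * f x \<partial>M)"
    proof (rule integral_dominated_convergence)
      show "integrable M (\<lambda>x. \<bar>f x\<bar>)" using f by simp
      have "(\<lambda>n. indicator {real_of_rat (q n)<..} x * f x) \<longlonglongrightarrow> indicator {a<..} x * f x" for x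
      proof (cases "a < x")
        case True
        then obtain N where N: "1 / real (Suc N) < x - a"
          using nat_approx_posE[of "x - a"] by auto
        have "real_of_rat (q n) < x" if "N \<le> n" for n
        proof -
          have "1 / real (Suc n) \<le> 1 / real (Suc N)" using that by (simp add: frac_le)
          then show ?thesis using q[of n] N by linarith
        qed
        then have "\<forall>\<^sub>F n in sequentially. indicator {real_of_rat (q n)<..} x * f x = indicator {a<..} x * f x"
          using True unfolding eventually_sequentially by (auto simp: indicator_def)
        then show ?thesis by (rule tendsto_eventually)
      next
        case False
        then have "indicator {real_of_rat (q n)<..} x * f x = indicator {a<..} x * f x" for n
          using q[of n] by (auto simp: indicator_def)
        then show ?thesis by (simp only: tendsto_const)
      qed
      then show "AE x in M. (\<lambda>n. indicator {real_of_rat (q n)<..} x * f x) \<longlonglongrightarrow> indicator {a<..} x * f x"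
        by simp
    qed (auto simp: indicator_def)
    then show ?thesis using rat LIMSEQ_unique by (simp add: LIMSEQ_const_iff)
  qed
  define p n where "p x = max 0 (f x)" and "n x = max 0 (- f x)" for x
  have pn: "integrable M p" "integrable M n"
    unfolding p_def n_def using f by auto
  have [measurable]: "p \<in> borel_measurable M" "n \<in> borel_measurable M" using pn by auto
  have em: "emeasure (density M (\<lambda>x. ennreal (g x))) {a<..} = ennreal (\<integral>x. indicator {a<..} x * g x \<partial>M)"
    if g: "integrable M g" "\<And>x. 0 \<le> g x" for g a
  proof -
    have [measurable]: "g \<in> borel_measurable M" using g by simp
    have "emeasure (density M (\<lambda>x. ennreal (g x))) {a<..}
        = (\<integral>\<^sup>+x. ennreal (g x) * indicator {a<..} x \<partial>M)"
      by (rule emeasure_density) (use sets in auto)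
    also have "\<dots> = (\<integral>\<^sup>+x. ennreal (indicator {a<..} x * g x) \<partial>M)"
      by (intro nn_integral_cong) (auto simp: indicator_def)
    also have "\<dots> = ennreal (\<integral>x. indicator {a<..} x * g x \<partial>M)"
      by (rule nn_integral_eq_integral[OF int[OF g(1)]]) (use g in auto)
    finally show ?thesis .
  qed
  have "density M (\<lambda>x. ennreal (p x)) = density M (\<lambda>x. ennreal (n x))"
  proof (rule measure_eqI_lessThan)
    fix a :: real
    show "emeasure (density M (\<lambda>x. ennreal (p x))) {a<..} < \<infinity>"
      by (subst em) (auto simp: pn, simp add: p_def)
    have "(\<integral>x. indicator {a<..} x * p x \<partial>M) - (\<integral>x. indicator {a<..} x * n x \<partial>M)
        = (\<integral>x. indicator {a<..} x * p x - indicator {a<..} x * n x \<partial>M)"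
      by (rule Bochner_Integration.integral_diff[symmetric]) (intro int pn)+
    also have "\<dots> = (\<integral>x. indicator {a<..} x * f x \<partial>M)"
      by (rule Bochner_Integration.integral_cong) (auto simp: p_def n_def indicator_def)
    finally have "(\<integral>x. indicator {a<..} x * p x \<partial>M) = (\<integral>x. indicator {a<..} x * n x \<partial>M)"
      using all by simp
    then show "emeasure (density M (\<lambda>x. ennreal (p x))) {a<..}
        = emeasure (density M (\<lambda>x. ennreal (n x))) {a<..}"
      using em[of p a] em[of n a] pn by (simp add: p_def n_def)
  qed (simp_all add: sets)
  then have "AE x in M. ennreal (p x) = ennreal (n x)"
    by (intro density_unique) auto
  then show ?thesis
    by eventually_elim (auto simp: p_def n_def max_def split: if_splits)
qed

text \<open>
  Countably many real numbers determine an integrable function up to null sets. Hence the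
  almost-everywhere classes can be represented in a type that has only the cardinality of the
  continuum.
\<close>

lemma sequence_code_integrable:
  assumes M: "finite_measure M" "sets M = sets (borel :: real measure)"
  obtains c :: "(real \<Rightarrow> complex) \<Rightarrow> nat \<Rightarrow> real"
  where "\<And>f g. integrable M f \<Longrightarrow> integrable M g \<Longrightarrow> c f = c g \<longleftrightarrow> (AE x in M. f x = g x)"
proof -
  define F where "F f q = (\<integral>x. indicator {real_of_rat q<..} x *\<^sub>R f x \<partial>M)" for f :: "real \<Rightarrow> complex" and q
  define c where "c f k = (if even k then Re else Im) (F f (from_nat (k div 2)))" for f k
  have c_eq: "c f = c g \<longleftrightarrow> (\<forall>q. F f q = F g q)" for f g
  proof
    assume eq: "c f = c g"
    show "\<forall>q. F f q = F g q"
    proof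
      fix q :: rat
      have "c f (2 * to_nat q) = c g (2 * to_nat q)" "c f (Suc (2 * to_nat q)) = c g (Suc (2 * to_nat q))"
        using eq by simp_all
      then show "F f q = F g q" by (simp add: c_def complex_eq_iff)
    qed
  qed (simp add: c_def fun_eq_iff)
  have "c f = c g \<longleftrightarrow> (AE x in M. f x = g x)" if f: "integrable M f" and g: "integrable M g" for f g
  proof
    assume "AE x in M. f x = g x"
    then have "F f q = F g q" for q
      unfolding F_def using f g M(2)
      by (intro integral_cong_AE) (auto intro!: borel_measurable_scaleR borel_measurable_indicator)
    then show "c f = c g" by (simp add: c_eq)
  next
    assume eq: "c f = c g"
    have int: "integrable M (\<lambda>x. indicator {real_of_rat q<..} x *\<^sub>R h x)" if "integrable M h" for q and h :: "real \<Rightarrow> complex"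
      using integrable_mult_indicator[OF _ that, of "{real_of_rat q<..}"] M(2) by simp
    have z: "(\<integral>x. indicator {real_of_rat q<..} x *\<^sub>R (f x - g x) \<partial>M) = 0" for q
      using eq int[OF f] int[OF g] unfolding c_eq F_def by (simp add: scaleR_diff_right)
    have i: "integrable M (\<lambda>x. indicator {real_of_rat q<..} x *\<^sub>R (f x - g x))" for q
      using f g by (intro int) simp
    have "AE x in M. Re (f x - g x) = 0"
    proof (rule AE_zero_if_integrals_over_rational_rays_zero[OF M])
      show "(\<integral>x. indicator {real_of_rat q<..} x * Re (f x - g x) \<partial>M) = 0" for q
        using integral_Re[OF i[of q]] z[of q] by simp
    qed (use f g in auto)
    moreover have "AE x in M. Im (f x - g x) = 0"
    proof (rule AE_zero_if_integrals_over_rational_rays_zero[OF M])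
      show "(\<integral>x. indicator {real_of_rat q<..} x * Im (f x - g x) \<partial>M) = 0" for q
        using integral_Im[OF i[of q]] z[of q] by simp
    qed (use f g in auto)
    ultimately show "AE x in M. f x = g x"
      by eventually_elim (simp add: complex_eq_iff)
  qed
  then show ?thesis by (rule that)
qed

section \<open>Additive groups of finite-dimensional spaces\<close>

lemma topological_group_additive_group:
  fixes S :: "'a::real_normed_vector set"
  assumes S: "0 \<in> S" "\<And>x y. x \<in> S \<Longrightarrow> y \<in> S \<Longrightarrow> x + y \<in> S" "\<And>x. x \<in> S \<Longrightarrow> - x \<in> S"
  shows "topological_group (additive_group S) (top_of_set S)"
proof -
  have G: "group (additive_group S)"
  proof (rule groupI)
    fix x assume "x \<in> carrier (additive_group S)"
    then show "\<exists>y\<in>carrier (additive_group S). y \<otimes>\<^bsub>additive_group S\<^esub> x = \<one>\<^bsub>additive_group S\<^esub>"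
      using S by (intro bexI[of _ "- x"]) auto
  qed (use S in \<open>auto simp: add.assoc\<close>)
  have "continuous_map (top_of_set S) (top_of_set S) uminus"
    using S by (auto simp: continuous_map_subtopology_eu intro!: continuous_intros)
  then have "continuous_map (top_of_set S) (top_of_set S) (\<lambda>x. inv\<^bsub>additive_group S\<^esub> x)"
    by (rule continuous_map_eq) (simp add: inv_additive_group[OF G] S)
  moreover have "continuous_map (top_of_set (S \<times> S)) (top_of_set S) (\<lambda>(x, y). x + y)"
    using S unfolding continuous_map_subtopology_eu case_prod_unfold
    by (auto intro!: continuous_intros)
  ultimately show ?thesis
    using G by (simp add: topological_group_def)
qed

text \<open>
  For \<open>\<bar>y\<bar> \<ge> 2\<close> use \<open>\<bar>sin y\<bar> \<le> 1\<close>; on the remaining compact interval \<open>sin y / y\<close> attains a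
  maximum, which is below 1.
\<close>

lemma abs_sin_uniformly_less:
  fixes e :: real
  assumes "0 < e"
  obtains \<kappa> where "0 < \<kappa>" "\<And>y. e \<le> \<bar>y\<bar> \<Longrightarrow> \<bar>sin y\<bar> \<le> (1 - \<kappa>) * \<bar>y\<bar>"
proof -
  define c where "c = min e 1"
  have c: "0 < c" "c \<le> 2" "c \<le> e" using assms by (auto simp: c_def)
  have cont: "continuous_on {c..2} (\<lambda>y. \<bar>sin y\<bar> / y)"
    using c by (intro continuous_intros) auto
  have "{c..2} \<noteq> {}" using c by simp
  from continuous_attains_sup[OF compact_Icc this cont] obtain z where
    z: "z \<in> {c..2}" "\<And>y. y \<in> {c..2} \<Longrightarrow> \<bar>sin y\<bar> / y \<le> \<bar>sin z\<bar> / z"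
    by blast
  have "\<bar>sin z\<bar> < z"
  proof -
    have zpi: "0 < z" "z < pi" using z c pi_gt3 by auto
    have "sin z = 2 * sin (z / 2) * cos (z / 2)"
      using sin_double[of "z / 2"] by simp
    also have "\<dots> < 2 * sin (z / 2)"
      using cos_monotone_0_pi[of 0 "z / 2"] sin_gt_zero[of "z / 2"] zpi by simp
    also have "\<dots> \<le> z" using sin_x_le_x[of "z / 2"] zpi by simp
    finally show ?thesis using sin_gt_zero[of z] zpi by simp
  qed
  then have r: "\<bar>sin z\<bar> / z < 1" using z c by simp
  define \<kappa> where "\<kappa> = min (1/2) (1 - \<bar>sin z\<bar> / z)"
  have k: "0 < \<kappa>" "\<kappa> \<le> 1/2" "\<bar>sin z\<bar> / z \<le> 1 - \<kappa>" 
  proof -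
    show "0 < \<kappa>" using r by (simp add: \<kappa>_def)
    show "\<kappa> \<le> 1/2" unfolding \<kappa>_def by (rule min.cobounded1)
    have "\<kappa> \<le> 1 - \<bar>sin z\<bar> / z" unfolding \<kappa>_def by (rule min.cobounded2)
    then show "\<bar>sin z\<bar> / z \<le> 1 - \<kappa>" by linarith
  qed
  show ?thesis
  proof (rule that[OF k(1)])
    fix y :: real assume y: "e \<le> \<bar>y\<bar>"
    show "\<bar>sin y\<bar> \<le> (1 - \<kappa>) * \<bar>y\<bar>"
    proof (cases "\<bar>y\<bar> \<le> 2")
      case True
      then have "\<bar>sin \<bar>y\<bar>\<bar> / \<bar>y\<bar> \<le> 1 - \<kappa>"
        using z(2)[of "\<bar>y\<bar>"] k(3) y c by auto
      moreover have "\<bar>sin \<bar>y\<bar>\<bar> = \<bar>sin y\<bar>" by (cases "0 \<le> y") auto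
      ultimately show ?thesis using y assms by (simp add: pos_divide_le_eq)
    next
      case False
      have "\<bar>sin y\<bar> \<le> 1" by simp
      also have "\<dots> \<le> (1/2) * \<bar>y\<bar>" using False by simp
      also have "\<dots> \<le> (1 - \<kappa>) * \<bar>y\<bar>" using k by (intro mult_right_mono) auto
      finally show ?thesis .
    qed
  qed
qed

text \<open>
  The integrand is \<open>\<bar>exp (\<i> c s) - 1\<bar>\<^sup>2\<close>. It has mean value
  \<open>2 - 2 (sin (c b) - sin (c a)) / (c (b - a))\<close>, and the quotient is \<open>sin y / y\<close> with
  \<open>y = c (b - a) / 2\<close>, up to a cosine factor.
\<close>

lemma cos_deficit_integral_ge:
  fixes a b c \<kappa> :: real
  assumes ab: "a < b" and c: "c \<noteq> 0"
    and k: "\<bar>sin (c * (b - a) / 2)\<bar> \<le> (1 - \<kappa>) * \<bar>c * (b - a) / 2\<bar>"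
  shows "integrable lborel (\<lambda>s. indicator {a..<b} s * (2 - 2 * cos (c * s)))"
    "2 * \<kappa> * (b - a) \<le> (\<integral>s. indicator {a..<b} s * (2 - 2 * cos (c * s)) \<partial>lborel)"
proof -
  define F where "F s = 2 * s - 2 * sin (c * s) / c" for s
  have "has_bochner_integral lborel (\<lambda>s. (2 - 2 * cos (c * s)) * indicator {a..b} s) (F b - F a)"
    using ab c unfolding F_def
    by (intro has_bochner_integral_FTC_Icc_real) (auto intro!: derivative_eq_intros continuous_intros)
  moreover have "AE s in lborel. (2 - 2 * cos (c * s)) * indicator {a..b} s
      = indicator {a..<b} s * (2 - 2 * cos (c * s))"
    using AE_lborel_singleton[of b] by eventually_elim (auto simp: indicator_def)
  ultimately have I: "has_bochner_integral lborel (\<lambda>s. indicator {a..<b} s * (2 - 2 * cos (c * s))) (F b - F a)"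
    by (subst has_bochner_integral_cong_AE[symmetric]) (auto intro: borel_measurable_continuous_onI continuous_intros)
  then show "integrable lborel (\<lambda>s. indicator {a..<b} s * (2 - 2 * cos (c * s)))"
    by (rule integrable.intros)
  have "sin (c * b) - sin (c * a) = 2 * sin (c * (b - a) / 2) * cos ((c * b + c * a) / 2)"
    using sin_diff_sin[of "c * b" "c * a"] by (simp add: right_diff_distrib)
  then have "\<bar>sin (c * b) - sin (c * a)\<bar> \<le> 2 * \<bar>sin (c * (b - a) / 2)\<bar>"
    by (simp add: abs_mult mult_left_le)
  also have "\<dots> \<le> (1 - \<kappa>) * \<bar>c\<bar> * (b - a)"
    using k ab by (simp add: abs_mult)
  finally have "\<bar>sin (c * b) - sin (c * a)\<bar> / \<bar>c\<bar> \<le> (1 - \<kappa>) * (b - a)"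
    using c by (simp add: pos_divide_le_eq mult.commute mult.left_commute)
  moreover have "(sin (c * b) - sin (c * a)) / c \<le> \<bar>sin (c * b) - sin (c * a)\<bar> / \<bar>c\<bar>"
    by (metis abs_divide abs_ge_self)
  ultimately have "(sin (c * b) - sin (c * a)) / c \<le> (1 - \<kappa>) * (b - a)" by linarith
  moreover have "F b - F a = 2 * (b - a) - 2 * ((sin (c * b) - sin (c * a)) / c)"
    by (simp add: F_def diff_divide_distrib right_diff_distrib)
  moreover have "(1 - \<kappa>) * (b - a) = (b - a) - \<kappa> * (b - a)" by (simp add: left_diff_distrib)
  moreover have "2 * K \<le> f" if "X \<le> Z" "f = 2 * D - 2 * X" "Z = D - K" for X Z f D K :: real
    using that by linarith
  ultimately have "2 * (\<kappa> * (b - a)) \<le> F b - F a" by blast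
  then show "2 * \<kappa> * (b - a) \<le> (\<integral>s. indicator {a..<b} s * (2 - 2 * cos (c * s)) \<partial>lborel)"
    using has_bochner_integral_integral_eq[OF I] by simp
qed

lemma cmod_cis_minus_one_square: "(cmod (cis t - 1))\<^sup>2 = 2 - 2 * cos t"
proof -
  have "(cmod (cis t - 1))\<^sup>2 = (cos t - 1)\<^sup>2 + (sin t)\<^sup>2"
    by (simp add: cmod_power2)
  then show ?thesis using sin_cos_squared_add[of t] by (simp add: power2_eq_square algebra_simps)
qed

lemma cmod_cis_diff: "cmod (cis a - cis b) = cmod (cis (a - b) - 1)"
proof -
  have "cis a - cis b = cis b * (cis (a - b) - 1)"
    by (simp add: right_diff_distrib cis_mult)
  then show ?thesis by (simp add: norm_mult)
qed

lemma cmod_cis_minus_one_le: "cmod (cis t - 1) \<le> \<bar>t\<bar>"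
proof (rule power2_le_imp_le)
  have "2 - 2 * cos t = 4 * (sin (t / 2))\<^sup>2"
    using cos_double_sin[of "t / 2"] by simp
  also have "\<dots> \<le> 4 * \<bar>t / 2\<bar>\<^sup>2"
    using power_mono[OF abs_sin_x_le_abs_x abs_ge_zero, of "t / 2" 2] by simp
  finally show "(cmod (cis t - 1))\<^sup>2 \<le> \<bar>t\<bar>\<^sup>2"
    by (simp add: cmod_cis_minus_one_square power_divide)
qed simp

definition unit_interval_measure :: "real measure" where
  "unit_interval_measure = density lborel (\<lambda>s. ennreal (indicator {0..1} s))"

lemma finite_unit_interval_measure: "finite_measure unit_interval_measure"
proof (rule finite_measureI)
  have "(\<lambda>s::real. ennreal (indicator {0..1} s)) = indicator {0..1}"
    by (auto simp: indicator_def)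
  then have "emeasure unit_interval_measure UNIV = emeasure lborel {0..1::real}"
    unfolding unit_interval_measure_def by (subst emeasure_density) simp_all
  then show "emeasure unit_interval_measure (space unit_interval_measure) \<noteq> \<infinity>"
    by (simp add: unit_interval_measure_def)
qed

lemma sets_unit_interval_measure [measurable_cong]: "sets unit_interval_measure = sets borel"
  by (simp add: unit_interval_measure_def)

text \<open>
  The unit interval is divided into \<open>n\<close> cells, one for each coordinate. On the cell \<open>k\<close> the
  function \<open>exp (\<i> phase n l v s)\<close> is an exponential whose frequency is proportional to \<open>l k v\<close>,
  so that a single space \<open>L\<^sup>2[0,1]\<close> carries all coordinates.
\<close>

definition phase :: "nat \<Rightarrow> (nat \<Rightarrow> 'a \<Rightarrow> real) \<Rightarrow> 'a \<Rightarrow> real \<Rightarrow> real" where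
  "phase n l v s =
    (\<Sum>k<n. indicator {real k / real n ..< (real k + 1) / real n} s * (l k v * (real n * s)))"

lemma phase_measurable [measurable]: "phase n l v \<in> borel_measurable borel"
  unfolding phase_def by measurable

lemma cell_subset: "k < n \<Longrightarrow> {real k / real n ..< (real k + 1) / real n} \<subseteq> {0..1}"
proof
  fix s assume k: "k < n" and s: "s \<in> {real k / real n ..< (real k + 1) / real n}"
  have "0 \<le> real k / real n" by simp
  moreover have "(real k + 1) / real n \<le> 1" using k by simp
  moreover have "real k / real n \<le> s" "s < (real k + 1) / real n" using s by simp_all
  ultimately have "0 \<le> s" "s \<le> 1" by linarith+
  then show "s \<in> {0..1}" by simp
qed

lemma abs_phase_le: "\<bar>phase n l v s\<bar> \<le> real n * (\<Sum>k<n. \<bar>l k v\<bar>)"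
proof -
  have "\<bar>phase n l v s\<bar> \<le> (\<Sum>k<n. \<bar>indicator {real k / real n ..< (real k + 1) / real n} s * (l k v * (real n * s))\<bar>)"
    unfolding phase_def by (rule sum_abs)
  also have "\<dots> \<le> (\<Sum>k<n. real n * \<bar>l k v\<bar>)"
  proof (rule sum_mono)
    fix k assume k: "k \<in> {..<n}"
    show "\<bar>indicator {real k / real n ..< (real k + 1) / real n} s * (l k v * (real n * s))\<bar> \<le> real n * \<bar>l k v\<bar>"
    proof (cases "s \<in> {real k / real n ..< (real k + 1) / real n}")
      case True
      then have "\<bar>s\<bar> \<le> 1" using cell_subset[of k n] k by fastforce
      then have "\<bar>l k v\<bar> * real n * \<bar>s\<bar> \<le> \<bar>l k v\<bar> * real n" by (intro mult_left_le) auto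
      then show ?thesis using True by (simp add: abs_mult ac_simps)
    qed simp
  qed
  finally show ?thesis by (simp add: sum_distrib_left)
qed

lemma phase_on_cell:
  assumes k: "k < n" and s: "s \<in> {real k / real n ..< (real k + 1) / real n}"
  shows "phase n l v s = l k v * real n * s"
proof -
  have "indicator {real j / real n ..< (real j + 1) / real n} s * (l j v * (real n * s))
      = (if j = k then l k v * (real n * s) else 0)" for j
  proof (cases "j = k")
    case False
    have n: "0 < real n" using k by simp
    have "\<not> (real j \<le> real n * s \<and> real n * s < real j + 1)"
      using s n False by (auto simp: field_simps)
    then have "s \<notin> {real j / real n ..< (real j + 1) / real n}"
      using n by (auto simp: field_simps)
    then show ?thesis using False by simp
  qed (use s in simp)
  then show ?thesis using k by (simp add: phase_def)
qed

text \<open>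
  The vector \<open>v\<close> acts by multiplication with \<open>exp (\<i> phase n l v s)\<close>. The action is Lipschitz in
  \<open>v\<close>, and if \<open>g\<close> and \<open>h\<close> move the constant function 1 to nearby functions, then all coordinates
  of \<open>g - h\<close> are small: on the cell \<open>k\<close> the functions would otherwise differ by a fixed amount
  in mean square.
\<close>

theorem additive_group_representable:
  fixes S :: "'a::banach set" and l :: "nat \<Rightarrow> 'a \<Rightarrow> real" and \<iota> :: "real \<Rightarrow> 'h"
  assumes \<iota>: "inj \<iota>"
    and S: "closed S" "0 \<in> S" "\<And>x y. x \<in> S \<Longrightarrow> y \<in> S \<Longrightarrow> x + y \<in> S" "\<And>x. x \<in> S \<Longrightarrow> - x \<in> S"
    and l: "\<And>k. k < n \<Longrightarrow> bounded_linear (l k)" and norm_le: "\<And>x. norm x \<le> (\<Sum>k<n. \<bar>l k x\<bar>)"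
  shows "strongly_unitarily_representable TYPE('h) (additive_group S) (top_of_set S)"
proof -
  let ?M = unit_interval_measure and ?ph = "phase n l"
  interpret finite_measure ?M by (rule finite_unit_interval_measure)
  obtain \<phi> :: "(nat \<Rightarrow> real) \<Rightarrow> real" where \<phi>: "inj \<phi>"
    using inj_nat_real_functions by blast
  obtain c :: "(real \<Rightarrow> complex) \<Rightarrow> nat \<Rightarrow> real" where
    c: "\<And>f g. integrable ?M f \<Longrightarrow> integrable ?M g \<Longrightarrow> c f = c g \<longleftrightarrow> (AE x in ?M. f x = g x)"
    by (rule sequence_code_integrable[OF finite_unit_interval_measure sets_unit_interval_measure])
      (rule that)
  interpret hilbert_presentation "L2 ?M" "\<lambda>c f x. c * f x" "L2_inner ?M" "\<lambda>f. \<iota> (\<phi> (c f))"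
  proof (rule hilbert_presentation_L2)
    show "\<iota> (\<phi> (c f)) = \<iota> (\<phi> (c g)) \<longleftrightarrow> (AE x in ?M. f x = g x)" if "f \<in> L2 ?M" "g \<in> L2 ?M" for f g
      using c[OF L2_integrable L2_integrable] that \<iota> \<phi> by (simp add: inj_eq)
  qed
  define \<pi> where "\<pi> v f s = cis (?ph v s) * f s" for v and f :: "real \<Rightarrow> complex" and s
  have cis_measurable [measurable]: "cis \<in> borel_measurable borel"
    by (intro borel_measurable_continuous_onI continuous_intros)
  have mem: "\<pi> v f \<in> L2 ?M" if "f \<in> L2 ?M" for v f
    unfolding \<pi>_def by (rule L2_bounded_mult[OF that, of _ 1]) simp_all
  have ph_add: "?ph (u + v) s = ?ph u s + ?ph v s" for u v s
    unfolding phase_def sum.distrib[symmetric]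
    using l by (intro sum.cong) (auto simp: linear_add bounded_linear.linear algebra_simps)
  have ph_0: "?ph 0 s = 0" for s using ph_add[of 0 0 s] by simp
  have ph_diff: "?ph u s - ?ph v s = ?ph (u - v) s" for u v s
    using ph_add[of "u - v" v s] by simp
  have nrm: "(nrm f)\<^sup>2 = (\<integral>s. (cmod (f s))\<^sup>2 \<partial>?M)" "0 \<le> nrm f" for f
    by (simp_all add: nrm_def L2_inner_self)
  have diff_eq: "(cmod ((\<pi> u f - \<pi> v f) s))\<^sup>2 = (cmod (cis (?ph (u - v) s) - 1))\<^sup>2 * (cmod (f s))\<^sup>2"
    for u v f s
  proof -
    have "(\<pi> u f - \<pi> v f) s = (cis (?ph u s) - cis (?ph v s)) * f s"
      by (simp add: \<pi>_def left_diff_distrib)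
    then show ?thesis by (simp add: norm_mult cmod_cis_diff ph_diff power_mult_distrib)
  qed
  obtain B where B: "0 < B" "\<And>v. (\<Sum>k<n. \<bar>l k v\<bar>) \<le> B * norm v"
  proof -
    have "\<exists>K. \<forall>v. \<bar>l k v\<bar> \<le> norm v * K" if "k < n" for k
      using bounded_linear.bounded[OF l[OF that]] by simp
    then obtain K where K: "\<And>k v. k < n \<Longrightarrow> \<bar>l k v\<bar> \<le> norm v * K k" by metis
    have "(\<Sum>k<n. \<bar>l k v\<bar>) \<le> (1 + \<bar>\<Sum>k<n. K k\<bar>) * norm v" for v
    proof -
      have "(\<Sum>k<n. \<bar>l k v\<bar>) \<le> (\<Sum>k<n. norm v * K k)" using K by (intro sum_mono) auto
      also have "\<dots> = (\<Sum>k<n. K k) * norm v" by (simp add: sum_distrib_left mult.commute)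
      also have "\<dots> \<le> (1 + \<bar>\<Sum>k<n. K k\<bar>) * norm v" by (intro mult_right_mono) auto
      finally show ?thesis .
    qed
    then show ?thesis by (intro that[of "1 + \<bar>\<Sum>k<n. K k\<bar>"]) auto
  qed
  have lipschitz: "nrm (\<pi> u f - \<pi> v f) \<le> real n * B * norm (u - v) * nrm f" if f: "f \<in> L2 ?M" for u v f
  proof (rule power2_le_imp_le)
    let ?C = "real n * B * norm (u - v)"
    have "cmod (cis (?ph (u - v) s) - 1) \<le> ?C" for s
    proof -
      have "cmod (cis (?ph (u - v) s) - 1) \<le> real n * (\<Sum>k<n. \<bar>l k (u - v)\<bar>)"
        using cmod_cis_minus_one_le abs_phase_le by (rule order_trans)
      also have "\<dots> \<le> real n * (B * norm (u - v))" by (intro mult_left_mono B) simp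
      finally show ?thesis by (simp add: mult.assoc)
    qed
    then have le: "(cmod ((\<pi> u f - \<pi> v f) s))\<^sup>2 \<le> ?C\<^sup>2 * (cmod (f s))\<^sup>2" for s
      unfolding diff_eq by (intro mult_right_mono power_mono) auto
    have "(nrm (\<pi> u f - \<pi> v f))\<^sup>2 \<le> (\<integral>s. ?C\<^sup>2 * (cmod (f s))\<^sup>2 \<partial>?M)"
      unfolding nrm
      by (intro integral_mono le L2_square L2_diff mem f integrable_mult_right)
    then show "(nrm (\<pi> u f - \<pi> v f))\<^sup>2 \<le> (?C * nrm f)\<^sup>2"
      by (simp add: power_mult_distrib nrm)
    show "0 \<le> ?C * nrm f" using B(1) nrm(2)[of f] by simp
  qed
  have one: "(\<lambda>_. 1) \<in> L2 ?M" by (simp add: L2_def)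
  have orbit: "\<exists>d>0. \<forall>g\<in>S. \<forall>h\<in>S. nrm (\<pi> g (\<lambda>_. 1) - \<pi> h (\<lambda>_. 1)) < d \<longrightarrow> dist g h < e"
    if e: "0 < e" for e
  proof -
    \<comment> \<open>The sum of \<open>n\<close> coordinates below \<open>e'\<close> is below \<open>e\<close>; \<open>n + 1\<close> also covers \<open>n = 0\<close>, here and in \<open>d\<close>.\<close>
    define e' where "e' = e / (real n + 1)"
    have e': "0 < e'" using e by (simp add: e'_def)
    obtain \<kappa> where \<kappa>: "0 < \<kappa>" "\<And>y. e' / 2 \<le> \<bar>y\<bar> \<Longrightarrow> \<bar>sin y\<bar> \<le> (1 - \<kappa>) * \<bar>y\<bar>"
      using abs_sin_uniformly_less[of "e' / 2"] e' by auto
    define d where "d = sqrt (2 * \<kappa> / (real n + 1))"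
    have d: "0 < d" using \<kappa> by (simp add: d_def)
    have "dist g h < e" if small: "nrm (\<pi> g (\<lambda>_. 1) - \<pi> h (\<lambda>_. 1)) < d" for g h
    proof -
      let ?w = "g - h"
      have lk: "\<bar>l k ?w\<bar> < e'" if k: "k < n" for k
      proof (rule ccontr)
        assume "\<not> \<bar>l k ?w\<bar> < e'"
        then have big: "e' \<le> \<bar>l k ?w\<bar>" by simp
        let ?a = "real k / real n" and ?b = "(real k + 1) / real n"
        let ?f = "\<lambda>s. (cmod ((\<pi> g (\<lambda>_. 1) - \<pi> h (\<lambda>_. 1)) s))\<^sup>2"
        have n: "0 < real n" using k by simp
        have ba: "?b - ?a = 1 / real n" by (simp add: diff_divide_distrib[symmetric])
        then have ab: "?a < ?b" using n by (smt (verit) divide_pos_pos)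
        have nz: "l k ?w * real n \<noteq> 0" using big e' n by auto
        have half: "l k ?w * real n * (?b - ?a) / 2 = l k ?w / 2" unfolding ba using n by simp
        have lower: "\<bar>sin (l k ?w * real n * (?b - ?a) / 2)\<bar>
            \<le> (1 - \<kappa>) * \<bar>l k ?w * real n * (?b - ?a) / 2\<bar>"
          unfolding half using big by (intro \<kappa>(2)) simp
        note I = cos_deficit_integral_ge[OF ab nz lower]
        have int: "integrable ?M ?f" by (intro L2_square L2_diff mem one)
        have f_meas: "?f \<in> borel_measurable lborel"
          using borel_measurable_integrable[OF int] by (simp add: unit_interval_measure_def)
        have ge: "indicator {?a..<?b} s * (2 - 2 * cos (l k ?w * real n * s)) \<le> indicator {0..1} s *\<^sub>R ?f s" for s
        proof (cases "s \<in> {?a..<?b}")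
          case True
          then have "s \<in> {0..1}" using cell_subset[OF k] by blast
          with True show ?thesis
            unfolding diff_eq by (simp add: phase_on_cell[OF k True] cmod_cis_minus_one_square)
        qed simp
        have "2 * \<kappa> * (?b - ?a) \<le> (\<integral>s. indicator {?a..<?b} s * (2 - 2 * cos (l k ?w * real n * s)) \<partial>lborel)"
          by (rule I(2))
        also have "\<dots> \<le> (\<integral>s. indicator {0..1} s *\<^sub>R ?f s \<partial>lborel)"
        proof (rule integral_mono[OF I(1) _ ge])
          show "integrable lborel (\<lambda>s. indicator {0..1} s *\<^sub>R ?f s)"
            using int f_meas unfolding unit_interval_measure_def
            by (subst (asm) integrable_density) auto
        qed
        also have "\<dots> = (\<integral>s. ?f s \<partial>?M)"
          unfolding unit_interval_measure_def using f_meas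
          by (subst integral_density) auto
        also have "\<dots> = (nrm (\<pi> g (\<lambda>_. 1) - \<pi> h (\<lambda>_. 1)))\<^sup>2" by (simp add: nrm)
        also have "\<dots> < d\<^sup>2" using small nrm(2) by (intro power_strict_mono) auto
        also have "\<dots> = 2 * \<kappa> / (real n + 1)" using \<kappa>(1) by (simp add: d_def)
        also have "\<dots> \<le> 2 * \<kappa> / real n" using \<kappa>(1) n by (intro divide_left_mono) auto
        finally show False unfolding ba by simp
      qed
      have "norm ?w \<le> (\<Sum>k<n. \<bar>l k ?w\<bar>)" by (rule norm_le)
      also have "\<dots> \<le> (\<Sum>k<n. e')" using lk by (intro sum_mono) (auto intro: less_imp_le)
      also have "\<dots> = real n * e'" by simp
      also have "\<dots> < (real n + 1) * e'" using e' by simp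
      also have "\<dots> = e" by (simp add: e'_def add_nonneg_eq_0_iff)
      finally show ?thesis by (simp add: dist_norm)
    qed
    then show ?thesis using d by blast
  qed
  show ?thesis
  proof (rule representable_if_uniform_orbit[where \<pi> = \<pi> and v = "\<lambda>_. 1"])
    show "topological_group (additive_group S) (top_of_set S)"
      using S by (intro topological_group_additive_group)
    show "complete S" using S(1) by (simp add: complete_eq_closed)
    show "\<pi> g (f + h) = \<pi> g f + \<pi> g h" for g f h
      by (simp add: \<pi>_def fun_eq_iff distrib_left)
    show "\<pi> g (\<lambda>x. c * f x) = (\<lambda>x. c * \<pi> g f x)" for g c f
      by (simp add: \<pi>_def fun_eq_iff)
    show "L2_inner ?M (\<pi> g f) (\<pi> g h) = L2_inner ?M f h" for g f h
    proof -
      have "cis t * a * cnj (cis t * b) = a * cnj b" for t a b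
        using cis_mult[of t "- t"] by (simp add: cis_cnj mult.assoc mult.left_commute)
      then show ?thesis by (simp only: L2_inner_def \<pi>_def)
    qed
    show "\<pi> (g \<otimes>\<^bsub>additive_group S\<^esub> h) f = \<pi> g (\<pi> h f)" for g h f
      by (simp add: \<pi>_def fun_eq_iff ph_add flip: cis_mult)
    show "\<pi> \<one>\<^bsub>additive_group S\<^esub> f = f" for f by (simp add: \<pi>_def fun_eq_iff ph_0)
    show "\<exists>d>0. \<forall>h\<in>S. dist h g < d \<longrightarrow> nrm (\<pi> h f - \<pi> g f) < e"
      if f: "f \<in> L2 ?M" and e: "0 < e" for g f e
    proof -
      define C where "C = real n * B * nrm f + 1"
      have C: "0 < C" using B(1) nrm(2)[of f] by (auto simp: C_def intro!: add_nonneg_pos)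
      have "nrm (\<pi> h f - \<pi> g f) < e" if "dist h g < e / C" for h
      proof -
        have "nrm (\<pi> h f - \<pi> g f) \<le> (real n * B * nrm f) * norm (h - g)"
          using lipschitz[OF f, of h g] by (simp add: ac_simps)
        also have "\<dots> \<le> C * norm (h - g)" by (intro mult_right_mono) (simp_all add: C_def)
        also have "\<dots> < e" using that C by (simp add: dist_norm pos_less_divide_eq mult.commute)
        finally show ?thesis .
      qed
      then show ?thesis using e C by (intro exI[of _ "e / C"]) auto
    qed
  qed (use mem one orbit in auto)
qed

section \<open>The unitary group of a finite-dimensional C*-algebra\<close>

lemma closed_self_adjoints: "closed (self_adjoints :: 'a::unital_cstar_algebra set)"
  unfolding self_adjoints_def by (intro closed_Collect_eq continuous_intros)

lemma closed_unitaries: "closed (unitaries :: 'a::unital_cstar_algebra set)"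
  unfolding unitaries_def by (intro closed_Collect_conj closed_Collect_eq continuous_intros)

lemma topological_group_unitary_group:
  "topological_group (unitary_group :: 'a::unital_cstar_algebra monoid) (top_of_set unitaries)"
proof -
  let ?U = "unitaries :: 'a set"
  interpret group "unitary_group :: 'a monoid" by (rule group_unitary_group)
  have "continuous_map (top_of_set ?U) (top_of_set ?U) star"
    unfolding continuous_map_subtopology_eu
    by (auto simp: unitaries_def star_star intro!: continuous_intros)
  then have "continuous_map (top_of_set ?U) (top_of_set ?U) (\<lambda>x. inv\<^bsub>unitary_group\<^esub> x)"
    by (rule continuous_map_eq) (simp add: inv_unitary_group)
  moreover have "continuous_map (top_of_set (?U \<times> ?U)) (top_of_set ?U) (\<lambda>(x, y). x * y)"
    unfolding continuous_map_subtopology_eu case_prod_unfold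
    using m_closed by (auto intro!: continuous_intros)
  ultimately show ?thesis
    using group_unitary_group[where 'a = 'a] by (simp add: topological_group_def)
qed

lemma (in minimal_projections) inj_sequence_code:
  obtains c :: "'a \<Rightarrow> nat \<Rightarrow> real" where "inj c"
proof -
  obtain n and l :: "nat \<Rightarrow> 'a \<Rightarrow> real" where
    l: "\<And>k. k < n \<Longrightarrow> bounded_linear (l k)" "\<And>x. norm x \<le> (\<Sum>k<n. \<bar>l k x\<bar>)"
    using coordinate_functionals by metis
  have "inj (\<lambda>x k. if k < n then l k x else 0)"
  proof (rule injI)
    fix x y assume eq: "(\<lambda>k. if k < n then l k x else 0) = (\<lambda>k. if k < n then l k y else 0)"
    have "l k (x - y) = 0" if "k < n" for k
      using fun_cong[OF eq, of k] that l(1)[OF that] by (simp add: linear_diff bounded_linear.linear)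
    then show "x = y" using l(2)[of "x - y"] by simp
  qed
  then show ?thesis by (rule that)
qed

text \<open>
  Left multiplication by a unitary preserves the trace inner product, whose norm is equivalent
  to the norm of the algebra. The orbit of 1 is the unitary group itself.
\<close>

theorem (in minimal_projections) unitary_group_representable:
  fixes \<iota> :: "real \<Rightarrow> 'h"
  assumes \<iota>: "inj \<iota>"
  shows "strongly_unitarily_representable TYPE('h) (unitary_group :: 'a monoid) (top_of_set unitaries)"
proof -
  obtain c :: "'a \<Rightarrow> nat \<Rightarrow> real" where c: "inj c" by (rule inj_sequence_code)
  obtain \<phi> :: "(nat \<Rightarrow> real) \<Rightarrow> real" where \<phi>: "inj \<phi>"
    using inj_nat_real_functions by blast
  define code where "code x = \<iota> (\<phi> (c x))" for x
  have code: "code x = code y \<longleftrightarrow> x = y" for x y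
    using \<iota> \<phi> c by (simp add: code_def inj_eq)
  \<comment> \<open>One constant for both norm inequalities; the summand 1 keeps it positive in the zero algebra.\<close>
  let ?C = "sqrt (card P) + 1"
  have C: "0 < ?C" by (simp add: add_nonneg_pos)
  let ?t = "\<lambda>x. sqrt (Re (trace_inner x x))"
  have t0: "0 \<le> ?t x" for x by (simp add: trace_inner_self sum_nonneg)
  have t1: "norm x \<le> ?C * ?t x" for x
    using norm_le_trace_norm[of x] t0[of x] unfolding distrib_right by linarith
  have t2: "?t x \<le> ?C * norm x" for x
    using trace_norm_le[of x] by (simp add: distrib_right add_increasing2)
  interpret hilbert_presentation UNIV scaleC trace_inner code
  proof
    show "0 < Re (trace_inner x x)" if "code x \<noteq> code 0" for x
      using that t1[of x] t0[of x] code by (metis less_eq_real_def mult_zero_right norm_le_zero_iff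
          real_sqrt_gt_0_iff)
    fix X :: "nat \<Rightarrow> 'a"
    assume X: "\<And>e. 0 < e \<Longrightarrow> \<exists>N. \<forall>m\<ge>N. \<forall>n\<ge>N. ?t (X m - X n) < e"
    have "Cauchy X"
    proof (rule metric_CauchyI)
      fix e :: real assume e: "0 < e"
      then obtain N where N: "\<And>m n. N \<le> m \<Longrightarrow> N \<le> n \<Longrightarrow> ?t (X m - X n) < e / ?C"
        using X[of "e / ?C"] C by auto
      have "dist (X m) (X n) < e" if "N \<le> m" "N \<le> n" for m n
      proof -
        have "norm (X m - X n) \<le> ?C * ?t (X m - X n)" by (rule t1)
        also have "\<dots> < e" using N[OF that] C by (simp add: pos_less_divide_eq mult.commute)
        finally show ?thesis by (simp add: dist_norm)
      qed
      then show "\<exists>N. \<forall>m\<ge>N. \<forall>n\<ge>N. dist (X m) (X n) < e" by blast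
    qed
    then obtain l where l: "X \<longlonglongrightarrow> l" using Cauchy_convergent convergent_def by blast
    have "\<exists>N. \<forall>n\<ge>N. ?t (X n - l) < e" if e: "0 < e" for e
    proof -
      obtain N where N: "\<And>n. N \<le> n \<Longrightarrow> norm (X n - l) < e / ?C"
        using l e C unfolding LIMSEQ_iff by (meson divide_pos_pos)
      have "?t (X n - l) < e" if "N \<le> n" for n
      proof -
        have "?t (X n - l) \<le> ?C * norm (X n - l)" by (rule t2)
        also have "\<dots> < e" using N[OF that] C by (simp add: pos_less_divide_eq mult.commute)
        finally show ?thesis .
      qed
      then show ?thesis by blast
    qed
    then show "\<exists>l\<in>UNIV. \<forall>e>0. \<exists>N. \<forall>n\<ge>N. ?t (X n - l) < e" by blast
  qed (simp_all add: code scaleC_add_right scaleC_add_left scaleC_scaleC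
      trace_inner_add_left trace_inner_scaleC_left trace_inner_commute[symmetric])
  have nrm1: "norm x \<le> ?C * nrm x" and nrm2: "nrm x \<le> ?C * norm x" for x
    using t1 t2 by (simp_all add: nrm_def)
  show ?thesis
  proof (rule representable_if_uniform_orbit[where \<pi> = "(*)" and v = 1])
    show "topological_group (unitary_group :: 'a monoid) (top_of_set unitaries)"
      by (rule topological_group_unitary_group)
    show "complete (unitaries :: 'a set)" using closed_unitaries by (simp add: complete_eq_closed)
    show "trace_inner (g * x) (g * y) = trace_inner x y" if "g \<in> unitaries" for g x y
      using that by (simp add: unitaries_def trace_inner_unitary)
    show "\<exists>d>0. \<forall>h\<in>unitaries. dist h g < d \<longrightarrow> nrm (h * x - g * x) < e"
      if e: "0 < e" for g x :: 'a and e
    proof -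
      define D where "D = ?C * norm x + 1"
      have D: "0 < D" using C by (simp add: D_def add_nonneg_pos)
      have "nrm (h * x - g * x) < e" if "dist h g < e / D" for h
      proof -
        have "nrm (h * x - g * x) \<le> ?C * norm ((h - g) * x)"
          using nrm2[of "h * x - g * x"] by (simp add: left_diff_distrib)
        also have "\<dots> \<le> ?C * (norm (h - g) * norm x)"
          using C by (intro mult_left_mono norm_mult_ineq) simp
        also have "\<dots> = ?C * norm x * norm (h - g)" by (simp add: ac_simps)
        also have "\<dots> \<le> D * norm (h - g)" by (intro mult_right_mono) (simp_all add: D_def)
        also have "\<dots> < e" using that D by (simp add: dist_norm pos_less_divide_eq mult.commute)
        finally show ?thesis .
      qed
      then show ?thesis using e D by (intro exI[of _ "e / D"]) auto
    qed
    show "\<exists>d>0. \<forall>g\<in>unitaries. \<forall>h\<in>unitaries. nrm (g * 1 - h * 1) < d \<longrightarrow> dist g h < e"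
      if e: "0 < e" for e
    proof -
      have "dist g h < e" if "nrm (g * 1 - h * 1) < e / ?C" for g h :: 'a
      proof -
        have "norm (g - h) \<le> ?C * nrm (g - h)" by (rule nrm1)
        also have "\<dots> < e" using that C by (simp add: pos_less_divide_eq mult.commute)
        finally show ?thesis by (simp add: dist_norm)
      qed
      then show ?thesis using e C by (intro exI[of _ "e / ?C"]) auto
    qed
  qed (simp_all add: distrib_left scaleC_mult_right mult.assoc)
qed

section \<open>The equivalence\<close>

theorem theorem3p3:
  assumes "\<exists>\<iota> :: real \<Rightarrow> 'h. inj \<iota>"
  shows
    "(strongly_unitarily_representable TYPE('h)
        (additive_group (UNIV :: 'a::unital_cstar_algebra set)) (euclidean :: 'a topology)
      \<longleftrightarrow>
      strongly_unitarily_representable TYPE('h)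
        (additive_group (self_adjoints :: 'a set)) (top_of_set (self_adjoints :: 'a set))) \<and>
     (strongly_unitarily_representable TYPE('h)
        (additive_group (self_adjoints :: 'a set)) (top_of_set (self_adjoints :: 'a set))
      \<longleftrightarrow>
      strongly_unitarily_representable TYPE('h)
        (unitary_group :: 'a monoid) (top_of_set (unitaries :: 'a set))) \<and>
     (strongly_unitarily_representable TYPE('h)
        (unitary_group :: 'a monoid) (top_of_set (unitaries :: 'a set))
      \<longleftrightarrow>
      finite_dimensional TYPE('a))"
proof -
  obtain \<iota> :: "real \<Rightarrow> 'h" where \<iota>: "inj \<iota>" using assms by blast
  have additive: "strongly_unitarily_representable TYPE('h) (additive_group S) (top_of_set S)
      \<longleftrightarrow> finite_dimensional TYPE('a)"
    if S: "self_adjoints \<subseteq> S" "closed S" "\<And>x y. x \<in> S \<Longrightarrow> y \<in> S \<Longrightarrow> x + y \<in> S"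
      "\<And>x. x \<in> S \<Longrightarrow> - x \<in> S" for S :: "'a set"
  proof
    assume "finite_dimensional TYPE('a)"
    then obtain P :: "'a set" where "minimal_projections P"
      using finite_dimensional_iff_minimal_projections by blast
    then interpret minimal_projections P .
    obtain n and l :: "nat \<Rightarrow> 'a \<Rightarrow> real" where
      l: "\<And>k. k < n \<Longrightarrow> bounded_linear (l k)" "\<And>x. norm x \<le> (\<Sum>k<n. \<bar>l k x\<bar>)"
      using coordinate_functionals by metis
    have "0 \<in> S" using S(1) by (auto simp: self_adjoints_def)
    then show "strongly_unitarily_representable TYPE('h) (additive_group S) (top_of_set S)"
      using S(2-4) l by (intro additive_group_representable[OF \<iota>, of S n l])
  qed (rule finite_dimensional_if_additive_group_representable[OF _ S(1)])
  have "strongly_unitarily_representable TYPE('h) (additive_group (UNIV :: 'a set)) (top_of_set UNIV)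
      \<longleftrightarrow> finite_dimensional TYPE('a)"
    by (rule additive) auto
  moreover have "strongly_unitarily_representable TYPE('h)
        (additive_group (self_adjoints :: 'a set)) (top_of_set self_adjoints)
      \<longleftrightarrow> finite_dimensional TYPE('a)"
    by (rule additive) (auto simp: closed_self_adjoints, auto simp: self_adjoints_def star_add star_minus)
  moreover have "strongly_unitarily_representable TYPE('h)
        (unitary_group :: 'a monoid) (top_of_set unitaries) \<longleftrightarrow> finite_dimensional TYPE('a)"
    using finite_dimensional_if_unitary_group_representable
      minimal_projections.unitary_group_representable[OF _ \<iota>]
    by (metis finite_dimensional_iff_minimal_projections)
  ultimately show ?thesis by simp
qed

end
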